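(* Let $e\in C([0,T],L^2(\Omega))$ satisfy $$T_hP(\partial_t)e(t)+e(t)=\rho(t),\quad t>0,\qquad T_he(0)=0,$$ where $P(\partial_t)=\partial_t^{\alpha}+\sum_{i=1}^m b_i\partial_t^{\alpha_i}$ with $0<\alpha_m\le\cdots\le\alpha_1\le\alpha<1$ and $b_i>0$ for $i=1,\dots,m$. Then there is a constant $C$, independent of $h$, $t$, $e$ and $\rho$, such that for $t\in(0,T]$, $$\|e(t)\|\le C\,t^{-1}\sup_{s\le t}\left(\|\tilde\rho(s)\|+s\|\rho(s)\|+s^2\|\rho_t(s)\|\right),\qquad \tilde\rho(s):=\int_0^s\rho(\xi)\,d\xi .$$
   Context: $\Omega\subset\mathbb R^2$ is a bounded domain, $T>0$ is fixed, and $(\cdot,\cdot)$, $\|\cdot\|$ are the inner product and norm of $L^2(\Omega)$. For $0<\nu<1$ the Caputo derivative of order $\nu$ in time is $\partial_t^\nu\varphi(t)=\int_0^t\omega_{1-\nu}(t-s)\varphi'(s)\,ds=\frac{d}{dt}\int_0^t\omega_{1-\nu}(t-s)(\varphi(s)-\varphi(0))\,ds$, where $\omega_\mu(t)=t^{\mu-1}/\Gamma(\mu)$. $V_h\subset L^2(\Omega)$, $0<h<1$, is a family of finite-dimensional subspaces, and $T_h:L^2(\Omega)\to V_h$ is a corresponding family of linear operators that are selfadjoint and positive semidefinite on $L^2(\Omega)$ and positive definite on $V_h$. $\rho$ is an $L^2(\Omega)$-valued function of $t$ with time derivative $\rho_t$. Functions of time are understood to be regular enough in $t$ for all displayed expressions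 to make sense and to be (locally) absolutely continuous where their time derivatives appear. Constants $C$ may depend on $T$, $\alpha$, the $\alpha_i$ and the $b_i$, but not on $h$. *)

theory Defs
  imports "HOL-Analysis.Analysis"
begin

section \<open>The Hilbert space of square-integrable functions on a planar domain\<close>

definition square_integrable :: "(real^2 \<Rightarrow> real) \<Rightarrow> bool" where
  "square_integrable f \<longleftrightarrow>
     f \<in> borel_measurable lebesgue \<and> integrable lebesgue (\<lambda>x. (f x)\<^sup>2)"

lemma square_integrable_mult:
  assumes "square_integrable f" "square_integrable g"
  shows "integrable lebesgue (\<lambda>x. f x * g x)"
proof (rule Bochner_Integration.integrable_bound[where f = "\<lambda>x. (f x)\<^sup>2 + (g x)\<^sup>2"])
  show "integrable lebesgue (\<lambda>x. (f x)\<^sup>2 + (g x)\<^sup>2)"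
    using assms by (auto simp: square_integrable_def)
  show "(\<lambda>x. f x * g x) \<in> borel_measurable lebesgue"
    using assms by (auto simp: square_integrable_def)
  have "norm (a * b) \<le> norm (a\<^sup>2 + b\<^sup>2)" for a b :: real
  proof -
    have "0 \<le> (\<bar>a\<bar> - \<bar>b\<bar>)\<^sup>2" by simp
    then have "2 * (\<bar>a\<bar> * \<bar>b\<bar>) \<le> a\<^sup>2 + b\<^sup>2" by (simp add: power2_diff)
    moreover have "0 \<le> \<bar>a\<bar> * \<bar>b\<bar>" by simp
    ultimately have "\<bar>a\<bar> * \<bar>b\<bar> \<le> a\<^sup>2 + b\<^sup>2" by linarith
    then show ?thesis by (simp add: abs_mult)
  qed
  then show "AE x in lebesgue. norm (f x * g x) \<le> norm ((f x)\<^sup>2 + (g x)\<^sup>2)" by simp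
qed

lemma square_integrable_scale:
  assumes "square_integrable f" shows "square_integrable (\<lambda>x. c * f x)"
  using assms by (auto simp: square_integrable_def power_mult_distrib)

lemma square_integrable_add:
  assumes "square_integrable f" "square_integrable g"
  shows "square_integrable (\<lambda>x. f x + g x)"
proof -
  have "integrable lebesgue (\<lambda>x. (f x)\<^sup>2 + (g x)\<^sup>2 + 2 * (f x * g x))"
    using assms square_integrable_mult[OF assms]
    by (intro Bochner_Integration.integrable_add integrable_mult_right)
       (auto simp: square_integrable_def)
  moreover have "(\<lambda>x. (f x)\<^sup>2 + (g x)\<^sup>2 + 2 * (f x * g x)) = (\<lambda>x. (f x + g x)\<^sup>2)"
    by (simp add: power2_sum mult.assoc)
  ultimately show ?thesis
    using assms by (auto simp: square_integrable_def)
qed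

definition ae_equal :: "(real^2 \<Rightarrow> real) \<Rightarrow> (real^2 \<Rightarrow> real) \<Rightarrow> bool" where
  "ae_equal f g \<longleftrightarrow>
     square_integrable f \<and> square_integrable g \<and> (AE x in lebesgue. f x = g x)"

text \<open>\<open>l2_plane\<close> is the space \<open>L\<^sup>2(\<real>\<^sup>2)\<close> of almost-everywhere classes.  Types cannot depend
  on the domain \<open>\<Omega>\<close>, so \<open>L\<^sup>2(\<Omega>)\<close> appears below as the closed subspace of the classes that
  vanish almost everywhere outside \<open>\<Omega>\<close> (isometric extension by zero).\<close>

quotient_type l2_plane = "real^2 \<Rightarrow> real" / partial: ae_equal
proof (rule part_equivpI)
  show "\<exists>f. ae_equal f f"
    by (rule exI[of _ "\<lambda>_. 0"]) (auto simp: ae_equal_def square_integrable_def)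
  show "symp ae_equal"
    by (rule sympI) (auto simp: ae_equal_def elim: AE_mp)
  show "transp ae_equal"
  proof (rule transpI)
    fix f g h assume "ae_equal f g" "ae_equal g h"
    then show "ae_equal f h"
      by (auto simp: ae_equal_def elim: AE_mp)
  qed
qed

lift_definition in_L2 :: "(real^2) set \<Rightarrow> l2_plane \<Rightarrow> bool" is
  "\<lambda>\<Omega> f. AE x in lebesgue. x \<notin> \<Omega> \<longrightarrow> f x = 0"
proof -
  fix \<Omega> :: "(real^2) set" and f g :: "real^2 \<Rightarrow> real"
  assume "ae_equal f g"
  then have "AE x in lebesgue. f x = g x" by (simp add: ae_equal_def)
  then have "AE x in lebesgue. (x \<notin> \<Omega> \<longrightarrow> f x = 0) \<longleftrightarrow> (x \<notin> \<Omega> \<longrightarrow> g x = 0)"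
    by (rule eventually_mono) simp
  then show "(AE x in lebesgue. x \<notin> \<Omega> \<longrightarrow> f x = 0) \<longleftrightarrow> (AE x in lebesgue. x \<notin> \<Omega> \<longrightarrow> g x = 0)"
    by (rule eventually_cong)
qed

definition L2 :: "(real^2) set \<Rightarrow> l2_plane set" where
  "L2 \<Omega> = {u. in_L2 \<Omega> u}"

instantiation l2_plane :: real_inner
begin

lift_definition zero_l2_plane :: l2_plane is "\<lambda>_. 0"
  by (auto simp: ae_equal_def square_integrable_def)

lift_definition plus_l2_plane :: "l2_plane \<Rightarrow> l2_plane \<Rightarrow> l2_plane" is "\<lambda>f g x. f x + g x"
  by (auto simp: ae_equal_def intro: square_integrable_add elim: AE_mp)

lift_definition scaleR_l2_plane :: "real \<Rightarrow> l2_plane \<Rightarrow> l2_plane" is "\<lambda>c f x. c * f x"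
  by (auto simp: ae_equal_def intro: square_integrable_scale elim: AE_mp)

lift_definition inner_l2_plane :: "l2_plane \<Rightarrow> l2_plane \<Rightarrow> real" is
  "\<lambda>f g. LINT x|lebesgue. f x * g x"
proof -
  fix f f' g g' assume *: "ae_equal f f'" "ae_equal g g'"
  then have "AE x in lebesgue. f x = f' x" "AE x in lebesgue. g x = g' x"
    by (simp_all add: ae_equal_def)
  then have "AE x in lebesgue. f x * g x = f' x * g' x" by eventually_elim simp
  then show "(LINT x|lebesgue. f x * g x) = (LINT x|lebesgue. f' x * g' x)"
    using * by (intro integral_cong_AE) (auto simp: ae_equal_def square_integrable_def)
qed

definition uminus_l2_plane :: "l2_plane \<Rightarrow> l2_plane" where "- (u :: l2_plane) = (-1) *\<^sub>R u"
definition minus_l2_plane :: "l2_plane \<Rightarrow> l2_plane \<Rightarrow> l2_plane" where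
  "(u :: l2_plane) - v = u + (- v)"
definition norm_l2_plane :: "l2_plane \<Rightarrow> real" where 
  "norm (u :: l2_plane) = sqrt (inner u u)"
definition sgn_l2_plane :: "l2_plane \<Rightarrow> l2_plane" where 
  "sgn (u :: l2_plane) = inverse (norm u) *\<^sub>R u"
definition dist_l2_plane :: "l2_plane \<Rightarrow> l2_plane \<Rightarrow> real" where
  "dist (u :: l2_plane) v = norm (u - v)"
definition uniformity_l2_plane :: "(l2_plane \<times> l2_plane) filter" where
  "(uniformity :: (l2_plane \<times> l2_plane) filter) =
     (INF e\<in>{0 <..}. principal {(u, v). dist u v < e})"
definition open_l2_plane :: "l2_plane set \<Rightarrow> bool" where
  "open (U :: l2_plane set) \<longleftrightarrow>
     (\<forall>u\<in>U. eventually (\<lambda>(u', v). u' = u \<longrightarrow> v \<in> U) uniformity)"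

instance
proof
  fix u v w :: l2_plane and a b :: real
  show *: "u + v + w = u + (v + w)"
    by transfer (auto simp: ae_equal_def add.assoc intro: square_integrable_add)
  show "u + v = v + u"
    by transfer (auto simp: ae_equal_def add.commute intro: square_integrable_add)
  show "0 + u = u"
    by transfer (auto simp: ae_equal_def)
  show "- u + u = 0"
    unfolding uminus_l2_plane_def
    by transfer (auto simp: ae_equal_def square_integrable_def)
  show "u - v = u + - v" by (simp add: minus_l2_plane_def)
  show "a *\<^sub>R (u + v) = a *\<^sub>R u + a *\<^sub>R v"
    by transfer (auto simp: ae_equal_def algebra_simps
          intro!: square_integrable_add square_integrable_scale)
  show "(a + b) *\<^sub>R u = a *\<^sub>R u + b *\<^sub>R u"
    by transfer (auto simp: ae_equal_def distrib_right
          intro!: square_integrable_add square_integrable_scale)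
  show "a *\<^sub>R b *\<^sub>R u = (a * b) *\<^sub>R u"
    by transfer (auto simp: ae_equal_def mult.assoc intro!: square_integrable_scale)
  show "1 *\<^sub>R u = u"
    by transfer (auto simp: ae_equal_def)
  show "sgn u = inverse (norm u) *\<^sub>R u" by (simp add: sgn_l2_plane_def)
  show "dist u v = norm (u - v)" by (simp add: dist_l2_plane_def)
  show "(uniformity :: (l2_plane \<times> l2_plane) filter) =
     (INF e\<in>{0 <..}. principal {(u, v). dist u v < e})" by (rule uniformity_l2_plane_def)
  show "open U \<longleftrightarrow> (\<forall>u\<in>U. eventually (\<lambda>(u', v). u' = u \<longrightarrow> v \<in> U) uniformity)" for U :: "l2_plane set"
    by (rule open_l2_plane_def)
  show "inner u v = inner v u"
    by transfer (simp add: mult.commute)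
  show "inner (u + v) w = inner u w + inner v w"
    by transfer (auto simp: ae_equal_def distrib_right
          intro!: Bochner_Integration.integral_add square_integrable_mult)
  show "inner (a *\<^sub>R u) v = a * inner u v"
    by transfer (simp add: mult.assoc)
  show "0 \<le> inner u u"
    by transfer simp
  show "inner u u = 0 \<longleftrightarrow> u = 0"
  proof transfer
    fix f assume f: "ae_equal f f"
    then have "integrable lebesgue (\<lambda>x. f x * f x)"
      by (auto simp: ae_equal_def intro: square_integrable_mult)
    then have "(LINT x|lebesgue. f x * f x) = 0 \<longleftrightarrow> (AE x in lebesgue. f x * f x = 0)"
      by (intro integral_nonneg_eq_0_iff_AE) auto
    then show "(LINT x|lebesgue. f x * f x) = 0 \<longleftrightarrow> ae_equal f (\<lambda>_. 0)"
      using f by (auto simp: ae_equal_def square_integrable_def)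
  qed
  show "norm u = sqrt (inner u u)" by (simp add: norm_l2_plane_def)
qed

end

lemma norm_abs_l2_plane:
  assumes "square_integrable f"
  shows "norm (abs_l2_plane f) = sqrt (LINT x|lebesgue. (f x)\<^sup>2)"
  using assms
  by (simp add: norm_l2_plane_def inner_l2_plane.abs_eq ae_equal_def power2_eq_square)

lemma diff_abs_l2_plane:
  assumes "square_integrable f" "square_integrable g"
  shows "abs_l2_plane f - abs_l2_plane g = abs_l2_plane (\<lambda>x. f x - g x)"
proof -
  have m: "ae_equal (\<lambda>x. - 1 * g x) (\<lambda>x. - 1 * g x)"
    using square_integrable_scale[OF assms(2), of "- 1"] by (simp only: ae_equal_def) simp
  have "abs_l2_plane f - abs_l2_plane g = abs_l2_plane (\<lambda>x. f x + - 1 * g x)"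
    unfolding minus_l2_plane_def uminus_l2_plane_def
    by (subst scaleR_l2_plane.abs_eq, use assms in \<open>simp add: ae_equal_def\<close>,
        rule plus_l2_plane.abs_eq[OF _ m], use assms in \<open>simp add: ae_equal_def\<close>)
  then show ?thesis by simp
qed

lemma square_integrable_diff:
  assumes "square_integrable f" "square_integrable g"
  shows "square_integrable (\<lambda>x. f x - g x)"
  using square_integrable_add[OF assms(1) square_integrable_scale[OF assms(2), of "-1"]] by simp

lemma l2_plane_rep:
  obtains f where "square_integrable f" "abs_l2_plane f = u"
  using Quotient_rep_reflp[OF Quotient_l2_plane] Quotient_abs_rep[OF Quotient_l2_plane]
  by (metis ae_equal_def)

lemma nn_integral_square_l2_plane:
  assumes "square_integrable f"
  shows "(\<integral>\<^sup>+x. ennreal ((f x)\<^sup>2) \<partial>lebesgue) = ennreal ((norm (abs_l2_plane f))\<^sup>2)"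
  using assms by (simp add: norm_abs_l2_plane square_integrable_def nn_integral_eq_integral)

instance l2_plane :: complete_space
proof
  fix X :: "nat \<Rightarrow> l2_plane" assume X: "Cauchy X"
  have "\<forall>n. \<exists>f. square_integrable f \<and> abs_l2_plane f = X n"
    using l2_plane_rep by metis
  then obtain F where F: "\<And>n. square_integrable (F n)" "\<And>n. abs_l2_plane (F n) = X n"
    by metis
  have [measurable]: "F n \<in> borel_measurable lebesgue" for n
    using F(1)[of n] by (simp add: square_integrable_def)
  have FF: "(\<integral>\<^sup>+x. ennreal ((F m x - F n x)\<^sup>2) \<partial>lebesgue) = ennreal ((norm (X m - X n))\<^sup>2)" for m n
    using nn_integral_square_l2_plane[OF square_integrable_diff[OF F(1) F(1)], of m n]
    by (simp add: F(2) diff_abs_l2_plane[OF F(1) F(1), symmetric])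
  have "\<exists>N. \<forall>m\<ge>N. \<forall>n\<ge>N. norm (X m - X n) < (1/2)^k" for k
    using CauchyD[OF X, of "(1/2)^k"] by simp
  then obtain N where N: "\<And>k m n. m \<ge> N k \<Longrightarrow> n \<ge> N k \<Longrightarrow> norm (X m - X n) < (1/2)^k"
    by metis
  define r where "r = rec_nat (N 0) (\<lambda>k p. max (Suc p) (N (Suc k)))"
  have r_Suc: "r (Suc k) = max (Suc (r k)) (N (Suc k))" for k by (simp add: r_def)
  have r_N: "r k \<ge> N k" for k by (cases k) (simp_all add: r_def)
  have r_mono: "strict_mono r" by (simp add: strict_mono_Suc_iff r_Suc less_max_iff_disj)
  define d where "d k x = F (r (Suc k)) x - F (r k) x" for k x
  have [measurable]: "d k \<in> borel_measurable lebesgue" for k unfolding d_def by measurable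
  have d_le: "(\<integral>\<^sup>+x. ennreal (2^k * (d k x)\<^sup>2) \<partial>lebesgue) \<le> ennreal ((1/2)^k)" for k
  proof -
    have "norm (X (r (Suc k)) - X (r k)) < (1/2)^k"
      by (rule N) (use r_N[of k] in \<open>auto simp: r_Suc\<close>)
    then have "(norm (X (r (Suc k)) - X (r k)))\<^sup>2 \<le> ((1/2)^k)\<^sup>2"
      by (intro power_mono) auto
    then have "2^k * (norm (X (r (Suc k)) - X (r k)))\<^sup>2 \<le> 2^k * ((1/2)^k)\<^sup>2"
      by (intro mult_left_mono) auto
    also have "2^k * ((1/2)^k)\<^sup>2 = ((1/2)::real)^k"
      by (simp add: power2_eq_square power_divide)
    finally have *: "2^k * (norm (X (r (Suc k)) - X (r k)))\<^sup>2 \<le> (1/2)^k" .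
    have "(\<integral>\<^sup>+x. ennreal (2^k * (d k x)\<^sup>2) \<partial>lebesgue)
        = (\<integral>\<^sup>+x. ennreal (2^k) * ennreal ((d k x)\<^sup>2) \<partial>lebesgue)"
      by (simp only: ennreal_mult[symmetric] zero_le_power2 zero_le_power zero_le_numeral)
    also have "\<dots> = ennreal (2^k) * (\<integral>\<^sup>+x. ennreal ((d k x)\<^sup>2) \<partial>lebesgue)"
      by (rule nn_integral_cmult) simp
    also have "\<dots> = ennreal (2^k * (norm (X (r (Suc k)) - X (r k)))\<^sup>2)"
      unfolding d_def FF by (rule ennreal_mult[symmetric]) auto
    finally show ?thesis using * by (simp add: ennreal_leI)
  qed
  have "(\<integral>\<^sup>+x. (\<Sum>k. ennreal (2^k * (d k x)\<^sup>2)) \<partial>lebesgue)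
      = (\<Sum>k. \<integral>\<^sup>+x. ennreal (2^k * (d k x)\<^sup>2) \<partial>lebesgue)"
    by (rule nn_integral_suminf) measurable
  also have "\<dots> \<le> (\<Sum>k. ennreal ((1/2)^k))"
    by (intro suminf_le d_le summableI)
  also have "\<dots> < \<infinity>"
    by (subst suminf_ennreal2) (auto intro: summable_geometric)
  finally have "(\<integral>\<^sup>+x. (\<Sum>k. ennreal (2^k * (d k x)\<^sup>2)) \<partial>lebesgue) \<noteq> \<infinity>" by simp
  then have "AE x in lebesgue. (\<Sum>k. ennreal (2^k * (d k x)\<^sup>2)) \<noteq> \<infinity>"
    by (intro nn_integral_noteq_infinite) measurable
  then have conv: "AE x in lebesgue. convergent (\<lambda>k. F (r k) x)"
  proof eventually_elim
    case (elim x)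
    then have "summable (\<lambda>k. 2^k * (d k x)\<^sup>2)"
      by (intro summable_suminf_not_top) auto
    then have s: "summable (\<lambda>k. 2^k * (d k x)\<^sup>2 + (1/2)^k)"
      by (intro summable_add summable_geometric) auto
    have "norm (d k x) \<le> 2^k * (d k x)\<^sup>2 + (1/2)^k" for k
    proof (cases "\<bar>d k x\<bar> \<le> (1/2)^k")
      case True
      then show ?thesis by (simp add: add_increasing)
    next
      case False
      then have "2^k * ((1/2)^k) * \<bar>d k x\<bar> \<le> 2^k * \<bar>d k x\<bar> * \<bar>d k x\<bar>"
        by (intro mult_right_mono mult_left_mono) auto
      then show ?thesis by (simp add: power2_eq_square power_divide mult.assoc add_increasing2)
    qed
    then have "summable (\<lambda>k. d k x)"
      using summable_comparison_test'[OF s, of 0 "\<lambda>k. d k x"] by blast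
    then have "convergent (\<lambda>n. F (r 0) x + (\<Sum>k<n. d k x))"
      by (intro convergent_add convergent_const) (simp add: summable_iff_convergent)
    moreover have "F (r 0) x + (\<Sum>k<n. d k x) = F (r n) x" for n
      by (induction n) (auto simp: d_def)
    ultimately show ?case by simp
  qed
  define f where "f x = lim (\<lambda>k. F (r k) x)" for x
  have [measurable]: "f \<in> borel_measurable lebesgue"
    unfolding f_def by (rule borel_measurable_lim_metric) measurable
  have lim: "AE x in lebesgue. (\<lambda>k. F (r k) x) \<longlonglongrightarrow> f x"
    using conv by eventually_elim (simp add: f_def convergent_LIMSEQ_iff)
  have bound: "(\<integral>\<^sup>+x. ennreal ((f x - F n x)\<^sup>2) \<partial>lebesgue) \<le> ennreal (((1/2)^k)\<^sup>2)" if n: "n \<ge> N k" for n k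
  proof -
    have "(\<integral>\<^sup>+x. ennreal ((f x - F n x)\<^sup>2) \<partial>lebesgue)
        = (\<integral>\<^sup>+x. liminf (\<lambda>j. ennreal ((F (r j) x - F n x)\<^sup>2)) \<partial>lebesgue)"
    proof (rule nn_integral_cong_AE)
      show "AE x in lebesgue. ennreal ((f x - F n x)\<^sup>2) = liminf (\<lambda>j. ennreal ((F (r j) x - F n x)\<^sup>2))"
        using lim
      proof eventually_elim
        case (elim x)
        then have "(\<lambda>j. ennreal ((F (r j) x - F n x)\<^sup>2)) \<longlonglongrightarrow> ennreal ((f x - F n x)\<^sup>2)"
          by (intro tendsto_ennrealI tendsto_intros)
        then show ?case by (intro lim_imp_Liminf[OF sequentially_bot, symmetric])
      qed
    qed
    also have "\<dots> \<le> liminf (\<lambda>j. \<integral>\<^sup>+x. ennreal ((F (r j) x - F n x)\<^sup>2) \<partial>lebesgue)"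
      by (rule nn_integral_liminf) measurable
    also have "\<dots> \<le> ennreal (((1/2)^k)\<^sup>2)"
    proof (rule Liminf_le)
      have "\<forall>\<^sub>F j in sequentially. j \<ge> N k" by (rule eventually_ge_at_top)
      then show "\<forall>\<^sub>F j in sequentially.
          (\<integral>\<^sup>+x. ennreal ((F (r j) x - F n x)\<^sup>2) \<partial>lebesgue) \<le> ennreal (((1/2)^k)\<^sup>2)"
      proof eventually_elim
        case (elim j)
        then have "r j \<ge> N k" using strict_mono_imp_increasing[OF r_mono, of j] by simp
        then have "norm (X (r j) - X n) < (1/2)^k" using n by (intro N)
        then show ?case unfolding FF by (intro ennreal_leI power_mono) auto
      qed
    qed simp
    finally show ?thesis .
  qed
  have sq: "square_integrable (\<lambda>x. f x - F n x)" if "n \<ge> N k" for n k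
    unfolding square_integrable_def
  proof
    show "(\<lambda>x. f x - F n x) \<in> borel_measurable lebesgue" by measurable
    show "integrable lebesgue (\<lambda>x. (f x - F n x)\<^sup>2)"
    proof (rule integrableI_bounded)
      show "(\<lambda>x. (f x - F n x)\<^sup>2) \<in> borel_measurable lebesgue" by measurable
      have "(\<integral>\<^sup>+x. ennreal (norm ((f x - F n x)\<^sup>2)) \<partial>lebesgue) \<le> ennreal (((1/2)^k)\<^sup>2)"
        using bound[OF that] by (simp only: real_norm_def abs_power2)
      also have "\<dots> < \<infinity>" by simp
      finally show "(\<integral>\<^sup>+x. ennreal (norm ((f x - F n x)\<^sup>2)) \<partial>lebesgue) < \<infinity>" .
    qed
  qed
  have sqf: "square_integrable f"
    using square_integrable_add[OF sq[OF order_refl[of "N 0"]] F(1)[of "N 0"]] by simp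
  have "X \<longlonglongrightarrow> abs_l2_plane f"
  proof (rule LIMSEQ_I)
    fix e :: real assume "e > 0"
    then obtain k where k: "(1/2)^k < e"
      using real_arch_pow_inv[of e "1/2"] by auto
    show "\<exists>n0. \<forall>n\<ge>n0. norm (X n - abs_l2_plane f) < e"
    proof (intro exI allI impI)
      fix n assume n: "n \<ge> N k"
      have "ennreal ((norm (abs_l2_plane f - X n))\<^sup>2) \<le> ennreal (((1/2)^k)\<^sup>2)"
        using bound[OF n] nn_integral_square_l2_plane[OF sq[OF n]]
        by (simp add: F(2)[symmetric] diff_abs_l2_plane[OF sqf F(1)])
      then have "(norm (abs_l2_plane f - X n))\<^sup>2 \<le> ((1/2)^k)\<^sup>2"
        by (subst (asm) ennreal_le_iff) auto
      then have "norm (abs_l2_plane f - X n) \<le> (1/2)^k"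
        by (rule power2_le_imp_le) auto
      then show "norm (X n - abs_l2_plane f) < e" using k by (simp add: norm_minus_commute)
    qed
  qed
  then show "convergent X" by (rule convergentI)
qed

instance l2_plane :: banach ..


section \<open>Functions of time\<close>

definition absolutely_continuous_on :: "real set \<Rightarrow> (real \<Rightarrow> 'a::real_normed_vector) \<Rightarrow> bool" where
  "absolutely_continuous_on S f \<longleftrightarrow>
     (\<forall>\<epsilon>>0. \<exists>\<delta>>0. \<forall>(n::nat) a b.
        (\<forall>i<n. a i \<le> b i \<and> {a i..b i} \<subseteq> S) \<and>
        (\<forall>i<n. \<forall>j<n. i \<noteq> j \<longrightarrow> {a i<..<b i} \<inter> {a j<..<b j} = {}) \<and>
        (\<Sum>i<n. b i - a i) < \<delta>
        \<longrightarrow> (\<Sum>i<n. norm (f (b i) - f (a i))) < \<epsilon>)"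

definition locally_absolutely_continuous_on :: "real set \<Rightarrow> (real \<Rightarrow> 'a::real_normed_vector) \<Rightarrow> bool" where
  "locally_absolutely_continuous_on S f \<longleftrightarrow>
     (\<forall>a b. {a..b} \<subseteq> S \<longrightarrow> absolutely_continuous_on {a..b} f)"

text \<open>Time integrals are the library's \<open>integral\<close>, which is defined on functions with values in the
  Banach space \<open>l2_plane\<close> and agrees with the Bochner integral wherever the latter exists.\<close>

definition omega :: "real \<Rightarrow> real \<Rightarrow> real" where
  "omega \<mu> t = t powr (\<mu> - 1) / Gamma \<mu>"

definition caputo_primitive :: "real \<Rightarrow> (real \<Rightarrow> 'a::real_normed_vector) \<Rightarrow> real \<Rightarrow> 'a" where
  "caputo_primitive \<nu> \<phi> t = integral {0..t} (\<lambda>s. omega (1 - \<nu>) (t - s) *\<^sub>R (\<phi> s - \<phi> 0))"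

text \<open>The second of the two usual formulas for the Caputo derivative.  It agrees almost everywhere
  with \<open>\<integral>\<^sub>0\<^sup>t \<omega>\<^bsub>1-\<nu>\<^esub>(t - s) \<phi>'(s) ds\<close> when \<open>\<phi>\<close> is absolutely continuous on \<open>[0,T]\<close>, and does
  not need \<open>\<phi>'\<close> to be integrable at 0.\<close>

definition caputo :: "real \<Rightarrow> (real \<Rightarrow> 'a::real_normed_vector) \<Rightarrow> real \<Rightarrow> 'a" where
  "caputo \<nu> \<phi> t = vector_derivative (caputo_primitive \<nu> \<phi>) (at t)"

text \<open>The almost everywhere differentiability is a consequence of the absolute continuity
  for functions with values in a Hilbert space; it is included because \<open>vector_derivative\<close> is
  unspecified at points of non-differentiability.\<close>

definition caputo_differentiable :: "real \<Rightarrow> real \<Rightarrow> (real \<Rightarrow> 'a::real_normed_vector) \<Rightarrow> bool" where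
  "caputo_differentiable \<nu> T \<phi> \<longleftrightarrow>
     locally_absolutely_continuous_on {0<..T} (caputo_primitive \<nu> \<phi>) \<and>
     (AE t in lborel. 0 < t \<and> t < T \<longrightarrow> caputo_primitive \<nu> \<phi> differentiable (at t))"

definition P_caputo ::
  "real \<Rightarrow> nat \<Rightarrow> (nat \<Rightarrow> real) \<Rightarrow> (nat \<Rightarrow> real) \<Rightarrow> (real \<Rightarrow> 'a::real_normed_vector) \<Rightarrow> real \<Rightarrow> 'a" where
  "P_caputo \<alpha> m \<alpha>s b \<phi> t = caputo \<alpha> \<phi> t + (\<Sum>i=1..m. b i *\<^sub>R caputo (\<alpha>s i) \<phi> t)"


section \<open>The discrete solution operators\<close>

definition discrete_space :: "(real^2) set \<Rightarrow> l2_plane set \<Rightarrow> bool" where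
  "discrete_space \<Omega> V \<longleftrightarrow> subspace V \<and> V \<subseteq> L2 \<Omega> \<and> (\<exists>B. finite B \<and> V = span B)"

definition solution_operator :: "(real^2) set \<Rightarrow> l2_plane set \<Rightarrow> (l2_plane \<Rightarrow> l2_plane) \<Rightarrow> bool" where
  "solution_operator \<Omega> V A \<longleftrightarrow>
     A \<in> L2 \<Omega> \<rightarrow> V \<and>
     (\<forall>u\<in>L2 \<Omega>. \<forall>v\<in>L2 \<Omega>. A (u + v) = A u + A v) \<and>
     (\<forall>u\<in>L2 \<Omega>. \<forall>c. A (c *\<^sub>R u) = c *\<^sub>R A u) \<and>
     (\<forall>u\<in>L2 \<Omega>. \<forall>v\<in>L2 \<Omega>. inner (A u) v = inner u (A v)) \<and>
     (\<forall>u\<in>L2 \<Omega>. 0 \<le> inner (A u) u) \<and>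
     (\<forall>v\<in>V. v \<noteq> 0 \<longrightarrow> 0 < inner (A v) v)"

end

theory Submission
  imports Defs
begin

text \<open>
  Write \<open>I\<^sup>\<mu>\<close> for the fractional integral \<open>frac_int \<mu>\<close>, and let \<open>\<gamma>\<close> run over the orders
  \<open>\<alpha>, \<alpha>\<^sub>1, \<dots>, \<alpha>\<^sub>m\<close>.  Integrating the error equation once in time removes the Caputo
  derivatives: since \<open>T\<^sub>h e(0) = 0\<close>, the function \<open>e\<close> satisfies the Volterra equation
  \<open>\<Sum>\<^sub>\<gamma> b\<^sub>\<gamma> T\<^sub>h I\<^bsup>1-\<gamma>\<^esup> e + I\<^sup>1 e = \<rho>~\<close>, where \<open>\<rho>~\<close> is the primitive of \<open>\<rho>\<close>
  (lemma \<open>integrated_lhs_eq_integral\<close>).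

  The engine is positivity: \<open>\<integral>\<^sub>0\<^sup>\<tau> I\<^sup>\<mu>f I\<^sup>\<nu>f ds \<ge> 0\<close> for all \<open>\<mu>, \<nu> \<in> (0,1]\<close>
  (lemma \<open>frac_int_product_nonneg\<close>).  It holds because every kernel \<open>\<omega>\<^sub>\<mu>\<close> is a positive
  superposition of exponentials, and for two exponential kernels the integrand is a sum of squares
  and of the derivative of a square.  As
  \<open>T\<^sub>h\<close> and \<open>T\<^sub>h\<^sup>2\<close> are symmetric, positive semidefinite and of finite rank, positivity passes
  from scalar to vector-valued functions, and expanding the square of the Volterra equation bounds
  every single term on the left by \<open>\<rho>~\<close> in \<open>L\<^sup>2(0,\<tau>)\<close> (lemma \<open>energy_estimate\<close>).  All
  constants depend only on the number of terms.

  The pointwise bound comes from the scaling of time.  Replacing \<open>f\<close> by \<open>c f(c \<cdot>)\<close> turns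
  \<open>I\<^sup>\<mu>f\<close> into \<open>c\<^bsup>1-\<mu>\<^esup> (I\<^sup>\<mu>f)(c \<cdot>)\<close>, so the dilation differences \<open>y(c \<cdot>) - y\<close> of
  \<open>y = I\<^sup>1 e\<close> solve an equation of the same type; its right-hand side is the dilation difference
  of \<open>\<rho>~\<close> plus memory terms that carry a factor \<open>1 - c\<^sup>\<gamma> \<le> 1 - c\<close> and are already under
  control.  Two such steps bound the first and second dilation differences of \<open>y\<close> in
  \<open>L\<^sup>2(0,\<tau>)\<close> by \<open>O(1 - c)\<close> and \<open>O((1 - c)\<^sup>2)\<close>; they play the part of \<open>t y' = t e\<close> and of
  \<open>(t d/dt)\<^sup>2 y\<close>, without asking \<open>e\<close> to be differentiable.  A one-dimensional interpolation between
  the two gives \<open>\<tau> \<parallel>e(\<tau>)\<parallel>\<close> (theorem \<open>pointwise_bound\<close>), and the three quantities in the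
  supremum are exactly what controls \<open>\<rho>~\<close> and its first two dilation differences
  (lemma \<open>integral_difference_bounds\<close>).
\<close>

section \<open>Forms of finite rank\<close>

lemma form_sum_left:
  fixes B :: "'a::real_vector \<Rightarrow> 'a \<Rightarrow> real"
  assumes V: "subspace V"
    and add: "\<And>u v w. u \<in> V \<Longrightarrow> v \<in> V \<Longrightarrow> w \<in> V \<Longrightarrow> B (u + v) w = B u w + B v w"
    and scale: "\<And>c u w. u \<in> V \<Longrightarrow> w \<in> V \<Longrightarrow> B (c *\<^sub>R u) w = c * B u w"
    and fin: "finite K" and mem: "\<And>k. k \<in> K \<Longrightarrow> \<psi> k \<in> V" and w: "w \<in> V"
  shows "B (\<Sum>k\<in>K. a k *\<^sub>R \<psi> k) w = (\<Sum>k\<in>K. a k * B (\<psi> k) w)"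
  using fin mem
proof (induction K rule: finite_induct)
  case empty
  show ?case using scale[of w w 0] w V by (simp add: subspace_0 scale[of 0 w 0, simplified])
next
  case (insert k K)
  have "(\<Sum>k\<in>K. a k *\<^sub>R \<psi> k) \<in> V"
    using insert.prems V by (intro subspace_sum) (auto intro: subspace_scale)
  then show ?case
    using insert V w by (simp add: add scale subspace_scale)
qed

text \<open>Gram--Schmidt for an arbitrary inner product \<open>B\<close> on a finitely generated subspace.  It serves
  twice: with the \<open>L\<^sup>2\<close> inner product, and with \<open>B u v = (T\<^sub>h u, v)\<close> on the discrete space.\<close>

lemma orthonormal_family_exists:
  fixes B :: "'a::real_vector \<Rightarrow> 'a \<Rightarrow> real"
  assumes "finite S" and "S \<subseteq> V" and V: "subspace V"
    and add: "\<And>u v w. u \<in> V \<Longrightarrow> v \<in> V \<Longrightarrow> w \<in> V \<Longrightarrow> B (u + v) w = B u w + B v w"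
    and scale: "\<And>c u w. u \<in> V \<Longrightarrow> w \<in> V \<Longrightarrow> B (c *\<^sub>R u) w = c * B u w"
    and sym: "\<And>u v. u \<in> V \<Longrightarrow> v \<in> V \<Longrightarrow> B u v = B v u"
    and pos: "\<And>u. u \<in> V \<Longrightarrow> u \<noteq> 0 \<Longrightarrow> 0 < B u u"
  shows "\<exists>(n::nat) \<psi>. (\<forall>k<n. \<psi> k \<in> span S) \<and>
      (\<forall>u\<in>span S. u = (\<Sum>k<n. B u (\<psi> k) *\<^sub>R \<psi> k))"
  using assms(1,2)
proof (induction S rule: finite_induct)
  case empty
  show ?case by (rule exI[of _ 0]) simp
next
  case (insert x S)
  then obtain n :: nat and \<psi> where \<psi>: "\<And>k. k < n \<Longrightarrow> \<psi> k \<in> span S"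
    and rep: "\<And>u. u \<in> span S \<Longrightarrow> u = (\<Sum>k<n. B u (\<psi> k) *\<^sub>R \<psi> k)" by blast
  have SV: "span S \<subseteq> V" and xV: "x \<in> V" using insert.prems V by (auto intro: span_minimal[THEN subsetD])
  have \<psi>V: "\<psi> k \<in> V" if "k < n" for k using \<psi>[OF that] SV by blast
  note lin = form_sum_left[OF V add scale]
  define p where "p = (\<Sum>k<n. B x (\<psi> k) *\<^sub>R \<psi> k)"
  have pS: "p \<in> span S" unfolding p_def using \<psi> by (intro span_sum span_scale) auto
  define x' where "x' = x - p"
  have x'V: "x' \<in> V" using xV pS SV V by (auto simp: x'_def intro: subspace_diff)
  have orth: "B x' s = 0" if s: "s \<in> span S" for s
  proof -
    have sV: "s \<in> V" using s SV by blast
    have "B s x = B (\<Sum>k<n. B s (\<psi> k) *\<^sub>R \<psi> k) x" using rep[OF s] by simp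
    also have "\<dots> = (\<Sum>k<n. B s (\<psi> k) * B (\<psi> k) x)"
      using \<psi>V xV by (intro lin) auto
    finally have 1: "B x s = (\<Sum>k<n. B s (\<psi> k) * B (\<psi> k) x)" using sym[OF xV sV] by simp
    have "B p s = (\<Sum>k<n. B x (\<psi> k) * B (\<psi> k) s)"
      unfolding p_def using \<psi>V sV by (intro lin) auto
    then have 2: "B p s = B x s"
      unfolding 1 using sym \<psi>V sV xV by (auto intro!: sum.cong)
    have "B x s = B (x' + p) s" by (simp add: x'_def)
    also have "\<dots> = B x' s + B p s" using x'V pS SV sV by (intro add) auto
    finally show ?thesis using 2 by simp
  qed
  show ?case
  proof (cases "x' = 0")
    case True
    then have "x \<in> span S" using pS by (simp add: x'_def)
    then have "span (insert x S) = span S" by (rule span_redundant)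
    then show ?thesis using \<psi> rep by (intro exI[of _ n] exI[of _ \<psi>]) auto
  next
    case False
    define q where "q = B x' x'"
    have q: "0 < q" using pos[OF x'V False] by (simp add: q_def)
    define \<phi> where "\<phi> k = (if k < n then \<psi> k else (1 / sqrt q) *\<^sub>R x')" for k
    have x'i: "x' \<in> span (insert x S)"
      unfolding x'_def using pS by (intro span_diff) (auto intro: span_base span_mono[THEN subsetD, of S])
    have mem: "\<phi> k \<in> span (insert x S)" if "k < Suc n" for k
      using \<psi> x'i by (auto simp: \<phi>_def intro: span_scale span_mono[THEN subsetD, of S])
    have "u = (\<Sum>k<Suc n. B u (\<phi> k) *\<^sub>R \<phi> k)" if u: "u \<in> span (insert x S)" for u
    proof -
      obtain a where "u - a *\<^sub>R x \<in> span S" using u by (auto simp: span_insert)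
      then have sS: "u - a *\<^sub>R x + a *\<^sub>R p \<in> span S" using pS by (intro span_add span_scale)
      define s where "s = u - a *\<^sub>R x + a *\<^sub>R p"
      have us: "u = a *\<^sub>R x' + s" by (simp add: s_def x'_def algebra_simps)
      have s: "s \<in> span S" "s \<in> V" using sS SV by (auto simp: s_def)
      have Bu: "B u w = a * B x' w + B s w" if "w \<in> V" for w
        unfolding us using that x'V s V by (simp add: add scale subspace_scale)
      have 1: "B u (\<psi> k) = B s (\<psi> k)" if "k < n" for k
        using Bu[OF \<psi>V[OF that]] orth[OF \<psi>[OF that]] by simp
      have "B u x' = a * q" using Bu[OF x'V] orth[OF s(1)] sym[OF x'V s(2)] by (simp add: q_def)
      have uV: "u \<in> V" unfolding us using x'V s V by (auto intro: subspace_add subspace_scale)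
      have "B u ((1 / sqrt q) *\<^sub>R x') = (1 / sqrt q) * B x' u"
        using uV x'V V sym scale by (metis subspace_scale)
      then have 2: "B u ((1 / sqrt q) *\<^sub>R x') *\<^sub>R ((1 / sqrt q) *\<^sub>R x') = a *\<^sub>R x'"
        using \<open>B u x' = a * q\<close> sym[OF uV x'V] q by simp
      have "(\<Sum>k<Suc n. B u (\<phi> k) *\<^sub>R \<phi> k) = (\<Sum>k<n. B s (\<psi> k) *\<^sub>R \<psi> k) + a *\<^sub>R x'"
        using 1 2 by (simp add: \<phi>_def)
      also have "\<dots> = u" using rep[OF s(1)] us by simp
      finally show ?thesis by simp
    qed
    then show ?thesis using mem by blast
  qed
qed

text \<open>A form of this shape reduces vector-valued positivity to the scalar case, one functional
  \<open>inner _ (\<eta> k)\<close> at a time.\<close>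

definition sum_of_squares_form :: "('a::real_inner \<Rightarrow> 'a \<Rightarrow> real) \<Rightarrow> bool" where
  "sum_of_squares_form B \<longleftrightarrow>
     (\<exists>(n::nat) \<eta>. \<forall>u v. B u v = (\<Sum>k<n. inner u (\<eta> k) * inner v (\<eta> k)))"

text \<open>The square of \<open>A\<close> gets its own sum of squares from an orthonormal basis of the range of \<open>A\<close>,
  because the components there are \<open>(A u, \<phi>) = (u, A \<phi>)\<close>.\<close>

lemma finite_rank_forms:
  fixes A :: "'a::real_inner \<Rightarrow> 'a" and \<eta> :: "nat \<Rightarrow> 'a"
  assumes A: "\<And>u. A u = (\<Sum>k<n. inner u (\<eta> k) *\<^sub>R \<eta> k)"
  shows "bounded_linear A"
    and "sum_of_squares_form (\<lambda>u v. inner (A u) v)"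
    and "sum_of_squares_form (\<lambda>u v. inner (A u) (A v))"
proof -
  show "bounded_linear A"
    unfolding A[abs_def]
    by (intro bounded_linear_sum bounded_linear_compose[OF bounded_linear_scaleR_left bounded_linear_inner_left])
  have sym: "inner (A u) v = (\<Sum>k<n. inner u (\<eta> k) * inner v (\<eta> k))" for u v
    unfolding A by (subst inner_sum_left) (simp add: inner_commute)
  then show "sum_of_squares_form (\<lambda>u v. inner (A u) v)"
    unfolding sum_of_squares_form_def by blast
  have range: "A u \<in> span (\<eta> ` {..<n})" for u
    unfolding A by (intro span_sum span_scale span_base) auto
  obtain l :: nat and \<phi> where rep: "\<And>w. w \<in> span (\<eta> ` {..<n}) \<Longrightarrow> w = (\<Sum>k<l. inner w (\<phi> k) *\<^sub>R \<phi> k)"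
  proof -
    have "\<exists>(l::nat) \<phi>. (\<forall>k<l. \<phi> k \<in> span (\<eta> ` {..<n})) \<and>
        (\<forall>w\<in>span (\<eta> ` {..<n}). w = (\<Sum>k<l. inner w (\<phi> k) *\<^sub>R \<phi> k))"
      by (rule orthonormal_family_exists[where V = UNIV]) (auto simp: inner_add_left intro: inner_commute)
    then show thesis using that by blast
  qed
  have "inner (A u) (A v) = (\<Sum>k<l. inner u (A (\<phi> k)) * inner v (A (\<phi> k)))" for u v
  proof -
    have swap: "inner (A u) (\<phi> k) = inner u (A (\<phi> k))" for u k
      using sym[of u "\<phi> k"] sym[of "\<phi> k" u] by (simp add: inner_commute mult.commute)
    have "inner (A u) (A v) = inner (A u) (\<Sum>k<l. inner (A v) (\<phi> k) *\<^sub>R \<phi> k)"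
      using rep[OF range[of v]] by simp
    also have "\<dots> = (\<Sum>k<l. inner (A u) (\<phi> k) * inner (A v) (\<phi> k))"
      by (subst inner_sum_right) (simp add: mult.commute)
    finally show ?thesis by (simp add: swap)
  qed
  then show "sum_of_squares_form (\<lambda>u v. inner (A u) (A v))"
    unfolding sum_of_squares_form_def by (intro exI[of _ l] exI[of _ "\<lambda>k. A (\<phi> k)"]) simp
qed

section \<open>The subspace \<open>L\<^sup>2(\<Omega>)\<close> and the discrete solution operator\<close>

lemma inner_abs_l2_plane:
  assumes "square_integrable f" "square_integrable g"
  shows "inner (abs_l2_plane f) (abs_l2_plane g) = (LINT x|lebesgue. f x * g x)"
  using assms by (simp add: inner_l2_plane.abs_eq ae_equal_def)

lemma abs_l2_plane_mem_L2:
  assumes "square_integrable f"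
  shows "abs_l2_plane f \<in> L2 \<Omega> \<longleftrightarrow> (AE x in lebesgue. x \<notin> \<Omega> \<longrightarrow> f x = 0)"
  using assms by (simp add: L2_def in_L2.abs_eq ae_equal_def)

text \<open>Being cut out by continuous linear equations makes \<open>L\<^sup>2(\<Omega>)\<close> stable under integrals and
  derivatives in time.  For the converse inclusion a function is tested against its own restriction
  to the complement of \<open>\<Omega>\<close>.\<close>

lemma L2_orthogonal_complement:
  assumes "\<Omega> \<in> sets lebesgue"
  shows "L2 \<Omega> = {u. \<forall>v\<in>L2 (- \<Omega>). inner u v = 0}"
proof (intro set_eqI iffI CollectI ballI)
  fix u v assume u: "u \<in> L2 \<Omega>" and v: "v \<in> L2 (- \<Omega>)"
  obtain f where f: "square_integrable f" "abs_l2_plane f = u" by (rule l2_plane_rep)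
  obtain g where g: "square_integrable g" "abs_l2_plane g = v" by (rule l2_plane_rep)
  have "AE x in lebesgue. x \<notin> \<Omega> \<longrightarrow> f x = 0"
    using u f abs_l2_plane_mem_L2 by blast
  moreover have "AE x in lebesgue. x \<notin> - \<Omega> \<longrightarrow> g x = 0"
    using v g abs_l2_plane_mem_L2 by blast
  ultimately have "AE x in lebesgue. f x * g x = 0" by eventually_elim auto
  then have "(LINT x|lebesgue. f x * g x) = 0" by (rule integral_eq_zero_AE)
  then show "inner u v = 0" using inner_abs_l2_plane[OF f(1) g(1)] f g by simp
next
  fix u assume "u \<in> {u. \<forall>v\<in>L2 (- \<Omega>). inner u v = 0}"
  then have u: "\<And>v. v \<in> L2 (- \<Omega>) \<Longrightarrow> inner u v = 0" by blast
  obtain f where f: "square_integrable f" "abs_l2_plane f = u" by (rule l2_plane_rep)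
  have [measurable]: "f \<in> borel_measurable lebesgue" using f by (simp add: square_integrable_def)
  have [measurable]: "\<Omega> \<in> sets lebesgue" by fact
  define g where "g x = indicat_real (- \<Omega>) x * f x" for x
  have gf: "f x * g x = (g x)\<^sup>2" for x by (auto simp: g_def indicator_def power2_eq_square)
  have [measurable]: "g \<in> borel_measurable lebesgue" unfolding g_def by measurable
  have int: "integrable lebesgue (\<lambda>x. (g x)\<^sup>2)"
  proof (rule Bochner_Integration.integrable_bound)
    show "integrable lebesgue (\<lambda>x. (f x)\<^sup>2)" using f by (simp add: square_integrable_def)
    show "AE x in lebesgue. norm ((g x)\<^sup>2) \<le> norm ((f x)\<^sup>2)"
      by (intro AE_I2) (auto simp: g_def indicator_def)
  qed measurable
  have g: "square_integrable g" using int by (simp add: square_integrable_def)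
  have "abs_l2_plane g \<in> L2 (- \<Omega>)"
    unfolding abs_l2_plane_mem_L2[OF g] by (intro AE_I2) (auto simp: g_def)
  then have "(LINT x|lebesgue. (g x)\<^sup>2) = 0"
    using u inner_abs_l2_plane[OF f(1) g] f(2) by (simp add: gf)
  then have "AE x in lebesgue. (g x)\<^sup>2 = 0"
    using int by (subst (asm) integral_nonneg_eq_0_iff_AE) auto
  then have "AE x in lebesgue. x \<notin> \<Omega> \<longrightarrow> f x = 0"
    by eventually_elim (auto simp: g_def)
  then show "u \<in> L2 \<Omega>" using abs_l2_plane_mem_L2[OF f(1)] f(2) by blast
qed

lemma subspace_L2: "\<Omega> \<in> sets lebesgue \<Longrightarrow> subspace (L2 \<Omega>)"
  unfolding L2_orthogonal_complement
  by (auto simp: subspace_def inner_add_left)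

lemma has_integral_inner_left:
  fixes f :: "'n::euclidean_space \<Rightarrow> 'a::real_inner"
  assumes "(f has_integral I) S"
  shows "((\<lambda>x. inner (f x) v) has_integral inner I v) S"
  using has_integral_linear[OF assms bounded_linear_inner_left] by (simp add: o_def)

lemma integral_mem_L2:
  assumes "\<Omega> \<in> sets lebesgue" and mem: "\<And>x. x \<in> S \<Longrightarrow> f x \<in> L2 \<Omega>"
  shows "integral S f \<in> L2 \<Omega>"
proof (cases "f integrable_on S")
  case True
  have "inner (integral S f) v = 0" if v: "v \<in> L2 (- \<Omega>)" for v
  proof -
    have "((\<lambda>x. inner (f x) v) has_integral inner (integral S f) v) S"
      using True by (intro has_integral_inner_left) auto
    moreover have "((\<lambda>x. inner (f x) v) has_integral 0) S"
      using mem v L2_orthogonal_complement[OF assms(1)] by (intro has_integral_is_0) blast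
    ultimately show ?thesis by (rule has_integral_unique)
  qed
  then show ?thesis using L2_orthogonal_complement[OF assms(1)] by blast
next
  case False
  then show ?thesis
    using subspace_L2[OF assms(1)] by (simp add: not_integrable_integral subspace_0)
qed

lemma has_vector_derivative_mem_L2:
  assumes "\<Omega> \<in> sets lebesgue" and mem: "\<And>s. s \<in> {a<..<b} \<Longrightarrow> f s \<in> L2 \<Omega>" and t: "t \<in> {a<..<b}"
    and der: "(f has_vector_derivative D) (at t)"
  shows "D \<in> L2 \<Omega>"
proof -
  have "inner D v = 0" if v: "v \<in> L2 (- \<Omega>)" for v
  proof -
    have "((\<lambda>s. inner (f s) v) has_vector_derivative inner D v) (at t)"
      using bounded_linear.has_vector_derivative[OF bounded_linear_inner_left der] .
    moreover have "((\<lambda>s. inner (f s) v) has_vector_derivative 0) (at t)"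
    proof (rule has_vector_derivative_transform_within_open[where S = "{a<..<b}"])
      show "((\<lambda>_. 0::real) has_vector_derivative 0) (at t)" by simp
      show "0 = inner (f s) v" if "s \<in> {a<..<b}" for s
        using mem[OF that] v L2_orthogonal_complement[OF assms(1)] by simp
    qed (use t in auto)
    ultimately show ?thesis by (rule vector_derivative_unique_at)
  qed
  then show ?thesis using L2_orthogonal_complement[OF assms(1)] by blast
qed

text \<open>With \<open>\<psi>\<close> orthonormal for \<open>(T\<^sub>h u, v)\<close> on \<open>V\<close> and \<open>\<eta>\<^sub>k = T\<^sub>h \<psi>\<^sub>k\<close>, both sides lie in
  \<open>V\<close> and have the same inner products with \<open>V\<close>, by selfadjointness.\<close>

lemma solution_operator_finite_rank:
  assumes V: "discrete_space \<Omega> V" and Th: "solution_operator \<Omega> V Th" and \<Omega>: "\<Omega> \<in> sets lebesgue"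
  obtains n :: nat and \<eta> where "\<And>u. u \<in> L2 \<Omega> \<Longrightarrow> Th u = (\<Sum>k<n. inner u (\<eta> k) *\<^sub>R \<eta> k)"
proof -
  have sV: "subspace V" and VL: "V \<subseteq> L2 \<Omega>" using V by (auto simp: discrete_space_def)
  obtain S where S: "finite S" "V = span S" using V by (auto simp: discrete_space_def)
  have ThV: "Th u \<in> V" if "u \<in> L2 \<Omega>" for u using Th that by (auto simp: solution_operator_def)
  have add: "Th (u + v) = Th u + Th v" if "u \<in> L2 \<Omega>" "v \<in> L2 \<Omega>" for u v
    using Th that by (auto simp: solution_operator_def)
  have scale: "Th (c *\<^sub>R u) = c *\<^sub>R Th u" if "u \<in> L2 \<Omega>" for u c
    using Th that by (auto simp: solution_operator_def)
  have sym: "inner (Th u) v = inner u (Th v)" if "u \<in> L2 \<Omega>" "v \<in> L2 \<Omega>" for u v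
    using Th that by (auto simp: solution_operator_def)
  have pos: "0 < inner (Th v) v" if "v \<in> V" "v \<noteq> 0" for v
    using Th that by (auto simp: solution_operator_def)
  have "\<exists>(n::nat) \<psi>. (\<forall>k<n. \<psi> k \<in> span S) \<and> (\<forall>u\<in>span S. u = (\<Sum>k<n. inner (Th u) (\<psi> k) *\<^sub>R \<psi> k))"
  proof (rule orthonormal_family_exists[where V = V])
    show "inner (Th u) v = inner (Th v) u" if "u \<in> V" "v \<in> V" for u v
      using sym[of u v] that VL by (simp add: subset_iff inner_commute)
  qed (use S sV VL pos in \<open>auto simp: add scale inner_add_left subset_iff span_base\<close>)
  then obtain n :: nat and \<psi> where \<psi>: "\<And>k. k < n \<Longrightarrow> \<psi> k \<in> V"
    and rep: "\<And>v. v \<in> V \<Longrightarrow> v = (\<Sum>k<n. inner (Th v) (\<psi> k) *\<^sub>R \<psi> k)"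
    unfolding S(2)[symmetric] by blast
  define \<eta> where "\<eta> k = Th (\<psi> k)" for k
  have \<eta>V: "\<eta> k \<in> V" if "k < n" for k unfolding \<eta>_def using \<psi>[OF that] VL by (intro ThV) auto
  have "Th u = (\<Sum>k<n. inner u (\<eta> k) *\<^sub>R \<eta> k)" if u: "u \<in> L2 \<Omega>" for u
  proof -
    define w where "w = Th u - (\<Sum>k<n. inner u (\<eta> k) *\<^sub>R \<eta> k)"
    have wV: "w \<in> V"
      unfolding w_def using \<eta>V ThV[OF u] sV
      by (intro subspace_diff subspace_sum subspace_scale) auto
    have "inner (Th u) v = inner (\<Sum>k<n. inner u (\<eta> k) *\<^sub>R \<eta> k) v" if v: "v \<in> V" for v
    proof -
      have "inner (Th u) v = inner (Th u) (\<Sum>k<n. inner (Th v) (\<psi> k) *\<^sub>R \<psi> k)"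
        using rep[OF v] by simp
      also have "\<dots> = (\<Sum>k<n. inner (Th v) (\<psi> k) * inner (Th u) (\<psi> k))"
        by (subst inner_sum_right) simp
      also have "\<dots> = (\<Sum>k<n. inner v (\<eta> k) * inner u (\<eta> k))"
        using sym u v VL \<psi> by (intro sum.cong refl) (auto simp: \<eta>_def subset_iff)
      also have "\<dots> = inner (\<Sum>k<n. inner u (\<eta> k) *\<^sub>R \<eta> k) v"
        by (subst inner_sum_left) (simp add: inner_commute mult.commute)
      finally show ?thesis .
    qed
    then have "inner w w = 0" using wV by (simp add: w_def inner_diff_left)
    then show ?thesis by (simp add: w_def)
  qed
  then show ?thesis using that by blast
qed

section \<open>Absolutely continuous functions of time\<close>

text \<open>The mean value inequality for absolutely continuous functions.  Cover the exceptional null set by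
  an open set of small measure and take a division of \<open>[a,b]\<close> that is fine for a gauge adapted to it:
  intervals with an exceptional tag contribute little by absolute continuity, the others at most
  \<open>K + \<epsilon>\<close> times their length.\<close>

lemma absolutely_continuous_norm_diff_le:
  fixes f :: "real \<Rightarrow> 'a::real_normed_vector"
  assumes "a \<le> b" and ac: "absolutely_continuous_on {a..b} f" and K: "0 \<le> K"
    and der: "AE t in lborel. a < t \<and> t < b \<longrightarrow> (\<exists>D. (f has_vector_derivative D) (at t) \<and> norm D \<le> K)"
  shows "norm (f b - f a) \<le> K * (b - a)"
proof -
  have main: "norm (f b - f a) \<le> \<epsilon> + (K + \<epsilon>) * (b - a)" if \<epsilon>: "0 < \<epsilon>" for \<epsilon>
  proof -
    obtain \<delta> where \<delta>: "0 < \<delta>" and AC0: "\<forall>(n::nat) u v.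
        (\<forall>i<n. u i \<le> v i \<and> {u i..v i} \<subseteq> {a..b}) \<and>
        (\<forall>i<n. \<forall>j<n. i \<noteq> j \<longrightarrow> {u i<..<v i} \<inter> {u j<..<v j} = {}) \<and>
        (\<Sum>i<n. v i - u i) < \<delta> \<longrightarrow> (\<Sum>i<n. norm (f (v i) - f (u i))) < \<epsilon>"
      using ac[unfolded absolutely_continuous_on_def, THEN spec, THEN mp, OF \<epsilon>] by (elim exE conjE)
    note AC = AC0[THEN spec, THEN spec, THEN spec, THEN mp]
    obtain N0 where N0: "N0 \<in> null_sets lborel"
      and good0: "\<And>t. t \<notin> N0 \<Longrightarrow> a < t \<and> t < b \<longrightarrow> (\<exists>D. (f has_vector_derivative D) (at t) \<and> norm D \<le> K)"
      by (rule AE_E3[OF der]) auto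
    define N where "N = N0 \<union> {a, b}"
    have N: "N \<in> null_sets lborel"
      unfolding N_def by (intro null_sets.Un N0 finite_imp_null_set_lborel) auto
    have good: "\<exists>D. (f has_vector_derivative D) (at t) \<and> norm D \<le> K" if "t \<in> {a..b}" "t \<notin> N" for t
      using good0[of t] that by (auto simp: N_def)
    obtain U where U: "open U" "N \<subseteq> U" "emeasure lborel (U - N) < ennreal \<delta>"
      using outer_regular_lborel[of N \<delta>] N \<delta> by (auto simp: null_sets_def)
    have UN: "U \<in> sets lborel" "N \<in> sets lborel" using U(1) N by auto
    have "emeasure lborel U \<le> emeasure lborel ((U - N) \<union> N)"
      using UN by (intro emeasure_mono sets.Un sets.Diff) auto
    also have "\<dots> = emeasure lborel (U - N)"
      using N UN by (intro emeasure_Un_null_set sets.Diff)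
    finally have mU: "emeasure lborel U < ennreal \<delta>" using U(3) by simp
    have "\<exists>r>0. \<forall>y. \<bar>y - x\<bar> < r \<longrightarrow> norm (f y - f x) \<le> (K + \<epsilon>) * \<bar>y - x\<bar>"
      if x: "x \<in> {a..b}" "x \<notin> N" for x
    proof -
      obtain D where D: "(f has_vector_derivative D) (at x)" "norm D \<le> K" using good[OF x] by blast
      have "\<exists>d>0. \<forall>y. norm (y - x) < d \<longrightarrow> norm (f y - f x - (y - x) *\<^sub>R D) \<le> \<epsilon> * norm (y - x)"
        using D(1) \<epsilon> unfolding has_vector_derivative_def has_derivative_at_alt by simp
      then obtain r where r: "r > 0"
        and *: "\<And>y. \<bar>y - x\<bar> < r \<Longrightarrow> norm (f y - f x - (y - x) *\<^sub>R D) \<le> \<epsilon> * \<bar>y - x\<bar>"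
        by auto
      have "norm (f y - f x) \<le> (K + \<epsilon>) * \<bar>y - x\<bar>" if "\<bar>y - x\<bar> < r" for y
      proof -
        have "norm (f y - f x) \<le> norm (f y - f x - (y - x) *\<^sub>R D) + norm ((y - x) *\<^sub>R D)"
          using norm_triangle_ineq[of "f y - f x - (y - x) *\<^sub>R D" "(y - x) *\<^sub>R D"] by simp
        also have "\<dots> \<le> \<epsilon> * \<bar>y - x\<bar> + \<bar>y - x\<bar> * K"
          using *[OF that] D(2) by (auto intro!: add_mono mult_left_mono)
        finally show ?thesis by (simp add: algebra_simps)
      qed
      then show ?thesis using r by blast
    qed
    then have "\<forall>x. \<exists>r. x \<in> {a..b} - N \<longrightarrow>
        0 < r \<and> (\<forall>y. \<bar>y - x\<bar> < r \<longrightarrow> norm (f y - f x) \<le> (K + \<epsilon>) * \<bar>y - x\<bar>)" by blast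
    from choice[OF this] obtain r where rr: "\<forall>x. x \<in> {a..b} - N \<longrightarrow>
        0 < r x \<and> (\<forall>y. \<bar>y - x\<bar> < r x \<longrightarrow> norm (f y - f x) \<le> (K + \<epsilon>) * \<bar>y - x\<bar>)"
      by (elim exE)
    have r: "r x > 0" if "x \<in> {a..b}" "x \<notin> N" for x using rr[THEN spec, of x] that by auto
    have fr: "norm (f y - f x) \<le> (K + \<epsilon>) * \<bar>y - x\<bar>"
      if "x \<in> {a..b}" "x \<notin> N" "\<bar>y - x\<bar> < r x" for x y using rr[THEN spec, of x] that by auto
    define g where "g x = (if x \<in> N then U else if x \<in> {a..b} then ball x (r x) else UNIV)" for x
    have "gauge g" unfolding gauge_def g_def using U r by auto
    then obtain p where p: "p tagged_division_of {a..b}" "g fine p"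
      using fine_division_exists_real by blast
    note pD = tagged_division_ofD[OF p(1)]
    have Icc: "\<exists>u v. u \<le> v \<and> K = {u..v} \<and> u \<le> x \<and> x \<le> v \<and> a \<le> u \<and> v \<le> b" if xK: "(x, K) \<in> p" for x K
    proof -
      obtain u v where "K = cbox u v" using pD(4)[OF xK] by blast
      then show ?thesis using pD(2,3)[OF xK] by (intro exI[of _ u] exI[of _ v]) auto
    qed
    define p1 where "p1 = {z \<in> p. fst z \<in> N}"
    define p2 where "p2 = {z \<in> p. fst z \<notin> N}"
    have fin: "finite p1" "finite p2" and p12: "p = p1 \<union> p2" "p1 \<inter> p2 = {}"
      using pD(1) by (auto simp: p1_def p2_def)
    let ?d = "\<lambda>(x, K). f (Sup K) - f (Inf K)"
    \<comment> \<open>The intervals with exceptional tags lie in \<open>U\<close>, so their total length is below \<open>\<delta>\<close>.\<close>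
    have "norm (\<Sum>z\<in>p1. ?d z) \<le> \<epsilon>"
    proof -
      obtain h :: "nat \<Rightarrow> real \<times> real set" where h: "bij_betw h {..<card p1} p1"
        using ex_bij_betw_nat_finite[OF fin(1)] by (auto simp: lessThan_atLeast0)
      define n where "n = card p1"
      have hp: "(fst (h i), snd (h i)) \<in> p" "fst (h i) \<in> N" if "i < n" for i
        using bij_betwE[OF h] that by (auto simp: n_def p1_def)
      define u where "u i = Inf (snd (h i))" for i
      define v where "v i = Sup (snd (h i))" for i
      have uv: "u i \<le> v i \<and> snd (h i) = {u i..v i} \<and> a \<le> u i \<and> v i \<le> b" if i: "i < n" for i
      proof -
        obtain c d where cd: "c \<le> d" "snd (h i) = {c..d}" "a \<le> c" "d \<le> b"
          using Icc[OF hp(1)[OF i]] by blast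
        then have "u i = c" "v i = d" by (simp_all add: u_def v_def)
        then show ?thesis using cd by simp
      qed
      have disj: "{u i<..<v i} \<inter> {u j<..<v j} = {}" if "i < n" "j < n" "i \<noteq> j" for i j
      proof -
        have "h i \<noteq> h j" using inj_onD[OF bij_betw_imp_inj_on[OF h], of i j] that unfolding n_def by blast
        then have "interior (snd (h i)) \<inter> interior (snd (h j)) = {}"
          by (intro pD(5)[OF hp(1)[OF that(1)] hp(1)[OF that(2)]]) simp
        then show ?thesis using uv[OF that(1)] uv[OF that(2)] by (metis interior_atLeastAtMost_real)
      qed
      have "(\<Sum>i<n. v i - u i) < \<delta>"
      proof -
        have "ennreal (\<Sum>i<n. v i - u i) = (\<Sum>i<n. emeasure lborel {u i<..<v i})"
        proof -
          have "(\<Sum>i<n. emeasure lborel {u i<..<v i}) = (\<Sum>i<n. ennreal (v i - u i))"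
            by (intro sum.cong refl emeasure_lborel_Ioo) (simp add: uv)
          also have "\<dots> = ennreal (\<Sum>i<n. v i - u i)"
            by (intro sum_ennreal) (simp add: uv)
          finally show ?thesis by simp
        qed
        also have "\<dots> = emeasure lborel (\<Union>i<n. {u i<..<v i})"
          using disj by (intro sum_emeasure) (auto simp: disjoint_family_on_def)
        also have "\<dots> \<le> emeasure lborel U"
        proof (rule emeasure_mono)
          have "{u i<..<v i} \<subseteq> U" if "i < n" for i
          proof -
            have "snd (h i) \<subseteq> g (fst (h i))" using p(2) hp(1)[OF that] unfolding fine_def by blast
            then show ?thesis using hp(2)[OF that] uv[OF that] by (auto simp: g_def)
          qed
          then show "(\<Union>i<n. {u i<..<v i}) \<subseteq> U" by blast
        qed (rule UN(1))
        also have "\<dots> < ennreal \<delta>" by (rule mU)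
        finally show ?thesis using \<delta> uv by (subst (asm) ennreal_less_iff) (auto intro!: sum_nonneg)
      qed
      then have "(\<Sum>i<n. norm (f (v i) - f (u i))) < \<epsilon>"
      proof (intro AC conjI allI impI)
        fix i assume "i < n"
        from uv[OF this] show "u i \<le> v i" "{u i..v i} \<subseteq> {a..b}" by (auto intro: order_trans)
      qed (use disj in blast)
      moreover have "(\<Sum>z\<in>p1. ?d z) = (\<Sum>i<n. f (v i) - f (u i))"
        unfolding n_def by (subst sum.reindex_bij_betw[OF h, symmetric]) (simp add: u_def v_def split_beta)
      moreover have "norm (\<Sum>i<n. f (v i) - f (u i)) \<le> (\<Sum>i<n. norm (f (v i) - f (u i)))"
        by (rule norm_sum)
      ultimately show ?thesis by simp
    qed
    moreover have "norm (\<Sum>z\<in>p2. ?d z) \<le> (K + \<epsilon>) * (b - a)"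
    proof -
      have "norm (\<Sum>z\<in>p2. ?d z) \<le> (\<Sum>z\<in>p2. (K + \<epsilon>) * measure lborel (snd z))"
      proof (rule sum_norm_le)
        fix z assume z: "z \<in> p2"
        obtain x k where zz: "z = (x, k)" by force
        then have xk: "(x, k) \<in> p" "x \<notin> N" using z by (auto simp: p2_def)
        obtain u v where k: "k = {u..v}" "u \<le> x" "x \<le> v" "a \<le> u" "v \<le> b" using Icc[OF xk(1)] by blast
        have "k \<subseteq> g x" using p(2) xk by (auto simp: fine_def)
        then have "{u..v} \<subseteq> ball x (r x)" using k xk by (auto simp: g_def)
        moreover have "u \<in> {u..v}" "v \<in> {u..v}" using k by auto
        ultimately have "dist x u < r x" "dist x v < r x" using mem_ball by blast+
        then have "norm (f u - f x) \<le> (K + \<epsilon>) * \<bar>u - x\<bar>" "norm (f v - f x) \<le> (K + \<epsilon>) * \<bar>v - x\<bar>"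
          using k xk fr[of x u] fr[of x v] by (simp_all add: dist_real_def abs_minus_commute)
        moreover have "norm (f v - f u) \<le> norm (f v - f x) + norm (f u - f x)"
          using norm_triangle_ineq4[of "f v - f x" "f u - f x"] by simp
        ultimately have "norm (f v - f u) \<le> (K + \<epsilon>) * (v - u)"
          using k by (simp add: algebra_simps)
        then show "norm (?d z) \<le> (K + \<epsilon>) * measure lborel (snd z)" using k zz by simp
      qed
      also have "\<dots> \<le> (\<Sum>z\<in>p. (K + \<epsilon>) * measure lborel (snd z))"
        using K \<epsilon> pD(1) by (intro sum_mono2) (auto simp: p2_def)
      also have "\<dots> = (K + \<epsilon>) * (b - a)"
        using additive_content_tagged_division[of p a b] p(1) \<open>a \<le> b\<close>
        by (simp add: sum_distrib_left[symmetric] split_beta)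
      finally show ?thesis .
    qed
    moreover have eq: "f b - f a = (\<Sum>z\<in>p1. ?d z) + (\<Sum>z\<in>p2. ?d z)"
      using additive_tagged_division_1[OF \<open>a \<le> b\<close> p(1), of f]
      unfolding p12 by (subst (asm) sum.union_disjoint) (use fin p12 in auto)
    ultimately show ?thesis
      unfolding eq using norm_triangle_ineq[of "\<Sum>z\<in>p1. ?d z" "\<Sum>z\<in>p2. ?d z"] by linarith
  qed
  have "((\<lambda>\<epsilon>. \<epsilon> + (K + \<epsilon>) * (b - a)) \<longlongrightarrow> 0 + (K + 0) * (b - a)) (at_right 0)"
    by (intro tendsto_intros)
  moreover have "eventually (\<lambda>\<epsilon>. norm (f b - f a) \<le> \<epsilon> + (K + \<epsilon>) * (b - a)) (at_right 0)"
    by (rule eventually_at_rightI[of 0 1]) (use main in auto)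
  ultimately have "norm (f b - f a) \<le> 0 + (K + 0) * (b - a)"
    by (intro tendsto_lowerbound[of _ _ "at_right (0::real)"]) auto
  then show ?thesis by simp
qed

text \<open>One criterion for sums, bounded linear images and Lipschitz perturbations together.\<close>

lemma absolutely_continuous_on_dominated:
  fixes F :: "'j \<Rightarrow> real \<Rightarrow> 'a::real_normed_vector" and h :: "real \<Rightarrow> 'b::real_normed_vector"
  assumes J: "finite J" and F: "\<And>j. j \<in> J \<Longrightarrow> absolutely_continuous_on S (F j)" and K: "0 < K"
    and h: "\<And>x y. x \<in> S \<Longrightarrow> y \<in> S \<Longrightarrow> x \<le> y \<Longrightarrow>
      norm (h y - h x) \<le> K * ((\<Sum>j\<in>J. norm (F j y - F j x)) + (y - x))"
  shows "absolutely_continuous_on S h"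
  unfolding absolutely_continuous_on_def
proof (intro allI impI)
  fix \<epsilon> :: real assume \<epsilon>: "0 < \<epsilon>"
  define \<epsilon>' where "\<epsilon>' = \<epsilon> / (K * (real (card J) + 1))"
  have \<epsilon>': "0 < \<epsilon>'" using \<epsilon> K by (simp add: \<epsilon>'_def)
  have "\<forall>j. \<exists>\<delta>. j \<in> J \<longrightarrow> \<delta> > 0 \<and> (\<forall>(n::nat) a b.
        (\<forall>i<n. a i \<le> b i \<and> {a i..b i} \<subseteq> S) \<and>
        (\<forall>i<n. \<forall>k<n. i \<noteq> k \<longrightarrow> {a i<..<b i} \<inter> {a k<..<b k} = {}) \<and>
        (\<Sum>i<n. b i - a i) < \<delta>
        \<longrightarrow> (\<Sum>i<n. norm (F j (b i) - F j (a i))) < \<epsilon>')"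
    using F[unfolded absolutely_continuous_on_def, rule_format, OF _ \<epsilon>'] by blast
  from choice[OF this] obtain \<delta> where \<delta>: "\<forall>j. j \<in> J \<longrightarrow> \<delta> j > 0 \<and> (\<forall>(n::nat) a b.
        (\<forall>i<n. a i \<le> b i \<and> {a i..b i} \<subseteq> S) \<and>
        (\<forall>i<n. \<forall>k<n. i \<noteq> k \<longrightarrow> {a i<..<b i} \<inter> {a k<..<b k} = {}) \<and>
        (\<Sum>i<n. b i - a i) < \<delta> j
        \<longrightarrow> (\<Sum>i<n. norm (F j (b i) - F j (a i))) < \<epsilon>')" by (elim exE)
  define d where "d = Min (insert \<epsilon>' (\<delta> ` J))"
  have d: "0 < d" "d \<le> \<epsilon>'" "\<And>j. j \<in> J \<Longrightarrow> d \<le> \<delta> j"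
    unfolding d_def using J \<delta> \<epsilon>' by auto
  show "\<exists>\<delta>>0. \<forall>(n::nat) a b. (\<forall>i<n. a i \<le> b i \<and> {a i..b i} \<subseteq> S) \<and>
        (\<forall>i<n. \<forall>j<n. i \<noteq> j \<longrightarrow> {a i<..<b i} \<inter> {a j<..<b j} = {}) \<and>
        (\<Sum>i<n. b i - a i) < \<delta> \<longrightarrow> (\<Sum>i<n. norm (h (b i) - h (a i))) < \<epsilon>"
  proof (intro exI[of _ d] conjI d(1) allI impI, elim conjE)
    fix n :: nat and a b :: "nat \<Rightarrow> real"
    assume ab: "\<forall>i<n. a i \<le> b i \<and> {a i..b i} \<subseteq> S"
      and disj: "\<forall>i<n. \<forall>j<n. i \<noteq> j \<longrightarrow> {a i<..<b i} \<inter> {a j<..<b j} = {}"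
      and sm: "(\<Sum>i<n. b i - a i) < d"
    have Fj: "(\<Sum>i<n. norm (F j (b i) - F j (a i))) \<le> \<epsilon>'" if j: "j \<in> J" for j
    proof -
      have "(\<Sum>i<n. b i - a i) < \<delta> j" using sm d(3)[OF j] by linarith
      moreover have "\<forall>(n::nat) a b.
        (\<forall>i<n. a i \<le> b i \<and> {a i..b i} \<subseteq> S) \<and>
        (\<forall>i<n. \<forall>k<n. i \<noteq> k \<longrightarrow> {a i<..<b i} \<inter> {a k<..<b k} = {}) \<and>
        (\<Sum>i<n. b i - a i) < \<delta> j
        \<longrightarrow> (\<Sum>i<n. norm (F j (b i) - F j (a i))) < \<epsilon>'" using \<delta> j by blast
      ultimately have "(\<Sum>i<n. norm (F j (b i) - F j (a i))) < \<epsilon>'" using ab disj by blast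
      then show ?thesis by simp
    qed
    have "(\<Sum>i<n. norm (h (b i) - h (a i)))
        \<le> (\<Sum>i<n. K * ((\<Sum>j\<in>J. norm (F j (b i) - F j (a i))) + (b i - a i)))"
    proof (rule sum_mono)
      fix i assume "i \<in> {..<n}"
      then have "a i \<le> b i" "{a i..b i} \<subseteq> S" using ab by auto
      then show "norm (h (b i) - h (a i)) \<le> K * ((\<Sum>j\<in>J. norm (F j (b i) - F j (a i))) + (b i - a i))"
        by (intro h) auto
    qed
    also have "\<dots> = K * ((\<Sum>j\<in>J. \<Sum>i<n. norm (F j (b i) - F j (a i))) + (\<Sum>i<n. b i - a i))"
      by (subst sum.swap) (simp only: sum_distrib_left[symmetric] sum.distrib)
    also have "\<dots> < K * ((\<Sum>j\<in>J. \<epsilon>') + \<epsilon>')"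
      using K Fj sm d(2) by (intro mult_strict_left_mono add_le_less_mono sum_mono) auto
    also have "\<dots> = \<epsilon>' * (K * (real (card J) + 1))" by (simp add: algebra_simps)
    also have "\<dots> = \<epsilon>" using K by (simp add: \<epsilon>'_def add_nonneg_eq_0_iff)
    finally show "(\<Sum>i<n. norm (h (b i) - h (a i))) < \<epsilon>" .
  qed
qed

lemma absolutely_continuous_on_imp_continuous_on:
  assumes ac: "absolutely_continuous_on {a..b} f"
  shows "continuous_on {a..b} f"
  unfolding continuous_on_iff
proof (intro ballI allI impI)
  fix x and \<epsilon> :: real assume x: "x \<in> {a..b}" and \<epsilon>: "0 < \<epsilon>"
  from ac[unfolded absolutely_continuous_on_def, THEN spec, THEN mp, OF \<epsilon>]
  obtain \<delta> where \<delta>: "0 < \<delta>" and AC: "\<forall>(n::nat) u v.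
        (\<forall>i<n. u i \<le> v i \<and> {u i..v i} \<subseteq> {a..b}) \<and>
        (\<forall>i<n. \<forall>j<n. i \<noteq> j \<longrightarrow> {u i<..<v i} \<inter> {u j<..<v j} = {}) \<and>
        (\<Sum>i<n. v i - u i) < \<delta> \<longrightarrow> (\<Sum>i<n. norm (f (v i) - f (u i))) < \<epsilon>"
    by (elim exE conjE)
  have step: "norm (f v - f u) < \<epsilon>" if "u \<in> {a..b}" "v \<in> {a..b}" "u \<le> v" "v - u < \<delta>" for u v
    using AC[THEN spec[of _ 1], THEN spec[of _ "\<lambda>_. u"], THEN spec[of _ "\<lambda>_. v"]] that by auto
  show "\<exists>d>0. \<forall>y\<in>{a..b}. dist y x < d \<longrightarrow> dist (f y) (f x) < \<epsilon>"
  proof (intro exI[of _ \<delta>] conjI \<delta> ballI impI)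
    fix y assume y: "y \<in> {a..b}" "dist y x < \<delta>"
    show "dist (f y) (f x) < \<epsilon>"
    proof (cases "x \<le> y")
      case True
      then show ?thesis using step[OF x y(1)] y by (simp add: dist_norm dist_real_def)
    next
      case False
      then show ?thesis using step[OF y(1) x] y by (simp add: dist_norm norm_minus_commute abs_if split: if_splits)
    qed
  qed
qed

lemma locally_absolutely_continuous_onD:
  "locally_absolutely_continuous_on S f \<Longrightarrow> {a..b} \<subseteq> S \<Longrightarrow> absolutely_continuous_on {a..b} f"
  unfolding locally_absolutely_continuous_on_def by blast

lemma locally_absolutely_continuous_on_imp_continuous_on:
  assumes "locally_absolutely_continuous_on {0<..T} f" "0 < a" "b \<le> T"
  shows "continuous_on {a..b} f"
  using assms
  by (intro absolutely_continuous_on_imp_continuous_on locally_absolutely_continuous_onD[OF assms(1)]) auto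

section \<open>Fractional integrals\<close>

definition frac_int :: "real \<Rightarrow> (real \<Rightarrow> 'a::real_normed_vector) \<Rightarrow> real \<Rightarrow> 'a" where
  "frac_int \<mu> f t = integral {0..t} (\<lambda>s. omega \<mu> (t - s) *\<^sub>R f s)"

lemma omega_nonneg: "0 < \<mu> \<Longrightarrow> 0 \<le> omega \<mu> t"
  by (simp add: omega_def Gamma_real_nonneg)

lemma omega_scale:
  assumes "0 < c" "0 \<le> x"
  shows "omega \<mu> (c * x) = c powr (\<mu> - 1) * omega \<mu> x"
  using assms by (simp add: omega_def powr_mult)

lemma powr_reflected_has_derivative:
  assumes "0 < \<mu>" "s < t"
  shows "((\<lambda>s. (t - s) powr \<mu>) has_real_derivative - (\<mu> * (t - s) powr (\<mu> - 1))) (at s)"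
  using assms by (auto intro!: derivative_eq_intros simp: powr_diff)

lemma continuous_on_powr_reflected:
  "0 < \<mu> \<Longrightarrow> continuous_on {0..t} (\<lambda>s. (t - s) powr \<mu>)" for t \<mu> :: real
  by (intro continuous_on_powr' continuous_intros) auto

lemma omega_has_integral:
  assumes "0 < \<mu>" "0 \<le> t"
  shows "((\<lambda>s. omega \<mu> (t - s)) has_integral (t powr \<mu> / Gamma (\<mu> + 1))) {0..t}"
proof -
  have G: "Gamma (\<mu> + 1) = \<mu> * Gamma \<mu>" using assms by (intro Gamma_plus1) auto
  have "((\<lambda>s. omega \<mu> (t - s)) has_integral
      (- ((t - t) powr \<mu>) / Gamma (\<mu> + 1) - - ((t - 0) powr \<mu>) / Gamma (\<mu> + 1))) {0..t}"
  proof (rule fundamental_theorem_of_calculus_interior)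
    show "continuous_on {0..t} (\<lambda>s. - ((t - s) powr \<mu>) / Gamma (\<mu> + 1))"
      using less_imp_neq[OF Gamma_real_pos[of "\<mu> + 1"]] assms
      by (intro continuous_on_divide continuous_on_minus continuous_on_powr_reflected continuous_on_const) auto
    fix s assume s: "s \<in> {0<..<t}"
    have "((\<lambda>s. - ((t - s) powr \<mu>) / Gamma (\<mu> + 1)) has_real_derivative
        - (- (\<mu> * (t - s) powr (\<mu> - 1))) / Gamma (\<mu> + 1)) (at s)"
      using s assms by (intro DERIV_cdivide DERIV_minus powr_reflected_has_derivative) auto
    moreover have "- (- (\<mu> * (t - s) powr (\<mu> - 1))) / Gamma (\<mu> + 1) = omega \<mu> (t - s)"
      using assms by (simp add: omega_def G)
    ultimately show "((\<lambda>s. - ((t - s) powr \<mu>) / Gamma (\<mu> + 1)) has_vector_derivative omega \<mu> (t - s)) (at s)"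
      by (simp add: has_real_derivative_iff_has_vector_derivative)
  qed (use assms in simp)
  then show ?thesis using assms by simp
qed

text \<open>The substitution \<open>v = (t - s)\<^sup>\<mu>\<close> removes the singularity and leaves a continuous integrand, so
  an explicit antiderivative exists with values in any Banach space.\<close>

lemma omega_scaleR_integrable:
  fixes f :: "real \<Rightarrow> 'a::banach"
  assumes "0 < \<mu>" "0 \<le> t" and f: "continuous_on {0..t} f"
  shows "(\<lambda>s. omega \<mu> (t - s) *\<^sub>R f s) integrable_on {0..t}"
proof -
  have G: "Gamma (\<mu> + 1) = \<mu> * Gamma \<mu>" using assms by (intro Gamma_plus1) auto
  define \<Phi> where "\<Phi> v = f (t - v powr (1 / \<mu>))" for v
  define E where "E v = integral {0..v} \<Phi>" for v
  define H where "H s = (- 1 / Gamma (\<mu> + 1)) *\<^sub>R E ((t - s) powr \<mu>)" for s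
  have img: "(t - s) powr \<mu> \<in> {0..t powr \<mu>}" if "s \<in> {0..t}" for s
    using that assms by (auto intro!: powr_mono2)
  have "t - v powr (1 / \<mu>) \<in> {0..t}" if "v \<in> {0..t powr \<mu>}" for v
  proof -
    have "v powr (1 / \<mu>) \<le> (t powr \<mu>) powr (1 / \<mu>)"
      using that assms by (intro powr_mono2) auto
    then show ?thesis using assms by (simp add: powr_powr)
  qed
  then have \<Phi>: "continuous_on {0..t powr \<mu>} \<Phi>"
    unfolding \<Phi>_def using assms
    by (intro continuous_on_compose2[OF f] continuous_on_diff continuous_on_powr' continuous_intros) auto
  have E: "(E has_vector_derivative \<Phi> v) (at v within {0..t powr \<mu>})" if "v \<in> {0..t powr \<mu>}" for v
    unfolding E_def by (rule integral_has_vector_derivative[OF \<Phi> that])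
  have "((\<lambda>s. omega \<mu> (t - s) *\<^sub>R f s) has_integral (H t - H 0)) {0..t}"
  proof (rule fundamental_theorem_of_calculus_interior)
    have "continuous_on {0..t powr \<mu>} E"
      using E by (meson has_vector_derivative_continuous continuous_on_eq_continuous_within)
    then show "continuous_on {0..t} H"
      unfolding H_def using assms img
      by (intro continuous_intros continuous_on_compose2[OF _ continuous_on_powr_reflected]) auto
    fix s assume s: "s \<in> {0<..<t}"
    have "(t - s) powr \<mu> \<in> {0<..<t powr \<mu>}" using s assms by (auto intro!: powr_less_mono2)
    then have "(E has_vector_derivative \<Phi> ((t - s) powr \<mu>)) (at ((t - s) powr \<mu>))"
      using E[of "(t - s) powr \<mu>"] by (simp add: at_within_Icc_at)
    then have "((\<lambda>s. E ((t - s) powr \<mu>)) has_vector_derivative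
        (- (\<mu> * (t - s) powr (\<mu> - 1))) *\<^sub>R \<Phi> ((t - s) powr \<mu>)) (at s)"
      using vector_diff_chain_at[of "\<lambda>s. (t - s) powr \<mu>" "- (\<mu> * (t - s) powr (\<mu> - 1))" s E]
        powr_reflected_has_derivative[of \<mu> s t] s assms
      by (simp add: o_def has_real_derivative_iff_has_vector_derivative)
    then have "(H has_vector_derivative
        (- 1 / Gamma (\<mu> + 1)) *\<^sub>R (- (\<mu> * (t - s) powr (\<mu> - 1))) *\<^sub>R \<Phi> ((t - s) powr \<mu>)) (at s)"
      unfolding H_def by (intro bounded_linear.has_vector_derivative[OF bounded_linear_scaleR_right])
    moreover have "\<Phi> ((t - s) powr \<mu>) = f s"
      using s assms by (simp add: \<Phi>_def powr_powr)
    moreover have "(- 1 / Gamma (\<mu> + 1)) *\<^sub>R (- (\<mu> * (t - s) powr (\<mu> - 1))) *\<^sub>R f s = omega \<mu> (t - s) *\<^sub>R f s"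
      using assms by (simp add: omega_def G)
    ultimately show "(H has_vector_derivative omega \<mu> (t - s) *\<^sub>R f s) (at s)" by metis
  qed (use assms in simp)
  then show ?thesis by blast
qed

lemma norm_frac_int_le:
  fixes f :: "real \<Rightarrow> 'a::banach"
  assumes "0 < \<mu>" "0 \<le> t" "continuous_on {0..t} f" "\<And>s. s \<in> {0..t} \<Longrightarrow> norm (f s) \<le> B"
  shows "norm (frac_int \<mu> f t) \<le> t powr \<mu> / Gamma (\<mu> + 1) * B"
proof -
  have I: "((\<lambda>s. omega \<mu> (t - s) * B) has_integral (t powr \<mu> / Gamma (\<mu> + 1) * B)) {0..t}"
    using assms by (intro has_integral_mult_left omega_has_integral)
  have "norm (frac_int \<mu> f t) \<le> integral {0..t} (\<lambda>s. omega \<mu> (t - s) * B)"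
    unfolding frac_int_def using assms I
    by (intro integral_norm_bound_integral omega_scaleR_integrable)
       (auto simp: omega_nonneg intro!: mult_left_mono)
  then show ?thesis unfolding integral_unique[OF I] .
qed

text \<open>The homogeneity of the kernel.  It yields both the continuity of \<open>frac_int \<mu> f\<close> and its
  behaviour under dilations.\<close>

lemma frac_int_rescale:
  fixes f :: "real \<Rightarrow> 'a::banach"
  assumes "0 < \<mu>" "0 \<le> t" and f: "continuous_on {0..t} f"
  shows "frac_int \<mu> f t = t powr \<mu> *\<^sub>R frac_int \<mu> (\<lambda>x. f (t * x)) 1"
proof (cases "t = 0")
  case True
  then show ?thesis by (simp add: frac_int_def)
next
  case False
  then have t: "0 < t" using assms by simp
  have img: "(\<lambda>x. x / t) ` {0..t} = {0..1}" using t by (simp add: image_divide_atLeastAtMost)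
  have "((\<lambda>x. omega \<mu> (t - t * x) *\<^sub>R f (t * x)) has_integral (1 / \<bar>t\<bar>) *\<^sub>R frac_int \<mu> f t) ((\<lambda>x. x / t) ` {0..t})"
    unfolding frac_int_def using assms t
    by (intro has_integral_stretch_real[where f = "\<lambda>s. omega \<mu> (t - s) *\<^sub>R f s"] integrable_integral omega_scaleR_integrable) auto
  then have 1: "((\<lambda>x. omega \<mu> (t - t * x) *\<^sub>R f (t * x)) has_integral (1 / t) *\<^sub>R frac_int \<mu> f t) {0..1}"
    unfolding img using t by simp
  have "continuous_on {0..1} (\<lambda>x. f (t * x))"
    using t by (intro continuous_on_compose2[OF f] continuous_intros) (auto simp: mult_left_le)
  then have "((\<lambda>x. omega \<mu> (1 - x) *\<^sub>R f (t * x)) has_integral frac_int \<mu> (\<lambda>x. f (t * x)) 1) {0..1}"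
    unfolding frac_int_def using assms by (intro integrable_integral omega_scaleR_integrable) auto
  then have "((\<lambda>x. t powr (\<mu> - 1) *\<^sub>R omega \<mu> (1 - x) *\<^sub>R f (t * x)) has_integral
      t powr (\<mu> - 1) *\<^sub>R frac_int \<mu> (\<lambda>x. f (t * x)) 1) {0..1}"
    by (rule has_integral_cmul)
  then have 2: "((\<lambda>x. omega \<mu> (t - t * x) *\<^sub>R f (t * x)) has_integral
      t powr (\<mu> - 1) *\<^sub>R frac_int \<mu> (\<lambda>x. f (t * x)) 1) {0..1}"
  proof (rule has_integral_eq[rotated])
    fix x :: real assume "x \<in> {0..1}"
    then have "omega \<mu> (t * (1 - x)) = t powr (\<mu> - 1) * omega \<mu> (1 - x)"
      using t by (intro omega_scale) auto
    then show "t powr (\<mu> - 1) *\<^sub>R omega \<mu> (1 - x) *\<^sub>R f (t * x) = omega \<mu> (t - t * x) *\<^sub>R f (t * x)"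
      by (simp add: right_diff_distrib)
  qed
  have "(1 / t) *\<^sub>R frac_int \<mu> f t = t powr (\<mu> - 1) *\<^sub>R frac_int \<mu> (\<lambda>x. f (t * x)) 1"
    using 1 2 by (rule has_integral_unique)
  then have "t *\<^sub>R (1 / t) *\<^sub>R frac_int \<mu> f t = t *\<^sub>R t powr (\<mu> - 1) *\<^sub>R frac_int \<mu> (\<lambda>x. f (t * x)) 1"
    by (rule arg_cong)
  moreover have "t * t powr (\<mu> - 1) = t powr \<mu>" using t by (simp add: powr_diff)
  ultimately show ?thesis using t by simp
qed

lemma frac_int_diff:
  fixes f g :: "real \<Rightarrow> 'a::banach"
  assumes "0 < \<mu>" "0 \<le> t" "continuous_on {0..t} f" "continuous_on {0..t} g"
  shows "frac_int \<mu> (\<lambda>s. f s - g s) t = frac_int \<mu> f t - frac_int \<mu> g t"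
  unfolding frac_int_def using assms
  by (simp add: scaleR_right_diff_distrib omega_scaleR_integrable Henstock_Kurzweil_Integration.integral_diff)

lemma frac_int_bounded_linear:
  fixes f :: "real \<Rightarrow> 'a::banach" and A :: "'a \<Rightarrow> 'b::banach"
  assumes "0 < \<mu>" "0 \<le> t" "continuous_on {0..t} f" and A: "bounded_linear A"
  shows "frac_int \<mu> (\<lambda>s. A (f s)) t = A (frac_int \<mu> f t)"
  using integral_linear[OF omega_scaleR_integrable[OF assms(1-3)] A]
  by (simp add: frac_int_def o_def linear_simps[OF A])

lemma frac_int_continuous_on:
  fixes f :: "real \<Rightarrow> 'a::banach"
  assumes \<mu>: "0 < \<mu>" and f: "continuous_on {0..\<tau>} f"
  shows "continuous_on {0..\<tau>} (frac_int \<mu> f)"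
proof -
  define J where "J t = frac_int \<mu> (\<lambda>x. f (t * x)) 1" for t
  have mem: "t * x \<in> {0..\<tau>}" if "t \<in> {0..\<tau>}" "x \<in> {0..1}" for t x
    using that mult_left_le[of x t] by auto
  have cont: "continuous_on {0..1} (\<lambda>x. f (t * x))" if "t \<in> {0..\<tau>}" for t
    using mem[OF that] by (intro continuous_on_compose2[OF f] continuous_intros) auto
  have G: "Gamma (\<mu> + 1) > 0" using \<mu> by (intro Gamma_real_pos) auto
  have "uniformly_continuous_on {0..\<tau>} f"
    using f by (intro compact_uniformly_continuous) auto
  note uc = this[unfolded uniformly_continuous_on_def]
  have "continuous_on {0..\<tau>} J"
    unfolding continuous_on_iff
  proof (intro ballI allI impI)
    fix t and \<epsilon> :: real assume t: "t \<in> {0..\<tau>}" and \<epsilon>: "0 < \<epsilon>"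
    define \<epsilon>' where "\<epsilon>' = \<epsilon> * Gamma (\<mu> + 1) / 2"
    have "0 < \<epsilon>'" using \<epsilon> G by (simp add: \<epsilon>'_def)
    then obtain d where d: "d > 0"
      and fd: "\<And>x y. x \<in> {0..\<tau>} \<Longrightarrow> y \<in> {0..\<tau>} \<Longrightarrow> dist y x < d \<Longrightarrow> dist (f y) (f x) < \<epsilon>'"
      using uc by meson
    have "dist (J t') (J t) < \<epsilon>" if t': "t' \<in> {0..\<tau>}" "dist t' t < d" for t'
    proof -
      have "J t' - J t = frac_int \<mu> (\<lambda>x. f (t' * x) - f (t * x)) 1"
        unfolding J_def using \<mu> cont t t' by (subst frac_int_diff) auto
      also have "norm \<dots> \<le> 1 powr \<mu> / Gamma (\<mu> + 1) * \<epsilon>'"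
      proof (rule norm_frac_int_le)
        fix x :: real assume x: "x \<in> {0..1}"
        have "dist (t' * x) (t * x) = \<bar>t' - t\<bar> * x"
          using x by (simp add: dist_real_def left_diff_distrib[symmetric] abs_mult)
        also have "\<dots> \<le> \<bar>t' - t\<bar>" using x by (intro mult_left_le) auto
        also have "\<dots> < d" using t' by (simp add: dist_real_def)
        finally have "dist (f (t' * x)) (f (t * x)) < \<epsilon>'" using mem t t' x by (intro fd) auto
        then show "norm (f (t' * x) - f (t * x)) \<le> \<epsilon>'" by (simp add: dist_norm)
      qed (use \<mu> cont t t' in \<open>auto intro: continuous_intros\<close>)
      also have "\<dots> = \<epsilon> / 2" using G by (simp add: \<epsilon>'_def)
      finally show ?thesis using \<epsilon> by (simp add: dist_norm)
    qed
    then show "\<exists>d>0. \<forall>t'\<in>{0..\<tau>}. dist t' t < d \<longrightarrow> dist (J t') (J t) < \<epsilon>" using d by blast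
  qed
  then have "continuous_on {0..\<tau>} (\<lambda>t. t powr \<mu> *\<^sub>R J t)"
    using \<mu> by (intro continuous_on_scaleR continuous_on_powr' continuous_intros) auto
  moreover have "frac_int \<mu> f t = t powr \<mu> *\<^sub>R J t" if "t \<in> {0..\<tau>}" for t
    unfolding J_def using that \<mu> by (intro frac_int_rescale continuous_on_subset[OF f]) auto
  ultimately show ?thesis by (subst continuous_on_cong[OF refl]) auto
qed

lemma frac_int_dilate:
  fixes f :: "real \<Rightarrow> 'a::banach"
  assumes \<mu>: "0 < \<mu>" and "0 < c" "0 \<le> t" and f: "continuous_on {0..c * t} f"
  shows "frac_int \<mu> (\<lambda>s. c *\<^sub>R f (c * s)) t = c powr (1 - \<mu>) *\<^sub>R frac_int \<mu> f (c * t)"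
proof -
  have cf: "continuous_on {0..t} (\<lambda>s. f (c * s))"
    using assms by (intro continuous_on_compose2[OF f] continuous_intros) auto
  have "frac_int \<mu> (\<lambda>s. c *\<^sub>R f (c * s)) t = c *\<^sub>R frac_int \<mu> (\<lambda>s. f (c * s)) t"
    using assms cf by (intro frac_int_bounded_linear bounded_linear_scaleR_right)
  also have "\<dots> = (c * t powr \<mu>) *\<^sub>R frac_int \<mu> (\<lambda>x. f (c * (t * x))) 1"
    using frac_int_rescale[OF \<mu> \<open>0 \<le> t\<close> cf] by simp
  also have "c * t powr \<mu> = c powr (1 - \<mu>) * (c * t) powr \<mu>"
    using assms by (simp add: powr_mult powr_diff)
  also have "\<dots> *\<^sub>R frac_int \<mu> (\<lambda>x. f (c * (t * x))) 1 = c powr (1 - \<mu>) *\<^sub>R frac_int \<mu> f (c * t)"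
    using assms frac_int_rescale[OF \<mu> _ f] by (simp add: mult.assoc)
  finally show ?thesis .
qed

lemma frac_int_one: "frac_int 1 f t = integral {0..t} f"
  unfolding frac_int_def
  by (rule integral_spike[of "{t}"]) (auto simp: omega_def)

section \<open>Positivity of fractional integrals\<close>

definition exp_conv :: "real \<Rightarrow> (real \<Rightarrow> real) \<Rightarrow> real \<Rightarrow> real" where
  "exp_conv a f s = integral {0..s} (\<lambda>r. exp (- a * (s - r)) * f r)"

lemma exp_conv_0 [simp]: "exp_conv a f 0 = 0"
  by (simp add: exp_conv_def)

lemma exp_conv_has_derivative:
  assumes f: "continuous_on {0..\<tau>} f" and s: "s \<in> {0..\<tau>}"
  shows "(exp_conv a f has_real_derivative f s - a * exp_conv a f s) (at s within {0..\<tau>})"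
proof -
  define E where "E s = integral {0..s} (\<lambda>r. exp (a * r) * f r)" for s
  have zE: "exp_conv a f = (\<lambda>s. exp (- a * s) * E s)"
  proof
    fix s
    have "exp_conv a f s = integral {0..s} (\<lambda>r. exp (- a * s) * (exp (a * r) * f r))"
      unfolding exp_conv_def by (intro integral_cong) (simp add: algebra_simps flip: exp_add)
    then show "exp_conv a f s = exp (- a * s) * E s" by (simp add: E_def)
  qed
  have "(E has_real_derivative exp (a * s) * f s) (at s within {0..\<tau>})"
    unfolding E_def using f s
    by (intro integral_has_real_derivative continuous_intros)
  then show ?thesis
    unfolding zE by (auto intro!: derivative_eq_intros simp: algebra_simps simp flip: exp_add)
qed

lemma exp_conv_continuous_on:
  "continuous_on {0..\<tau>} f \<Longrightarrow> continuous_on {0..\<tau>} (exp_conv a f)"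
  by (rule DERIV_continuous_on[OF exp_conv_has_derivative])

text \<open>Both convolutions \<open>y, z\<close> satisfy \<open>y' + a y = f = z' + b z\<close>.  Subtracting the equations and
  multiplying by \<open>y - z\<close> gives \<open>(a + b) y z = ((y - z)\<^sup>2 / 2)' + a y\<^sup>2 + b z\<^sup>2\<close>, and \<open>y - z\<close>
  starts at zero.\<close>

lemma exp_conv_product_nonneg:
  assumes f: "continuous_on {0..\<tau>} f" and "0 \<le> \<tau>" "0 \<le> a" "0 \<le> b"
  shows "0 \<le> integral {0..\<tau>} (\<lambda>s. exp_conv a f s * exp_conv b f s)"
proof (cases "a + b = 0")
  case True
  then have "a = 0" "b = 0" using assms by auto
  then show ?thesis by (intro Henstock_Kurzweil_Integration.integral_nonneg integrable_continuous_real continuous_intros exp_conv_continuous_on f) auto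
next
  case False
  let ?y = "exp_conv a f" and ?z = "exp_conv b f"
  note cont = exp_conv_continuous_on[OF f]
  have "((\<lambda>s. (a + b) * (?y s * ?z s) - (a * (?y s)\<^sup>2 + b * (?z s)\<^sup>2)) has_integral
      ((?y \<tau> - ?z \<tau>)\<^sup>2 / 2 - (?y 0 - ?z 0)\<^sup>2 / 2)) {0..\<tau>}"
  proof (rule fundamental_theorem_of_calculus[OF \<open>0 \<le> \<tau>\<close>])
    fix s assume s: "s \<in> {0..\<tau>}"
    note [derivative_intros] = exp_conv_has_derivative[OF f s]
    have "((\<lambda>s. (?y s - ?z s)\<^sup>2 / 2) has_real_derivative
        (a + b) * (?y s * ?z s) - (a * (?y s)\<^sup>2 + b * (?z s)\<^sup>2)) (at s within {0..\<tau>})"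
      by (auto intro!: derivative_eq_intros simp: field_simps power2_eq_square)
    then show "((\<lambda>s. (?y s - ?z s)\<^sup>2 / 2) has_vector_derivative
        (a + b) * (?y s * ?z s) - (a * (?y s)\<^sup>2 + b * (?z s)\<^sup>2)) (at s within {0..\<tau>})"
      by (simp add: has_real_derivative_iff_has_vector_derivative)
  qed
  then have 1: "integral {0..\<tau>} (\<lambda>s. (a + b) * (?y s * ?z s) - (a * (?y s)\<^sup>2 + b * (?z s)\<^sup>2))
      = (?y \<tau> - ?z \<tau>)\<^sup>2 / 2" by (simp add: integral_unique)
  have 2: "integral {0..\<tau>} (\<lambda>s. (a + b) * (?y s * ?z s) - (a * (?y s)\<^sup>2 + b * (?z s)\<^sup>2))
     = (a + b) * integral {0..\<tau>} (\<lambda>s. ?y s * ?z s) - integral {0..\<tau>} (\<lambda>s. a * (?y s)\<^sup>2 + b * (?z s)\<^sup>2)"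
    by (subst Henstock_Kurzweil_Integration.integral_diff)
       (auto intro!: integrable_continuous_real continuous_intros cont)
  have "0 \<le> integral {0..\<tau>} (\<lambda>s. a * (?y s)\<^sup>2 + b * (?z s)\<^sup>2)"
    using assms by (intro Henstock_Kurzweil_Integration.integral_nonneg)
       (auto intro!: integrable_continuous_real continuous_intros cont)
  then have "0 \<le> (a + b) * integral {0..\<tau>} (\<lambda>s. ?y s * ?z s)"
    using 1 2 zero_le_power2[of "?y \<tau> - ?z \<tau>"] by linarith
  then show ?thesis using False assms by (simp add: zero_le_mult_iff)
qed

text \<open>The truncation to \<open>1 / (n+1) \<le> a \<le> n+1\<close> of the representation
  \<open>\<omega>\<^sub>\<mu>(u) = (\<Gamma>(\<mu>) \<Gamma>(1-\<mu>))\<^sup>-\<^sup>1 \<integral>\<^sub>0\<^sup>\<infinity> a\<^sup>-\<^sup>\<mu> e\<^sup>-\<^sup>a\<^sup>u da\<close>.\<close>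

definition exp_mixture :: "real \<Rightarrow> nat \<Rightarrow> real \<Rightarrow> real" where
  "exp_mixture \<mu> n u =
     integral {1 / Suc n..Suc n} (\<lambda>a. a powr - \<mu> * exp (- a * u)) / (Gamma \<mu> * Gamma (1 - \<mu>))"

text \<open>After the substitution \<open>v = a u\<close> the truncated integrals exhaust the integral for
  \<open>\<Gamma>(1-\<mu>)\<close>.\<close>

lemma exp_mixture_approximates_omega:
  assumes \<mu>: "0 < \<mu>" "\<mu> < 1" and u: "0 < u"
  shows "0 \<le> exp_mixture \<mu> n u" "exp_mixture \<mu> n u \<le> omega \<mu> u"
    "(\<lambda>n. exp_mixture \<mu> n u) \<longlonglongrightarrow> omega \<mu> u"
proof -
  define \<phi> :: "real \<Rightarrow> real" where "\<phi> = (\<lambda>v. v powr - \<mu> / exp v)"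
  define I where "I n = {u / Suc n..u * Suc n}" for n
  have G: "0 < Gamma \<mu>" "0 < Gamma (1 - \<mu>)" using \<mu> by (auto intro!: Gamma_real_pos)
  have \<phi>: "(\<phi> has_integral Gamma (1 - \<mu>)) {0..}"
    using Gamma_integral_real[of "1 - \<mu>"] \<mu> by (simp add: \<phi>_def)
  have \<phi>0: "0 \<le> \<phi> v" for v by (simp add: \<phi>_def)
  have pos: "0 < a" if "1 / real (Suc n) \<le> a" for a n
    using that by (metis less_le_trans of_nat_0_less_iff zero_less_Suc zero_less_divide_1_iff)
  have posu: "0 < v" if "u / real (Suc n) \<le> v" for v n
    using that u by (meson divide_pos_pos less_le_trans of_nat_0_less_iff zero_less_Suc)
  have \<phi>I: "\<phi> integrable_on I n" for n
    unfolding \<phi>_def I_def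
    by (intro integrable_continuous_real continuous_intros) (use posu in fastforce)+
  have stretch: "exp_mixture \<mu> n u = u powr (\<mu> - 1) * integral (I n) \<phi> / (Gamma \<mu> * Gamma (1 - \<mu>))" for n
  proof -
    have img: "(\<lambda>x. x / u) ` I n = {1 / Suc n..Suc n}"
      unfolding I_def using u by (subst image_divide_atLeastAtMost) auto
    have "((\<lambda>a. \<phi> (u * a)) has_integral (1 / \<bar>u\<bar>) *\<^sub>R integral (I n) \<phi>) ((\<lambda>x. x / u) ` I n)"
      using \<phi>I[of n] u unfolding I_def by (intro has_integral_stretch_real integrable_integral) auto
    then have "((\<lambda>a. \<phi> (u * a)) has_integral integral (I n) \<phi> / u) {1 / Suc n..Suc n}"
      unfolding img using u by simp
    then have "((\<lambda>a. u powr \<mu> * \<phi> (u * a)) has_integral u powr \<mu> * (integral (I n) \<phi> / u)) {1 / Suc n..Suc n}"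
      by (rule has_integral_mult_right)
    then have "((\<lambda>a. a powr - \<mu> * exp (- a * u)) has_integral u powr \<mu> * (integral (I n) \<phi> / u)) {1 / Suc n..Suc n}"
    proof (rule has_integral_eq[rotated])
      fix a assume "a \<in> {1 / real (Suc n)..Suc n}"
      then have "0 < a" using pos by auto
      then show "u powr \<mu> * \<phi> (u * a) = a powr - \<mu> * exp (- a * u)"
        using u by (simp add: \<phi>_def powr_mult powr_minus exp_minus field_simps)
    qed
    then show ?thesis using u by (simp add: exp_mixture_def integral_unique powr_diff)
  qed
  have om: "omega \<mu> u = u powr (\<mu> - 1) * Gamma (1 - \<mu>) / (Gamma \<mu> * Gamma (1 - \<mu>))"
    using G by (simp add: omega_def)
  have I0: "I n \<subseteq> {0..}" for n using posu by (force simp: I_def)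
  show "0 \<le> exp_mixture \<mu> n u"
    unfolding stretch using G \<phi>0 \<phi>I
    by (intro divide_nonneg_nonneg mult_nonneg_nonneg Henstock_Kurzweil_Integration.integral_nonneg) auto
  have "integral (I n) \<phi> \<le> integral {0..} \<phi>"
    using \<phi> \<phi>0 \<phi>I I0 by (intro integral_subset_le) auto
  then show "exp_mixture \<mu> n u \<le> omega \<mu> u"
    unfolding stretch om integral_unique[OF \<phi>] using G by (intro divide_right_mono mult_left_mono) auto
  have "(\<lambda>n. integral {0..} (\<lambda>v. if v \<in> I n then \<phi> v else 0)) \<longlonglongrightarrow> integral {0..} \<phi>"
  proof (rule dominated_convergence(2)[where h = \<phi>])
    show "(\<lambda>v. if v \<in> I n then \<phi> v else 0) integrable_on {0..}" for n
      using integrable_on_superset[of "\<lambda>v. if v \<in> I n then \<phi> v else 0" "I n" "{0..}"] \<phi>I[of n] I0[of n]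
      by (simp add: integrable_restrict_Int Int_absorb2)
    show "\<phi> integrable_on {0..}" using \<phi> by blast
    show "norm (if v \<in> I n then \<phi> v else 0) \<le> \<phi> v" for n v using \<phi>0[of v] by simp
    fix v :: real assume v: "v \<in> {0..}"
    show "(\<lambda>n. if v \<in> I n then \<phi> v else 0) \<longlonglongrightarrow> \<phi> v"
    proof (cases "v = 0")
      case True
      then have "\<phi> v = 0" by (simp add: \<phi>_def)
      then show ?thesis by (simp cong: if_cong)
    next
      case False
      then have "0 < v" using v by simp
      obtain N where N: "max (u / v) (v / u) < real N" using reals_Archimedean2 by blast
      have "v \<in> I n" if "n \<ge> N" for n
      proof -
        have "u / v \<le> real (Suc n)" "v / u \<le> real (Suc n)" using N that by auto
        then show ?thesis using u \<open>0 < v\<close> by (simp add: I_def field_simps)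
      qed
      then have "eventually (\<lambda>n. (if v \<in> I n then \<phi> v else 0) = \<phi> v) sequentially"
        by (intro eventually_sequentiallyI[of N]) simp
      then show ?thesis by (rule tendsto_eventually)
    qed
  qed
  moreover have "integral {0..} (\<lambda>v. if v \<in> I n then \<phi> v else 0) = integral (I n) \<phi>" for n
    using I0[of n] by (simp add: Henstock_Kurzweil_Integration.integral_restrict_Int Int_absorb2)
  ultimately have "(\<lambda>n. integral (I n) \<phi>) \<longlonglongrightarrow> Gamma (1 - \<mu>)"
    using integral_unique[OF \<phi>] by simp
  then show "(\<lambda>n. exp_mixture \<mu> n u) \<longlonglongrightarrow> omega \<mu> u"
    unfolding stretch om using G by (intro tendsto_intros) auto
qed

text \<open>On a fixed interval of integration the dependence on \<open>s\<close> sits in the integrand alone, which gives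
  joint continuity in \<open>a\<close> and \<open>s\<close>.\<close>

lemma exp_conv_rescale:
  assumes "0 \<le> s" and f: "continuous_on {0..s} f"
  shows "exp_conv a f s = integral {0..1} (\<lambda>x. s * exp (- a * (s * (1 - x))) * f (s * x))"
proof -
  have "exp_conv a f s = frac_int 1 (\<lambda>r. exp (- a * (s - r)) * f r) s"
    by (simp add: frac_int_one exp_conv_def)
  also have "\<dots> = s * frac_int 1 (\<lambda>x. exp (- a * (s - s * x)) * f (s * x)) 1"
    using assms by (subst frac_int_rescale) (auto intro!: continuous_intros)
  also have "\<dots> = integral {0..1} (\<lambda>x. s * exp (- a * (s * (1 - x))) * f (s * x))"
    by (simp add: frac_int_one right_diff_distrib mult.assoc)
  finally show ?thesis .
qed

lemma exp_conv_jointly_continuous: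
  assumes f: "continuous_on {0..\<tau>} f"
  shows "continuous_on ({c..d} \<times> {0..\<tau>}) (\<lambda>(a, s). exp_conv a f s)"
proof -
  have mem: "s * x \<in> {0..\<tau>}" if "s \<in> {0..\<tau>}" "x \<in> {0..1}" for s x
    using that mult_left_le[of x s] by auto
  have "continuous_on (({c..d} \<times> {0..\<tau>}) \<times> cbox 0 1)
      (\<lambda>(p, x). snd p * exp (- fst p * (snd p * (1 - x))) * f (snd p * x))"
    unfolding split_beta using mem
    by (intro continuous_intros continuous_on_compose2[OF f]) auto
  then have "continuous_on ({c..d} \<times> {0..\<tau>})
      (\<lambda>p. integral (cbox 0 1) (\<lambda>x. snd p * exp (- fst p * (snd p * (1 - x))) * f (snd p * x)))"
    by (rule integral_continuous_on_param)
  then show ?thesis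
  proof (rule continuous_on_eq)
    fix p assume "p \<in> {c..d} \<times> {0..\<tau>}"
    then show "integral (cbox 0 1) (\<lambda>x. snd p * exp (- fst p * (snd p * (1 - x))) * f (snd p * x))
        = (case p of (a, s) \<Rightarrow> exp_conv a f s)"
      using exp_conv_rescale[of "snd p" f "fst p"] continuous_on_subset[OF f, of "{0..snd p}"]
      by (auto simp: split_beta)
  qed
qed

lemma integral_exp_mixture:
  assumes "0 \<le> s" and f: "continuous_on {0..s} f"
  shows "integral {0..s} (\<lambda>r. exp_mixture \<mu> n (s - r) * f r)
    = integral {1 / Suc n..Suc n} (\<lambda>a. a powr - \<mu> * exp_conv a f s) / (Gamma \<mu> * Gamma (1 - \<mu>))"
proof -
  let ?I = "{1 / real (Suc n)..real (Suc n)}"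
  have pos: "0 < a" if "1 / real (Suc n) \<le> a" for a
    using that by (metis less_le_trans of_nat_0_less_iff zero_less_Suc zero_less_divide_1_iff)
  have "continuous_on (cbox (0, 1 / real (Suc n)) (s, real (Suc n)))
      (\<lambda>(r, a). a powr - \<mu> * exp (- a * (s - r)) * f r)"
    unfolding split_beta cbox_Pair_eq
    by (intro continuous_intros continuous_on_compose2[OF f]) (use pos in fastforce)+
  from integral_swap_continuous[OF this]
  have "integral {0..s} (\<lambda>r. integral ?I (\<lambda>a. a powr - \<mu> * exp (- a * (s - r)) * f r))
      = integral ?I (\<lambda>a. integral {0..s} (\<lambda>r. a powr - \<mu> * exp (- a * (s - r)) * f r))"
    by simp
  also have "\<dots> = integral ?I (\<lambda>a. a powr - \<mu> * exp_conv a f s)"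
    unfolding exp_conv_def by (simp only: mult.assoc integral_mult_right)
  finally show ?thesis
    by (simp only: exp_mixture_def integral_mult_left integral_divide times_divide_eq_left)
qed

text \<open>The integral is linear in the kernel, and \<open>\<omega>\<^sub>\<mu>\<close> is a positive mixture of
  exponentials.  For the truncated mixtures only continuous functions on rectangles are involved, so the order of integration
  may be exchanged; dominated convergence removes the truncation.\<close>

lemma integral_frac_int_nonneg:
  assumes \<mu>: "0 < \<mu>" "\<mu> < 1" and \<tau>: "0 \<le> \<tau>"
    and f: "continuous_on {0..\<tau>} f" and h: "continuous_on {0..\<tau>} h"
    and pos: "\<And>a. 0 < a \<Longrightarrow> 0 \<le> integral {0..\<tau>} (\<lambda>s. h s * exp_conv a f s)"
  shows "0 \<le> integral {0..\<tau>} (\<lambda>s. h s * frac_int \<mu> f s)"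
proof -
  define C where "C = Gamma \<mu> * Gamma (1 - \<mu>)"
  have C: "0 < C" unfolding C_def using \<mu> by (intro mult_pos_pos Gamma_real_pos) auto
  define G where "G n s = integral {0..s} (\<lambda>r. exp_mixture \<mu> n (s - r) * f r)" for n s
  have sub: "continuous_on {0..s} f" if "s \<in> {0..\<tau>}" for s
    using that by (intro continuous_on_subset[OF f]) auto
  have apos: "0 < a" if "1 / real (Suc n) \<le> a" for a n
    using that by (metis less_le_trans of_nat_0_less_iff zero_less_Suc zero_less_divide_1_iff)
  obtain F where F: "0 < F" "\<And>s. s \<in> {0..\<tau>} \<Longrightarrow> norm (f s) \<le> F"
    using compact_imp_bounded[OF compact_continuous_image[OF f]] by (force simp: bounded_pos)
  obtain H where H: "0 < H" "\<And>s. s \<in> {0..\<tau>} \<Longrightarrow> norm (h s) \<le> H"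
    using compact_imp_bounded[OF compact_continuous_image[OF h]] by (force simp: bounded_pos)
  have hG: "h s * G n s = integral {1 / Suc n..Suc n} (\<lambda>a. h s * (a powr - \<mu> * exp_conv a f s)) / C"
    if "s \<in> {0..\<tau>}" for n s
    using integral_exp_mixture[OF _ sub[OF that], of \<mu> n] that by (simp add: G_def C_def)
  have zc: "continuous_on ({0..\<tau>} \<times> {1 / real (Suc n)..real (Suc n)}) (\<lambda>p. exp_conv (snd p) f (fst p))" for n
  proof -
    have "continuous_on ({0..\<tau>} \<times> {1 / real (Suc n)..real (Suc n)})
        (\<lambda>p. case (snd p, fst p) of (a, s) \<Rightarrow> exp_conv a f s)"
      by (rule continuous_on_compose2[OF exp_conv_jointly_continuous[OF f]])
         (auto intro!: continuous_intros)
    then show ?thesis by simp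
  qed
  have kc: "continuous_on ({0..\<tau>} \<times> {1 / real (Suc n)..real (Suc n)})
      (\<lambda>p. h (fst p) * (snd p powr - \<mu> * exp_conv (snd p) f (fst p)))" for n
    by (intro continuous_intros continuous_on_compose2[OF h] zc) (use apos in fastforce)+
  have contG: "continuous_on {0..\<tau>} (\<lambda>s. h s * G n s)" for n
  proof -
    have "continuous_on ({0..\<tau>} \<times> cbox (1 / real (Suc n)) (real (Suc n)))
        (\<lambda>(s, a). h s * (a powr - \<mu> * exp_conv a f s))"
      using kc[of n] by (simp only: case_prod_beta' cbox_Pair_eq box_real)
    from integral_continuous_on_param[OF this] C
    have "continuous_on {0..\<tau>} (\<lambda>s. integral {1 / Suc n..Suc n} (\<lambda>a. h s * (a powr - \<mu> * exp_conv a f s)) / C)"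
      by (intro continuous_intros) auto
    then show ?thesis by (rule continuous_on_eq) (simp add: hG)
  qed
  have nonneg: "0 \<le> integral {0..\<tau>} (\<lambda>s. h s * G n s)" for n
  proof -
    have cont: "continuous_on (cbox (0, 1 / real (Suc n)) (\<tau>, real (Suc n)))
        (\<lambda>(s, a). h s * (a powr - \<mu> * exp_conv a f s))"
      using kc[of n] by (simp only: case_prod_beta' cbox_Pair_eq box_real)
    have "integral {0..\<tau>} (\<lambda>s. h s * G n s)
        = integral {0..\<tau>} (\<lambda>s. integral {1 / Suc n..Suc n} (\<lambda>a. h s * (a powr - \<mu> * exp_conv a f s)) / C)"
      by (intro integral_cong hG)
    also have "\<dots> = integral {0..\<tau>} (\<lambda>s. integral {1 / Suc n..Suc n} (\<lambda>a. h s * (a powr - \<mu> * exp_conv a f s))) / C"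
      by simp
    also have "\<dots> = integral {1 / Suc n..Suc n} (\<lambda>a. integral {0..\<tau>} (\<lambda>s. h s * (a powr - \<mu> * exp_conv a f s))) / C"
      using integral_swap_continuous[OF cont] by simp
    also have "\<dots> = integral {1 / Suc n..Suc n} (\<lambda>a. a powr - \<mu> * integral {0..\<tau>} (\<lambda>s. h s * exp_conv a f s)) / C"
      by (simp only: mult.left_commute[of "h _"] integral_mult_right)
    also have "\<dots> \<ge> 0"
    proof (cases "(\<lambda>a. a powr - \<mu> * integral {0..\<tau>} (\<lambda>s. h s * exp_conv a f s)) integrable_on {1 / Suc n..Suc n}")
      case True
      then show ?thesis using C pos apos
        by (intro divide_nonneg_nonneg Henstock_Kurzweil_Integration.integral_nonneg) auto
    qed (simp add: not_integrable_integral)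
    finally show ?thesis .
  qed
  have bnd: "norm (if r = s then 0 else exp_mixture \<mu> n (s - r) * f r) \<le> omega \<mu> (s - r) * F"
    if "s \<in> {0..\<tau>}" "r \<in> {0..s}" for n s r
  proof (cases "r = s")
    case True
    then show ?thesis using F(1) \<mu> by (simp add: omega_nonneg)
  next
    case False
    then have "0 < s - r" using that by auto
    from exp_mixture_approximates_omega(1,2)[OF \<mu> this, of n] F(2)[of r] False that
    show ?thesis by (auto simp: abs_mult intro!: mult_mono)
  qed
  have omI: "((\<lambda>r. omega \<mu> (s - r) * F) has_integral (s powr \<mu> / Gamma (\<mu> + 1) * F)) {0..s}"
    if "s \<in> {0..\<tau>}" for s using that \<mu> by (intro has_integral_mult_left omega_has_integral) auto
  \<comment> \<open>At \<open>r = s\<close> the mixture is positive whereas \<open>omega\<close> has the value 0, so this point is removed before comparing.\<close>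
  have spike: "integral {0..s} (\<lambda>r. if r = s then 0 else exp_mixture \<mu> n (s - r) * f r) = G n s" for n s
    unfolding G_def by (rule integral_spike[of "{s}"]) auto
  have intG: "(\<lambda>r. if r = s then 0 else exp_mixture \<mu> n (s - r) * f r) integrable_on {0..s}"
    if s: "s \<in> {0..\<tau>}" for n s
  proof -
    have "continuous_on ({0..s} \<times> cbox (1 / real (Suc n)) (real (Suc n)))
        (\<lambda>(r, a). a powr - \<mu> * exp (- a * (s - r)))"
      unfolding split_beta by (intro continuous_intros) (use apos in fastforce)+
    from integral_continuous_on_param[OF this]
    have "continuous_on {0..s} (\<lambda>r. exp_mixture \<mu> n (s - r))"
      unfolding exp_mixture_def using C by (intro continuous_intros) (auto simp: C_def)
    then have "(\<lambda>r. exp_mixture \<mu> n (s - r) * f r) integrable_on {0..s}"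
      by (intro integrable_continuous_real continuous_intros sub[OF s])
    then show ?thesis by (rule integrable_spike[where S = "{s}"]) auto
  qed
  have lim: "(\<lambda>n. G n s) \<longlonglongrightarrow> frac_int \<mu> f s" if s: "s \<in> {0..\<tau>}" for s
    unfolding spike[symmetric] frac_int_def
  proof (rule dominated_convergence(2)[OF intG[OF s] _ bnd[OF s]])
    show "(\<lambda>r. omega \<mu> (s - r) * F) integrable_on {0..s}" using omI[OF s] by blast
    fix r assume r: "r \<in> {0..s}"
    show "(\<lambda>n. if r = s then 0 else exp_mixture \<mu> n (s - r) * f r) \<longlonglongrightarrow> omega \<mu> (s - r) *\<^sub>R f r"
    proof (cases "r = s")
      case True
      then show ?thesis by (simp add: omega_def)
    next
      case False
      then show ?thesis
        using exp_mixture_approximates_omega(3)[OF \<mu>, of "s - r"] r by (auto intro!: tendsto_intros)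
    qed
  qed
  define K where "K = H * (\<tau> powr \<mu> / Gamma (\<mu> + 1) * F)"
  have "(\<lambda>n. integral {0..\<tau>} (\<lambda>s. h s * G n s)) \<longlonglongrightarrow> integral {0..\<tau>} (\<lambda>s. h s * frac_int \<mu> f s)"
  proof (rule dominated_convergence(2)[where h = "\<lambda>_. K"])
    show "(\<lambda>s. h s * G n s) integrable_on {0..\<tau>}" for n
      by (intro integrable_continuous_real contG)
    fix n s assume s: "s \<in> {0..\<tau>}"
    have "norm (G n s) \<le> integral {0..s} (\<lambda>r. omega \<mu> (s - r) * F)"
      unfolding spike[symmetric] using omI[OF s]
      by (intro integral_norm_bound_integral intG[OF s] bnd[OF s]) auto
    also have "\<dots> = s powr \<mu> / Gamma (\<mu> + 1) * F" by (rule integral_unique[OF omI[OF s]])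
    also have "\<dots> \<le> \<tau> powr \<mu> / Gamma (\<mu> + 1) * F"
      using s \<mu> F(1) Gamma_real_pos[of "\<mu> + 1"]
      by (intro mult_right_mono divide_right_mono powr_mono2) auto
    finally have "norm (G n s) \<le> \<tau> powr \<mu> / Gamma (\<mu> + 1) * F" .
    then show "norm (h s * G n s) \<le> K"
      unfolding K_def norm_mult using H(2)[OF s] H(1) by (intro mult_mono) auto
  qed (auto intro!: tendsto_intros lim)
  then show ?thesis
    by (rule LIMSEQ_le_const) (use nonneg in blast)
qed

text \<open>The two kernels are resolved into exponentials one after the other, starting from the case of two
  exponentials.  The kernel \<open>\<omega>\<^sub>1 = 1\<close> is itself the exponential with \<open>a = 0\<close>.\<close>

lemma frac_int_product_nonneg:
  fixes f :: "real \<Rightarrow> real"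
  assumes f: "continuous_on {0..\<tau>} f" and \<tau>: "0 \<le> \<tau>"
    and \<mu>: "0 < \<mu>" "\<mu> \<le> 1" and \<nu>: "0 < \<nu>" "\<nu> \<le> 1"
  shows "0 \<le> integral {0..\<tau>} (\<lambda>s. frac_int \<mu> f s * frac_int \<nu> f s)"
proof -
  have one: "frac_int 1 f = exp_conv 0 f"
    by (rule ext) (simp add: frac_int_one exp_conv_def)
  have step: "0 \<le> integral {0..\<tau>} (\<lambda>s. h s * frac_int \<mu> f s)"
    if h: "continuous_on {0..\<tau>} h" and \<mu>: "0 < \<mu>" "\<mu> \<le> 1"
      and pos: "\<And>a. 0 \<le> a \<Longrightarrow> 0 \<le> integral {0..\<tau>} (\<lambda>s. h s * exp_conv a f s)" for h \<mu>
  proof (cases "\<mu> = 1")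
    case True
    then show ?thesis using pos[of 0] by (simp add: one)
  next
    case False
    then show ?thesis using that \<tau> f by (intro integral_frac_int_nonneg) auto
  qed
  have "0 \<le> integral {0..\<tau>} (\<lambda>s. exp_conv a f s * frac_int \<mu> f s)" if "0 \<le> a" for a
    using that by (intro step exp_conv_product_nonneg f \<tau> \<mu> exp_conv_continuous_on)
  then show ?thesis
    using \<mu> \<nu> f by (intro step frac_int_continuous_on) (auto simp: mult.commute)
qed

section \<open>Energy estimates and dilation differences\<close>

lemma integral_form_frac_int_nonneg:
  fixes f :: "real \<Rightarrow> 'a::{real_inner, banach}"
  assumes B: "sum_of_squares_form B" and f: "continuous_on {0..\<tau>} f" and \<tau>: "0 \<le> \<tau>"
    and \<mu>: "0 < \<mu>" "\<mu> \<le> 1" and \<nu>: "0 < \<nu>" "\<nu> \<le> 1"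
  shows "0 \<le> integral {0..\<tau>} (\<lambda>s. B (frac_int \<mu> f s) (frac_int \<nu> f s))"
proof -
  obtain n :: nat and \<eta> where B: "\<And>u v. B u v = (\<Sum>k<n. inner u (\<eta> k) * inner v (\<eta> k))"
    using B unfolding sum_of_squares_form_def by blast
  define f' where "f' k s = inner (f s) (\<eta> k)" for k s
  have f': "continuous_on {0..\<tau>} (f' k)" for k
    unfolding f'_def by (intro continuous_intros f)
  have comp: "inner (frac_int \<mu> f s) (\<eta> k) = frac_int \<mu> (f' k) s"
    if "s \<in> {0..\<tau>}" "0 < \<mu>" for \<mu> s k
    unfolding f'_def using that
    by (intro frac_int_bounded_linear[symmetric] continuous_on_subset[OF f] bounded_linear_inner_left) auto
  have "integral {0..\<tau>} (\<lambda>s. B (frac_int \<mu> f s) (frac_int \<nu> f s))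
      = integral {0..\<tau>} (\<lambda>s. \<Sum>k<n. frac_int \<mu> (f' k) s * frac_int \<nu> (f' k) s)"
    unfolding B using \<mu> \<nu> by (intro integral_cong sum.cong) (simp_all add: comp)
  also have "\<dots> = (\<Sum>k<n. integral {0..\<tau>} (\<lambda>s. frac_int \<mu> (f' k) s * frac_int \<nu> (f' k) s))"
    using \<mu> \<nu> f'
    by (intro integral_sum integrable_continuous_real continuous_intros frac_int_continuous_on) auto
  also have "\<dots> \<ge> 0"
    using \<mu> \<nu> f' \<tau> by (intro sum_nonneg frac_int_product_nonneg) auto
  finally show ?thesis .
qed

lemma integral_norm_square_sum_ge:
  fixes w :: "'i \<Rightarrow> real \<Rightarrow> 'a::{real_inner, banach}"
  assumes I: "finite I" and w: "\<And>i. i \<in> I \<Longrightarrow> continuous_on {0..\<tau>} (w i)" and y: "continuous_on {0..\<tau>} y"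
    and ww: "\<And>i l. i \<in> I \<Longrightarrow> l \<in> I \<Longrightarrow> 0 \<le> integral {0..\<tau>} (\<lambda>s. inner (w i s) (w l s))"
    and wy: "\<And>i. i \<in> I \<Longrightarrow> 0 \<le> integral {0..\<tau>} (\<lambda>s. inner (w i s) (y s))"
  shows "(\<Sum>i\<in>I. integral {0..\<tau>} (\<lambda>s. (norm (w i s))\<^sup>2)) + integral {0..\<tau>} (\<lambda>s. (norm (y s))\<^sup>2)
    \<le> integral {0..\<tau>} (\<lambda>s. (norm ((\<Sum>i\<in>I. w i s) + y s))\<^sup>2)"
proof -
  let ?J = "integral {0..\<tau>}"
  have expand: "(norm ((\<Sum>i\<in>I. w i s) + y s))\<^sup>2
      = (\<Sum>i\<in>I. \<Sum>l\<in>I. inner (w i s) (w l s)) + ((\<Sum>i\<in>I. 2 * inner (w i s) (y s)) + (norm (y s))\<^sup>2)" for s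
  proof -
    have "inner (\<Sum>i\<in>I. w i s) (\<Sum>i\<in>I. w i s) = (\<Sum>i\<in>I. \<Sum>l\<in>I. inner (w i s) (w l s))"
      by (subst inner_sum_left, subst inner_sum_right) (rule refl)
    moreover have "(\<Sum>i\<in>I. 2 * inner (w i s) (y s)) = 2 * inner (\<Sum>i\<in>I. w i s) (y s)"
      by (simp only: inner_sum_left sum_distrib_left)
    ultimately show ?thesis
      using dot_norm[of "\<Sum>i\<in>I. w i s" "y s"] by (simp add: power2_norm_eq_inner)
  qed
  have i1: "(\<lambda>s. \<Sum>i\<in>I. \<Sum>l\<in>I. inner (w i s) (w l s)) integrable_on {0..\<tau>}"
    and i2: "(\<lambda>s. \<Sum>i\<in>I. 2 * inner (w i s) (y s)) integrable_on {0..\<tau>}"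
    and i3: "(\<lambda>s. (norm (y s))\<^sup>2) integrable_on {0..\<tau>}"
    by (intro integrable_continuous_real continuous_intros w y; assumption)+
  have "?J (\<lambda>s. (norm ((\<Sum>i\<in>I. w i s) + y s))\<^sup>2) = ?J (\<lambda>s. \<Sum>i\<in>I. \<Sum>l\<in>I. inner (w i s) (w l s))
      + (?J (\<lambda>s. \<Sum>i\<in>I. 2 * inner (w i s) (y s)) + ?J (\<lambda>s. (norm (y s))\<^sup>2))"
    unfolding expand
    by (subst Henstock_Kurzweil_Integration.integral_add[OF i1 integrable_add[OF i2 i3]],
        subst Henstock_Kurzweil_Integration.integral_add[OF i2 i3]) simp
  moreover have "?J (\<lambda>s. \<Sum>i\<in>I. \<Sum>l\<in>I. inner (w i s) (w l s))
      = (\<Sum>i\<in>I. \<Sum>l\<in>I. ?J (\<lambda>s. inner (w i s) (w l s)))"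
  proof -
    have "?J (\<lambda>s. \<Sum>i\<in>I. \<Sum>l\<in>I. inner (w i s) (w l s)) = (\<Sum>i\<in>I. ?J (\<lambda>s. \<Sum>l\<in>I. inner (w i s) (w l s)))"
      by (intro integral_sum I integrable_continuous_real continuous_intros w; assumption)
    also have "\<dots> = (\<Sum>i\<in>I. \<Sum>l\<in>I. ?J (\<lambda>s. inner (w i s) (w l s)))"
      by (intro sum.cong refl integral_sum I integrable_continuous_real continuous_intros w; assumption)
    finally show ?thesis .
  qed
  moreover have "?J (\<lambda>s. \<Sum>i\<in>I. 2 * inner (w i s) (y s)) = (\<Sum>i\<in>I. 2 * ?J (\<lambda>s. inner (w i s) (y s)))"
  proof -
    have "?J (\<lambda>s. \<Sum>i\<in>I. 2 * inner (w i s) (y s)) = (\<Sum>i\<in>I. ?J (\<lambda>s. 2 * inner (w i s) (y s)))"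
      by (intro integral_sum I integrable_continuous_real continuous_intros w y; assumption)
    then show ?thesis by simp
  qed
  moreover have "(\<Sum>i\<in>I. ?J (\<lambda>s. (norm (w i s))\<^sup>2)) \<le> (\<Sum>i\<in>I. \<Sum>l\<in>I. ?J (\<lambda>s. inner (w i s) (w l s)))"
  proof (rule sum_mono)
    fix i assume i: "i \<in> I"
    then show "?J (\<lambda>s. (norm (w i s))\<^sup>2) \<le> (\<Sum>l\<in>I. ?J (\<lambda>s. inner (w i s) (w l s)))"
      unfolding power2_norm_eq_inner using I ww by (intro member_le_sum) auto
  qed
  moreover have "0 \<le> (\<Sum>i\<in>I. 2 * ?J (\<lambda>s. inner (w i s) (y s)))"
    using wy by (intro sum_nonneg) auto
  ultimately show ?thesis by linarith
qed

lemma norm_diff_sum_square_le: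
  fixes v :: "'i \<Rightarrow> 'a::real_normed_vector"
  shows "(norm (a - (\<Sum>i\<in>I. v i)))\<^sup>2 \<le> 2 * (norm a)\<^sup>2 + 2 * real (card I) * (\<Sum>i\<in>I. (norm (v i))\<^sup>2)"
proof -
  have "norm (a - (\<Sum>i\<in>I. v i)) \<le> norm a + (\<Sum>i\<in>I. norm (v i))"
    using norm_triangle_ineq4[of a "\<Sum>i\<in>I. v i"] norm_sum[of v I] by linarith
  then have "(norm (a - (\<Sum>i\<in>I. v i)))\<^sup>2 \<le> (norm a + (\<Sum>i\<in>I. norm (v i)))\<^sup>2"
    by (intro power_mono) auto
  also have "\<dots> \<le> 2 * (norm a)\<^sup>2 + 2 * (\<Sum>i\<in>I. norm (v i))\<^sup>2"
    using sum_squares_bound[of "norm a" "\<Sum>i\<in>I. norm (v i)"] by (simp add: power2_sum)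
  also have "(\<Sum>i\<in>I. norm (v i))\<^sup>2 \<le> (\<Sum>i\<in>I. (norm (v i))\<^sup>2) * card I"
    by (rule sum_squared_le_sum_of_squares)
  finally show ?thesis by (simp add: algebra_simps)
qed

lemma integral_dilate:
  fixes \<phi> :: "real \<Rightarrow> real"
  assumes c: "0 < c" and \<phi>: "continuous_on {0..c * \<tau>} \<phi>"
  shows "c * integral {0..\<tau>} (\<lambda>s. \<phi> (c * s)) = integral {0..c * \<tau>} \<phi>"
proof -
  have "((\<lambda>s. \<phi> (c * s)) has_integral (1 / \<bar>c\<bar>) *\<^sub>R integral {0..c * \<tau>} \<phi>) ((\<lambda>x. x / c) ` {0..c * \<tau>})"
    using c \<phi> by (intro has_integral_stretch_real integrable_integral integrable_continuous_real) auto
  moreover have "(\<lambda>x. x / c) ` {0..c * \<tau>} = {0..\<tau>}"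
    using c by (subst image_divide_atLeastAtMost) auto
  ultimately show ?thesis using c by (simp add: integral_unique)
qed

lemma integral_dilate_le:
  fixes \<phi> :: "real \<Rightarrow> real"
  assumes c: "1 / 2 \<le> c" "c \<le> 1" and \<tau>: "0 \<le> \<tau>" and \<phi>: "continuous_on {0..\<tau>} \<phi>"
    and nn: "\<And>s. s \<in> {0..\<tau>} \<Longrightarrow> 0 \<le> \<phi> s"
  shows "integral {0..\<tau>} (\<lambda>s. \<phi> (c * s)) \<le> 2 * integral {0..\<tau>} \<phi>"
proof -
  have le: "c * \<tau> \<le> \<tau>" using c \<tau> by (intro mult_left_le_one_le) auto
  have \<phi>c: "continuous_on {0..c * \<tau>} \<phi>" using le by (intro continuous_on_subset[OF \<phi>]) auto
  have "c * integral {0..\<tau>} (\<lambda>s. \<phi> (c * s)) = integral {0..c * \<tau>} \<phi>"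
    using c \<phi>c by (intro integral_dilate) auto
  also have "\<dots> \<le> integral {0..\<tau>} \<phi>"
    using le nn by (intro integral_subset_le integrable_continuous_real \<phi> \<phi>c) auto
  finally have *: "c * integral {0..\<tau>} (\<lambda>s. \<phi> (c * s)) \<le> integral {0..\<tau>} \<phi>" .
  have "c * s \<in> {0..\<tau>}" if "s \<in> {0..\<tau>}" for s
    using that c mult_left_le_one_le[of s c] by auto
  then have "0 \<le> integral {0..\<tau>} (\<lambda>s. \<phi> (c * s))"
    using nn by (intro Henstock_Kurzweil_Integration.integral_nonneg integrable_continuous_real
        continuous_on_compose2[OF \<phi>] continuous_intros) auto
  then have "1 / 2 * integral {0..\<tau>} (\<lambda>s. \<phi> (c * s)) \<le> c * integral {0..\<tau>} (\<lambda>s. \<phi> (c * s))"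
    using c by (intro mult_right_mono) auto
  then show ?thesis using * by linarith
qed

text \<open>The factor \<open>c\<close> makes the primitive of \<open>dilation_diff c f\<close> the plain difference
  \<open>y(c s) - y(s)\<close> of the primitive \<open>y\<close> of \<open>f\<close>.\<close>

definition dilation_diff :: "real \<Rightarrow> (real \<Rightarrow> 'a::real_vector) \<Rightarrow> real \<Rightarrow> 'a" where
  "dilation_diff c f s = c *\<^sub>R f (c * s) - f s"

lemma dilate_mem:
  fixes c s \<tau> :: real
  shows "0 \<le> c \<Longrightarrow> c \<le> 1 \<Longrightarrow> s \<in> {0..\<tau>} \<Longrightarrow> c * s \<in> {0..\<tau>}"
  using mult_left_le_one_le[of s c] by auto

lemma continuous_on_dilation_diff:
  fixes f :: "real \<Rightarrow> 'a::real_normed_vector"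
  assumes f: "continuous_on {0..\<tau>} f" and c: "0 \<le> c" "c \<le> 1"
  shows "continuous_on {0..\<tau>} (dilation_diff c f)"
  unfolding dilation_diff_def using c
  by (intro continuous_intros f continuous_on_compose2[OF f]) (use dilate_mem in blast)+

lemma frac_int_dilation_diff:
  fixes f :: "real \<Rightarrow> 'a::banach"
  assumes \<mu>: "0 < \<mu>" and c: "0 < c" "c \<le> 1" and f: "continuous_on {0..\<tau>} f" and s: "s \<in> {0..\<tau>}"
  shows "frac_int \<mu> (dilation_diff c f) s = c powr (1 - \<mu>) *\<^sub>R frac_int \<mu> f (c * s) - frac_int \<mu> f s"
proof -
  have fs: "continuous_on {0..s} f" using s by (intro continuous_on_subset[OF f]) auto
  have fc: "continuous_on {0..c * s} f"
    using s c dilate_mem[of c s \<tau>] by (intro continuous_on_subset[OF f]) auto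
  have "continuous_on {0..s} (\<lambda>s. f (c * s))"
    using c by (intro continuous_on_compose2[OF fc] continuous_intros) auto
  then show ?thesis
    unfolding dilation_diff_def using \<mu> c s fs
    by (subst frac_int_diff) (auto intro!: continuous_intros simp: frac_int_dilate[OF \<mu> c(1) _ fc])
qed

text \<open>This constant and the next collect the numerical factors in \<open>energy_first_difference\<close>
  and \<open>energy_second_difference\<close>; the argument is the number of fractional derivatives.\<close>

definition first_difference_const :: "nat \<Rightarrow> real" where
  "first_difference_const n = 8 + 4 * real n"

definition second_difference_const :: "nat \<Rightarrow> real" where
  "second_difference_const n = 576 + 32 * real n * first_difference_const n + 8 * real n"

locale multi_term_relaxation =
  fixes A :: "'a::{real_inner, banach} \<Rightarrow> 'a" and I :: "'i set" and \<gamma> b :: "'i \<Rightarrow> real"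
  assumes A: "bounded_linear A"
    and form1: "sum_of_squares_form (\<lambda>u v. inner (A u) v)"
    and form2: "sum_of_squares_form (\<lambda>u v. inner (A u) (A v))"
    and I: "finite I"
    and \<gamma>: "\<And>i. i \<in> I \<Longrightarrow> 0 < \<gamma> i \<and> \<gamma> i < 1"
    and b: "\<And>i. i \<in> I \<Longrightarrow> 0 < b i"
begin

definition memory_term :: "'i \<Rightarrow> (real \<Rightarrow> 'a) \<Rightarrow> real \<Rightarrow> 'a" where
  "memory_term i f t = b i *\<^sub>R A (frac_int (1 - \<gamma> i) f t)"

text \<open>The left-hand side of the error equation integrated once in time, up to the initial value, which
  \<open>A\<close> annihilates in the application.\<close>

definition integrated_lhs :: "(real \<Rightarrow> 'a) \<Rightarrow> real \<Rightarrow> 'a" where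
  "integrated_lhs f t = (\<Sum>i\<in>I. memory_term i f t) + frac_int 1 f t"

definition energy :: "real \<Rightarrow> (real \<Rightarrow> 'a) \<Rightarrow> real" where
  "energy \<tau> v = integral {0..\<tau>} (\<lambda>s. (norm (v s))\<^sup>2)"

lemma memory_term_continuous_on:
  assumes "continuous_on {0..\<tau>} f" "i \<in> I"
  shows "continuous_on {0..\<tau>} (memory_term i f)"
  unfolding memory_term_def using assms \<gamma>[of i]
  by (intro continuous_intros bounded_linear.continuous_on[OF A] frac_int_continuous_on) auto

lemma integrated_lhs_continuous_on:
  assumes "continuous_on {0..\<tau>} f"
  shows "continuous_on {0..\<tau>} (integrated_lhs f)"
  unfolding integrated_lhs_def using assms
  by (intro continuous_intros memory_term_continuous_on frac_int_continuous_on) auto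

text \<open>The cross terms are nonnegative: between two memory terms through the form of \<open>A\<^sup>2\<close>, between a
  memory term and the primitive of \<open>f\<close> through the form of \<open>A\<close>.\<close>

lemma energy_estimate:
  assumes f: "continuous_on {0..\<tau>} f" and \<tau>: "0 \<le> \<tau>"
  shows "(\<Sum>i\<in>I. energy \<tau> (memory_term i f)) + energy \<tau> (frac_int 1 f) \<le> energy \<tau> (integrated_lhs f)"
  unfolding energy_def integrated_lhs_def
proof (rule integral_norm_square_sum_ge)
  fix i l assume il: "i \<in> I" "l \<in> I"
  have "0 \<le> integral {0..\<tau>} (\<lambda>s. inner (A (frac_int (1 - \<gamma> i) f s)) (A (frac_int (1 - \<gamma> l) f s)))"
    using \<gamma>[OF il(1)] \<gamma>[OF il(2)] by (intro integral_form_frac_int_nonneg[OF form2 f \<tau>]) auto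
  then have "0 \<le> b i * (b l * integral {0..\<tau>} (\<lambda>s. inner (A (frac_int (1 - \<gamma> i) f s)) (A (frac_int (1 - \<gamma> l) f s))))"
    using b[OF il(1)] b[OF il(2)] by (intro mult_nonneg_nonneg) auto
  then show "0 \<le> integral {0..\<tau>} (\<lambda>s. inner (memory_term i f s) (memory_term l f s))"
    by (simp add: memory_term_def mult.left_commute)
next
  fix i assume i: "i \<in> I"
  have "0 \<le> integral {0..\<tau>} (\<lambda>s. inner (A (frac_int (1 - \<gamma> i) f s)) (frac_int 1 f s))"
    using \<gamma>[OF i] by (intro integral_form_frac_int_nonneg[OF form1 f \<tau>]) auto
  then have "0 \<le> b i * integral {0..\<tau>} (\<lambda>s. inner (A (frac_int (1 - \<gamma> i) f s)) (frac_int 1 f s))"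
    using b[OF i] by (intro mult_nonneg_nonneg) auto
  then show "0 \<le> integral {0..\<tau>} (\<lambda>s. inner (memory_term i f s) (frac_int 1 f s))"
    by (simp add: memory_term_def)
qed (use I f in \<open>auto intro: memory_term_continuous_on frac_int_continuous_on\<close>)

lemma energy_nonneg: "continuous_on {0..\<tau>} v \<Longrightarrow> 0 \<le> energy \<tau> v"
  unfolding energy_def
  by (intro Henstock_Kurzweil_Integration.integral_nonneg integrable_continuous_real continuous_intros) auto

lemma energy_sum_memory_term_le:
  assumes f: "continuous_on {0..\<tau>} f" and \<tau>: "0 \<le> \<tau>"
  shows "(\<Sum>i\<in>I. energy \<tau> (memory_term i f)) \<le> energy \<tau> (integrated_lhs f)"
  using energy_estimate[OF assms] energy_nonneg[OF frac_int_continuous_on[OF _ f], of 1] by simp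

lemma energy_frac_int_one_le:
  assumes f: "continuous_on {0..\<tau>} f" and \<tau>: "0 \<le> \<tau>"
  shows "energy \<tau> (frac_int 1 f) \<le> energy \<tau> (integrated_lhs f)"
proof -
  have "0 \<le> (\<Sum>i\<in>I. energy \<tau> (memory_term i f))"
    by (intro sum_nonneg energy_nonneg memory_term_continuous_on f)
  then show ?thesis using energy_estimate[OF assms] by simp
qed

lemma energy_le_of_bound:
  assumes v: "continuous_on {0..\<tau>} v" and \<tau>: "0 \<le> \<tau>" and "\<And>s. s \<in> {0..\<tau>} \<Longrightarrow> norm (v s) \<le> B"
  shows "energy \<tau> v \<le> \<tau> * B\<^sup>2"
proof -
  have "energy \<tau> v \<le> integral {0..\<tau>} (\<lambda>_. B\<^sup>2)"
    unfolding energy_def using assms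
    by (intro integral_le integrable_continuous_real continuous_intros v) (auto intro!: power_mono)
  then show ?thesis using \<tau> by simp
qed

lemma energy_dilate_le:
  assumes v: "continuous_on {0..\<tau>} v" and \<tau>: "0 \<le> \<tau>" and c: "1 / 2 \<le> c" "c \<le> 1"
  shows "energy \<tau> (\<lambda>s. v (c * s)) \<le> 2 * energy \<tau> v"
  unfolding energy_def
  by (rule integral_dilate_le[OF c \<tau>, where \<phi> = "\<lambda>s. (norm (v s))\<^sup>2"]) (auto intro!: continuous_intros v)

lemma energy_diff_sum_le:
  assumes K: "finite K" and a: "continuous_on {0..\<tau>} a" and v: "\<And>i. i \<in> K \<Longrightarrow> continuous_on {0..\<tau>} (v i)"
  shows "energy \<tau> (\<lambda>s. a s - (\<Sum>i\<in>K. q i *\<^sub>R v i s))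
    \<le> 2 * energy \<tau> a + 2 * real (card K) * (\<Sum>i\<in>K. (q i)\<^sup>2 * energy \<tau> (v i))"
proof -
  have i1: "(\<lambda>s. 2 * (norm (a s))\<^sup>2) integrable_on {0..\<tau>}"
    and i2: "(\<lambda>s. 2 * real (card K) * (\<Sum>i\<in>K. (q i)\<^sup>2 * (norm (v i s))\<^sup>2)) integrable_on {0..\<tau>}"
    and i3: "(\<lambda>s. (norm (a s - (\<Sum>i\<in>K. q i *\<^sub>R v i s)))\<^sup>2) integrable_on {0..\<tau>}"
    and i4: "\<And>i. i \<in> K \<Longrightarrow> (\<lambda>s. (q i)\<^sup>2 * (norm (v i s))\<^sup>2) integrable_on {0..\<tau>}"
    by (intro integrable_continuous_real continuous_intros a v; assumption)+
  have "energy \<tau> (\<lambda>s. a s - (\<Sum>i\<in>K. q i *\<^sub>R v i s))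
    \<le> integral {0..\<tau>} (\<lambda>s. 2 * (norm (a s))\<^sup>2 + 2 * real (card K) * (\<Sum>i\<in>K. (q i)\<^sup>2 * (norm (v i s))\<^sup>2))"
    unfolding energy_def
  proof (intro integral_le i3 integrable_add i1 i2)
    fix s
    show "(norm (a s - (\<Sum>i\<in>K. q i *\<^sub>R v i s)))\<^sup>2
        \<le> 2 * (norm (a s))\<^sup>2 + 2 * real (card K) * (\<Sum>i\<in>K. (q i)\<^sup>2 * (norm (v i s))\<^sup>2)"
      using norm_diff_sum_square_le[of "a s" "\<lambda>i. q i *\<^sub>R v i s" K] by (simp add: power_mult_distrib)
  qed
  also have "\<dots> = 2 * energy \<tau> a + 2 * real (card K) * integral {0..\<tau>} (\<lambda>s. \<Sum>i\<in>K. (q i)\<^sup>2 * (norm (v i s))\<^sup>2)"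
    by (subst Henstock_Kurzweil_Integration.integral_add[OF i1 i2]) (simp add: energy_def)
  also have "integral {0..\<tau>} (\<lambda>s. \<Sum>i\<in>K. (q i)\<^sup>2 * (norm (v i s))\<^sup>2) = (\<Sum>i\<in>K. (q i)\<^sup>2 * energy \<tau> (v i))"
    by (subst integral_sum[OF K i4]) (simp_all add: energy_def)
  finally show ?thesis .
qed

lemma memory_term_dilation_diff:
  assumes "i \<in> I" "0 < c" "c \<le> 1" "continuous_on {0..\<tau>} f" "s \<in> {0..\<tau>}"
  shows "memory_term i (dilation_diff c f) s = c powr \<gamma> i *\<^sub>R memory_term i f (c * s) - memory_term i f s"
  using frac_int_dilation_diff[OF _ assms(2-5), of "1 - \<gamma> i"] \<gamma>[OF assms(1)]
  by (simp add: memory_term_def linear_simps[OF A] scaleR_right_diff_distrib mult.commute)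

lemma frac_int_one_dilation_diff:
  fixes f :: "real \<Rightarrow> 'a"
  assumes "0 < c" "c \<le> 1" "continuous_on {0..\<tau>} f" "s \<in> {0..\<tau>}"
  shows "frac_int 1 (dilation_diff c f) s = frac_int 1 f (c * s) - frac_int 1 f s"
  using frac_int_dilation_diff[OF _ assms, of 1] assms(1) by simp

lemma integrated_lhs_dilation_diff:
  assumes "0 < c" "c \<le> 1" "continuous_on {0..\<tau>} f" "s \<in> {0..\<tau>}"
  shows "integrated_lhs (dilation_diff c f) s
    = (integrated_lhs f (c * s) - integrated_lhs f s) - (\<Sum>i\<in>I. (1 - c powr \<gamma> i) *\<^sub>R memory_term i f (c * s))"
proof -
  have "(\<Sum>i\<in>I. memory_term i (dilation_diff c f) s)
      = (\<Sum>i\<in>I. memory_term i f (c * s) - (1 - c powr \<gamma> i) *\<^sub>R memory_term i f (c * s) - memory_term i f s)"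
    by (intro sum.cong refl) (simp add: memory_term_dilation_diff[OF _ assms] scaleR_left_diff_distrib)
  then show ?thesis
    unfolding integrated_lhs_def frac_int_one_dilation_diff[OF assms] by (simp add: sum_subtractf)
qed

text \<open>The factors \<open>2 q\<close> and \<open>q\<^sup>2\<close> with \<open>q = 1 - c\<^sup>\<gamma>\<close> come from writing the memory terms of
  \<open>f\<close> at \<open>c s\<close> through those of \<open>dilation_diff c f\<close>, so that each summand is of second order in
  \<open>1 - c\<close>.\<close>

lemma integrated_lhs_dilation_diff_twice:
  assumes "0 < c" "c \<le> 1" "continuous_on {0..\<tau>} f" "s \<in> {0..\<tau>}"
  shows "integrated_lhs (dilation_diff c (dilation_diff c f)) s
    = ((integrated_lhs f (c * (c * s)) - 2 *\<^sub>R integrated_lhs f (c * s) + integrated_lhs f s)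
        - (\<Sum>i\<in>I. (2 * (1 - c powr \<gamma> i)) *\<^sub>R memory_term i (dilation_diff c f) (c * s)))
        - (\<Sum>i\<in>I. (1 - c powr \<gamma> i)\<^sup>2 *\<^sub>R memory_term i f (c * (c * s)))"
proof -
  have cs: "c * s \<in> {0..\<tau>}" using assms by (intro dilate_mem) auto
  have D: "continuous_on {0..\<tau>} (dilation_diff c f)" using assms by (intro continuous_on_dilation_diff) auto
  let ?q = "\<lambda>i. 1 - c powr \<gamma> i"
  have dbl: "(2 * x) *\<^sub>R v = x *\<^sub>R v + x *\<^sub>R v" for x and v :: 'a
    by (simp add: scaleR_left_distrib[symmetric])
  have m: "?q i *\<^sub>R memory_term i f (c * (c * s)) - ?q i *\<^sub>R memory_term i f (c * s)
      = ?q i *\<^sub>R memory_term i (dilation_diff c f) (c * s) + (?q i)\<^sup>2 *\<^sub>R memory_term i f (c * (c * s))"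
    if "i \<in> I" for i
    unfolding memory_term_dilation_diff[OF that assms(1-3) cs]
    by (simp add: algebra_simps power2_eq_square dbl)
  have S: "(\<Sum>i\<in>I. ?q i *\<^sub>R memory_term i f (c * (c * s))) - (\<Sum>i\<in>I. ?q i *\<^sub>R memory_term i f (c * s))
      = (\<Sum>i\<in>I. ?q i *\<^sub>R memory_term i (dilation_diff c f) (c * s)) + (\<Sum>i\<in>I. (?q i)\<^sup>2 *\<^sub>R memory_term i f (c * (c * s)))"
    unfolding sum_subtractf[symmetric] sum.distrib[symmetric] by (rule sum.cong[OF refl m])
  have S2: "(\<Sum>i\<in>I. (2 * ?q i) *\<^sub>R memory_term i (dilation_diff c f) (c * s))
      = (\<Sum>i\<in>I. ?q i *\<^sub>R memory_term i (dilation_diff c f) (c * s)) + (\<Sum>i\<in>I. ?q i *\<^sub>R memory_term i (dilation_diff c f) (c * s))"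
    unfolding sum.distrib[symmetric] by (intro sum.cong refl) (simp add: scaleR_left_distrib[symmetric])
  show ?thesis
    unfolding integrated_lhs_dilation_diff[OF assms(1,2) D assms(4)]
      integrated_lhs_dilation_diff[OF assms(1-3) cs] integrated_lhs_dilation_diff[OF assms] S2
    using S by (simp add: algebra_simps scaleR_2)
qed

lemma one_minus_powr_bounds:
  assumes "i \<in> I" "0 < c" "c \<le> 1"
  shows "0 \<le> 1 - c powr \<gamma> i" "1 - c powr \<gamma> i \<le> 1 - c"
proof -
  show "0 \<le> 1 - c powr \<gamma> i" using assms \<gamma>[OF assms(1)] by (simp add: powr_le1)
  have "c powr 1 \<le> c powr \<gamma> i" using assms \<gamma>[OF assms(1)] by (intro powr_mono') auto
  then show "1 - c powr \<gamma> i \<le> 1 - c" using assms by simp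
qed

lemma energy_cong: "(\<And>s. s \<in> {0..\<tau>} \<Longrightarrow> v s = w s) \<Longrightarrow> energy \<tau> v = energy \<tau> w"
  unfolding energy_def by (intro integral_cong) auto

lemma weighted_energy_sum_le:
  assumes f: "continuous_on {0..\<tau>} f" and \<tau>: "0 \<le> \<tau>" and c: "1 / 2 \<le> c" "c \<le> 1"
    and q: "\<And>i. i \<in> I \<Longrightarrow> 0 \<le> q i \<and> q i \<le> Q"
    and w: "\<And>i. i \<in> I \<Longrightarrow> energy \<tau> (w i) \<le> k * energy \<tau> (memory_term i f)" and k: "0 \<le> k"
  shows "(\<Sum>i\<in>I. (q i)\<^sup>2 * energy \<tau> (w i)) \<le> k * Q\<^sup>2 * energy \<tau> (integrated_lhs f)"
proof -
  have "(\<Sum>i\<in>I. (q i)\<^sup>2 * energy \<tau> (w i)) \<le> (\<Sum>i\<in>I. Q\<^sup>2 * (k * energy \<tau> (memory_term i f)))"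
  proof (rule sum_mono)
    fix i assume i: "i \<in> I"
    have "(q i)\<^sup>2 * energy \<tau> (w i) \<le> (q i)\<^sup>2 * (k * energy \<tau> (memory_term i f))"
      by (intro mult_left_mono w i) auto
    also have "\<dots> \<le> Q\<^sup>2 * (k * energy \<tau> (memory_term i f))"
      using q[OF i] k by (intro mult_right_mono power_mono mult_nonneg_nonneg energy_nonneg memory_term_continuous_on f i) auto
    finally show "(q i)\<^sup>2 * energy \<tau> (w i) \<le> Q\<^sup>2 * (k * energy \<tau> (memory_term i f))" .
  qed
  also have "\<dots> = k * Q\<^sup>2 * (\<Sum>i\<in>I. energy \<tau> (memory_term i f))"
    by (simp add: sum_distrib_left mult_ac)
  also have "\<dots> \<le> k * Q\<^sup>2 * energy \<tau> (integrated_lhs f)"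
    using k by (intro mult_left_mono energy_sum_memory_term_le f \<tau>) auto
  finally show ?thesis .
qed

context
  fixes \<tau> M c :: real and f :: "real \<Rightarrow> 'a"
  assumes \<tau>: "0 < \<tau>" and f: "continuous_on {0..\<tau>} f" and M: "0 \<le> M" and c: "1 / 2 \<le> c" "c < 1"
    and r0: "\<And>s. s \<in> {0..\<tau>} \<Longrightarrow> norm (integrated_lhs f s) \<le> M"
    and r1: "\<And>s. s \<in> {0..\<tau>} \<Longrightarrow> norm (integrated_lhs f (c * s) - integrated_lhs f s) \<le> 2 * (1 - c) * M"
    and r2: "\<And>s. s \<in> {0..\<tau>} \<Longrightarrow>
      norm (integrated_lhs f (c * (c * s)) - 2 *\<^sub>R integrated_lhs f (c * s) + integrated_lhs f s) \<le> 12 * (1 - c)\<^sup>2 * M"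
begin

lemma cpos: "0 < c" "c \<le> 1" using c by auto

lemma dilate_mem': "s \<in> {0..\<tau>} \<Longrightarrow> c * s \<in> {0..\<tau>}"
  using cpos by (intro dilate_mem) auto

lemma dilate_cont: "continuous_on {0..\<tau>} v \<Longrightarrow> continuous_on {0..\<tau>} (\<lambda>s. v (c * s))"
  for v :: "real \<Rightarrow> 'b::topological_space"
  by (rule continuous_on_compose2[of "{0..\<tau>}" v]) (use dilate_mem' in \<open>auto intro!: continuous_intros\<close>)

lemma D_cont: "continuous_on {0..\<tau>} (dilation_diff c f)"
  using cpos by (intro continuous_on_dilation_diff f) auto

lemma energy_memory_term_dilate_le:
  assumes "continuous_on {0..\<tau>} g" "i \<in> I"
  shows "energy \<tau> (\<lambda>s. memory_term i g (c * s)) \<le> 2 * energy \<tau> (memory_term i g)"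
  using energy_dilate_le[OF memory_term_continuous_on[OF assms] _ c(1) cpos(2)] \<tau> by simp

lemma energy_integrated_lhs_le: "energy \<tau> (integrated_lhs f) \<le> \<tau> * M\<^sup>2"
  using \<tau> r0 by (intro energy_le_of_bound integrated_lhs_continuous_on f) auto

lemma energy_first_difference: "energy \<tau> (integrated_lhs (dilation_diff c f)) \<le> first_difference_const (card I) * (1 - c)\<^sup>2 * (\<tau> * M\<^sup>2)"
proof -
  have "energy \<tau> (integrated_lhs (dilation_diff c f)) = energy \<tau> (\<lambda>s. (integrated_lhs f (c * s) - integrated_lhs f s)
      - (\<Sum>i\<in>I. (1 - c powr \<gamma> i) *\<^sub>R memory_term i f (c * s)))"
    by (rule energy_cong) (rule integrated_lhs_dilation_diff[OF cpos f])
  also have "\<dots> \<le> 2 * energy \<tau> (\<lambda>s. integrated_lhs f (c * s) - integrated_lhs f s)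
      + 2 * real (card I) * (\<Sum>i\<in>I. (1 - c powr \<gamma> i)\<^sup>2 * energy \<tau> (\<lambda>s. memory_term i f (c * s)))"
    by (intro energy_diff_sum_le I continuous_intros dilate_cont integrated_lhs_continuous_on memory_term_continuous_on f)
  also have "\<dots> \<le> 2 * (\<tau> * (2 * (1 - c) * M)\<^sup>2) + 2 * real (card I) * (2 * (1 - c)\<^sup>2 * energy \<tau> (integrated_lhs f))"
  proof (intro add_mono mult_left_mono)
    show "energy \<tau> (\<lambda>s. integrated_lhs f (c * s) - integrated_lhs f s) \<le> \<tau> * (2 * (1 - c) * M)\<^sup>2"
      using \<tau> r1 by (intro energy_le_of_bound continuous_intros dilate_cont integrated_lhs_continuous_on f) auto
    show "(\<Sum>i\<in>I. (1 - c powr \<gamma> i)\<^sup>2 * energy \<tau> (\<lambda>s. memory_term i f (c * s)))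
        \<le> 2 * (1 - c)\<^sup>2 * energy \<tau> (integrated_lhs f)"
      using \<tau> one_minus_powr_bounds[OF _ cpos]
      by (intro weighted_energy_sum_le[OF f _ c(1) cpos(2)] energy_memory_term_dilate_le f) auto
  qed auto
  also have "\<dots> \<le> 2 * (\<tau> * (2 * (1 - c) * M)\<^sup>2) + 2 * real (card I) * (2 * (1 - c)\<^sup>2 * (\<tau> * M\<^sup>2))"
    by (intro add_mono mult_left_mono energy_integrated_lhs_le order_refl) auto
  also have "\<dots> = first_difference_const (card I) * (1 - c)\<^sup>2 * (\<tau> * M\<^sup>2)"
  proof -
    define d where "d = 1 - c"
    show ?thesis unfolding first_difference_const_def d_def[symmetric] by (simp add: power_mult_distrib algebra_simps)
  qed
  finally show ?thesis .
qed

lemma energy_second_difference: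
  "energy \<tau> (integrated_lhs (dilation_diff c (dilation_diff c f))) \<le> second_difference_const (card I) * (1 - c) ^ 4 * (\<tau> * M\<^sup>2)"
proof -
  let ?N = "real (card I)" and ?D = "dilation_diff c f"
  let ?q = "\<lambda>i. 1 - c powr \<gamma> i"
  define a where "a s = integrated_lhs f (c * (c * s)) - 2 *\<^sub>R integrated_lhs f (c * s) + integrated_lhs f s" for s
  have ac: "continuous_on {0..\<tau>} a"
    unfolding a_def by (intro continuous_intros dilate_cont integrated_lhs_continuous_on f)
  have "energy \<tau> (integrated_lhs (dilation_diff c ?D)) = energy \<tau> (\<lambda>s.
      (a s - (\<Sum>i\<in>I. (2 * ?q i) *\<^sub>R memory_term i ?D (c * s))) - (\<Sum>i\<in>I. (?q i)\<^sup>2 *\<^sub>R memory_term i f (c * (c * s))))"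
    unfolding a_def by (rule energy_cong) (rule integrated_lhs_dilation_diff_twice[OF cpos f])
  also have "\<dots> \<le> 2 * energy \<tau> (\<lambda>s. a s - (\<Sum>i\<in>I. (2 * ?q i) *\<^sub>R memory_term i ?D (c * s)))
      + 2 * ?N * (\<Sum>i\<in>I. ((?q i)\<^sup>2)\<^sup>2 * energy \<tau> (\<lambda>s. memory_term i f (c * (c * s))))"
    by (intro energy_diff_sum_le I continuous_intros dilate_cont memory_term_continuous_on f D_cont ac)
  also have "\<dots> \<le> 2 * (2 * energy \<tau> a + 2 * ?N * (\<Sum>i\<in>I. (2 * ?q i)\<^sup>2 * energy \<tau> (\<lambda>s. memory_term i ?D (c * s))))
      + 2 * ?N * (\<Sum>i\<in>I. ((?q i)\<^sup>2)\<^sup>2 * energy \<tau> (\<lambda>s. memory_term i f (c * (c * s))))"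
    by (intro add_mono mult_left_mono energy_diff_sum_le I continuous_intros dilate_cont
        memory_term_continuous_on f D_cont ac) auto
  also have "\<dots> \<le> 2 * (2 * (\<tau> * (12 * (1 - c)\<^sup>2 * M)\<^sup>2) + 2 * ?N * (2 * (2 * (1 - c))\<^sup>2 * energy \<tau> (integrated_lhs ?D)))
      + 2 * ?N * (4 * ((1 - c)\<^sup>2)\<^sup>2 * energy \<tau> (integrated_lhs f))"
  proof (intro add_mono mult_left_mono)
    show "energy \<tau> a \<le> \<tau> * (12 * (1 - c)\<^sup>2 * M)\<^sup>2"
      using \<tau> r2 by (intro energy_le_of_bound ac) (auto simp: a_def)
    show "(\<Sum>i\<in>I. (2 * ?q i)\<^sup>2 * energy \<tau> (\<lambda>s. memory_term i ?D (c * s)))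
        \<le> 2 * (2 * (1 - c))\<^sup>2 * energy \<tau> (integrated_lhs ?D)"
      using \<tau> one_minus_powr_bounds[OF _ cpos]
      by (intro weighted_energy_sum_le[OF D_cont _ c(1) cpos(2)] energy_memory_term_dilate_le D_cont) auto
    show "(\<Sum>i\<in>I. ((?q i)\<^sup>2)\<^sup>2 * energy \<tau> (\<lambda>s. memory_term i f (c * (c * s))))
        \<le> 4 * ((1 - c)\<^sup>2)\<^sup>2 * energy \<tau> (integrated_lhs f)"
    proof (rule weighted_energy_sum_le[OF f _ c(1) cpos(2)])
      fix i assume i: "i \<in> I"
      have cont: "continuous_on {0..\<tau>} (memory_term i f)" by (intro memory_term_continuous_on f i)
      have "energy \<tau> (\<lambda>s. memory_term i f (c * (c * s))) \<le> 2 * energy \<tau> (\<lambda>s. memory_term i f (c * s))"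
        using energy_dilate_le[OF dilate_cont[OF cont] _ c(1) cpos(2)] \<tau> by simp
      also have "\<dots> \<le> 2 * (2 * energy \<tau> (memory_term i f))"
        by (intro mult_left_mono energy_memory_term_dilate_le f i) auto
      finally show "energy \<tau> (\<lambda>s. memory_term i f (c * (c * s))) \<le> 4 * energy \<tau> (memory_term i f)" by simp
      show "0 \<le> (?q i)\<^sup>2 \<and> (?q i)\<^sup>2 \<le> (1 - c)\<^sup>2"
        using one_minus_powr_bounds[OF i cpos] by (auto intro!: power_mono)
    qed (use \<tau> in auto)
  qed auto
  also have "\<dots> \<le> 2 * (2 * (\<tau> * (12 * (1 - c)\<^sup>2 * M)\<^sup>2)
        + 2 * ?N * (2 * (2 * (1 - c))\<^sup>2 * (first_difference_const (card I) * (1 - c)\<^sup>2 * (\<tau> * M\<^sup>2))))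
      + 2 * ?N * (4 * ((1 - c)\<^sup>2)\<^sup>2 * (\<tau> * M\<^sup>2))"
    by (intro add_mono mult_left_mono energy_integrated_lhs_le energy_first_difference order_refl) auto
  also have "\<dots> = second_difference_const (card I) * (1 - c) ^ 4 * (\<tau> * M\<^sup>2)"
  proof -
    define d where "d = 1 - c"
    show ?thesis unfolding second_difference_const_def d_def[symmetric]
      by (simp add: power_mult_distrib algebra_simps power2_eq_square power4_eq_xxxx)
  qed
  finally show ?thesis .
qed

text \<open>Write \<open>\<phi>\<close> for the first and \<open>\<psi>\<close> for the second difference, so that \<open>\<psi> = \<phi>(c \<cdot>) - \<phi>\<close>.  The
  integral over \<open>[c\<tau>,\<tau>]\<close> is the difference of \<open>\<integral>\<^sub>0\<^sup>\<tau> \<parallel>\<phi>\<parallel>\<^sup>2\<close> and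
  \<open>c \<integral>\<^sub>0\<^sup>\<tau> \<parallel>\<phi>(c s)\<parallel>\<^sup>2 ds\<close>; expanding \<open>\<parallel>\<phi> + \<psi>\<parallel>\<^sup>2\<close> and weighting the mixed term by
  \<open>1 - c\<close> leaves three powers of \<open>1 - c\<close>.\<close>

lemma energy_near_end:
  "integral {c * \<tau>..\<tau>} (\<lambda>s. (norm (frac_int 1 (dilation_diff c f) s))\<^sup>2)
    \<le> (3 * first_difference_const (card I) + second_difference_const (card I)) * (1 - c) ^ 3 * (\<tau> * M\<^sup>2)"
proof -
  define \<phi> where "\<phi> = frac_int 1 (dilation_diff c f)"
  define \<psi> where "\<psi> = frac_int 1 (dilation_diff c (dilation_diff c f))"
  define d where "d = 1 - c"
  have d: "0 < d" using c by (simp add: d_def)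
  have \<phi>c: "continuous_on {0..\<tau>} \<phi>" unfolding \<phi>_def by (intro frac_int_continuous_on D_cont) simp
  have \<psi>c: "continuous_on {0..\<tau>} \<psi>"
    unfolding \<psi>_def using cpos by (intro frac_int_continuous_on continuous_on_dilation_diff D_cont) auto
  have \<psi>: "\<psi> s = \<phi> (c * s) - \<phi> s" if "s \<in> {0..\<tau>}" for s
    unfolding \<psi>_def \<phi>_def by (rule frac_int_one_dilation_diff[OF cpos D_cont that])
  have Q1: "energy \<tau> \<phi> \<le> first_difference_const (card I) * d\<^sup>2 * (\<tau> * M\<^sup>2)"
    using energy_frac_int_one_le[OF D_cont] energy_first_difference \<tau> by (simp add: \<phi>_def d_def)
  have Q2: "energy \<tau> \<psi> \<le> second_difference_const (card I) * d ^ 4 * (\<tau> * M\<^sup>2)"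
    using energy_frac_int_one_le[OF continuous_on_dilation_diff[OF D_cont less_imp_le[OF cpos(1)] cpos(2)]]
      energy_second_difference \<tau> by (simp add: \<psi>_def d_def)
  have le: "c * \<tau> \<le> \<tau>" "0 \<le> c * \<tau>" using cpos \<tau> by (auto intro: mult_left_le_one_le)
  have "integral {0..c * \<tau>} (\<lambda>s. (norm (\<phi> s))\<^sup>2) + integral {c * \<tau>..\<tau>} (\<lambda>s. (norm (\<phi> s))\<^sup>2) = energy \<tau> \<phi>"
    unfolding energy_def using le
    by (intro Henstock_Kurzweil_Integration.integral_combine integrable_continuous_real continuous_intros \<phi>c) auto
  moreover have "integral {0..c * \<tau>} (\<lambda>s. (norm (\<phi> s))\<^sup>2) = c * energy \<tau> (\<lambda>s. \<phi> (c * s))"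
    unfolding energy_def using cpos le
    by (intro integral_dilate[symmetric, where \<phi> = "\<lambda>s. (norm (\<phi> s))\<^sup>2"])
       (auto intro!: continuous_intros continuous_on_subset[OF \<phi>c])
  ultimately have 1: "integral {c * \<tau>..\<tau>} (\<lambda>s. (norm (\<phi> s))\<^sup>2) = energy \<tau> \<phi> - c * energy \<tau> (\<lambda>s. \<phi> (c * s))"
    by linarith
  have "energy \<tau> \<phi> \<le> integral {0..\<tau>} (\<lambda>s. (norm (\<phi> (c * s)))\<^sup>2 + (d * (norm (\<phi> s))\<^sup>2 + (norm (\<psi> s))\<^sup>2 / d))"
    unfolding energy_def
  proof (intro integral_le integrable_continuous_real continuous_intros dilate_cont \<phi>c \<psi>c)
    fix s assume s: "s \<in> {0..\<tau>}"
    have "(norm (\<phi> (c * s)))\<^sup>2 = (norm (\<phi> s))\<^sup>2 + (norm (\<psi> s))\<^sup>2 + 2 * inner (\<phi> s) (\<psi> s)"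
      using dot_norm[of "\<phi> s" "\<psi> s"] \<psi>[OF s] by simp
    moreover have "- (norm (\<phi> s) * norm (\<psi> s)) \<le> inner (\<phi> s) (\<psi> s)"
      using Cauchy_Schwarz_ineq2[of "\<phi> s" "\<psi> s"] by linarith
    moreover have "2 * (norm (\<phi> s) * norm (\<psi> s)) \<le> d * (norm (\<phi> s))\<^sup>2 + (norm (\<psi> s))\<^sup>2 / d"
    proof -
      have "0 \<le> (d * norm (\<phi> s) - norm (\<psi> s))\<^sup>2 / d" using d by simp
      also have "\<dots> = d * (norm (\<phi> s))\<^sup>2 + (norm (\<psi> s))\<^sup>2 / d - 2 * (norm (\<phi> s) * norm (\<psi> s))"
        using d by (simp add: field_simps power2_eq_square)
      finally show ?thesis by simp
    qed
    moreover have "0 \<le> (norm (\<psi> s))\<^sup>2" by simp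
    ultimately show "(norm (\<phi> s))\<^sup>2 \<le> (norm (\<phi> (c * s)))\<^sup>2 + (d * (norm (\<phi> s))\<^sup>2 + (norm (\<psi> s))\<^sup>2 / d)"
      by linarith
  qed (use d in auto)
  also have "\<dots> = energy \<tau> (\<lambda>s. \<phi> (c * s)) + (d * energy \<tau> \<phi> + energy \<tau> \<psi> / d)"
  proof -
    have i: "(\<lambda>s. (norm (\<phi> (c * s)))\<^sup>2) integrable_on {0..\<tau>}"
      "(\<lambda>s. d * (norm (\<phi> s))\<^sup>2) integrable_on {0..\<tau>}" "(\<lambda>s. (norm (\<psi> s))\<^sup>2 / d) integrable_on {0..\<tau>}"
      using d by (intro integrable_continuous_real continuous_intros dilate_cont \<phi>c \<psi>c; simp)+
    show ?thesis
      by (subst Henstock_Kurzweil_Integration.integral_add[OF i(1) integrable_add[OF i(2,3)]],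
          subst Henstock_Kurzweil_Integration.integral_add[OF i(2,3)]) (simp add: energy_def)
  qed
  finally have "integral {c * \<tau>..\<tau>} (\<lambda>s. (norm (\<phi> s))\<^sup>2)
      \<le> d * energy \<tau> (\<lambda>s. \<phi> (c * s)) + (d * energy \<tau> \<phi> + energy \<tau> \<psi> / d)"
    using 1 by (simp add: d_def algebra_simps)
  also have "\<dots> \<le> d * (2 * energy \<tau> \<phi>) + (d * energy \<tau> \<phi> + energy \<tau> \<psi> / d)"
    using d \<tau> by (intro add_mono mult_left_mono energy_dilate_le[OF \<phi>c _ c(1) cpos(2)] order_refl) auto
  also have "\<dots> = 3 * d * energy \<tau> \<phi> + energy \<tau> \<psi> / d" by simp
  also have "\<dots> \<le> 3 * d * (first_difference_const (card I) * d\<^sup>2 * (\<tau> * M\<^sup>2)) + second_difference_const (card I) * d ^ 4 * (\<tau> * M\<^sup>2) / d"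
    using d by (intro add_mono mult_left_mono divide_right_mono Q1 Q2) auto
  also have "\<dots> = (3 * first_difference_const (card I) + second_difference_const (card I)) * d ^ 3 * (\<tau> * M\<^sup>2)"
  proof -
    have "d ^ 4 / d = d ^ 3" "d * d\<^sup>2 = d ^ 3" using d by (simp_all add: power4_eq_xxxx power3_eq_cube power2_eq_square)
    moreover have "second_difference_const (card I) * d ^ 4 * (\<tau> * M\<^sup>2) / d = second_difference_const (card I) * (d ^ 4 / d) * (\<tau> * M\<^sup>2)"
      "3 * d * (first_difference_const (card I) * d\<^sup>2 * (\<tau> * M\<^sup>2)) = 3 * first_difference_const (card I) * (d * d\<^sup>2) * (\<tau> * M\<^sup>2)" by simp_all
    ultimately show ?thesis by (simp add: distrib_right)
  qed
  finally show ?thesis by (simp add: \<phi>_def d_def)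
qed

text \<open>On \<open>[c\<tau>,\<tau>]\<close> the first difference is \<open>-\<integral> f\<close> over \<open>[c s,s]\<close>, hence of size at least
  \<open>(1 - c) s (\<parallel>f(\<tau>)\<parallel> - \<epsilon>)\<close>.  Its square integral over this interval therefore also carries three
  powers of \<open>1 - c\<close>, and they cancel.\<close>

lemma pointwise_bound_near_end:
  assumes \<epsilon>: "\<And>x. x \<in> {c * (c * \<tau>)..\<tau>} \<Longrightarrow> norm (f x - f \<tau>) \<le> \<epsilon>" and E: "0 \<le> norm (f \<tau>) - \<epsilon>"
  shows "\<tau> * (norm (f \<tau>) - \<epsilon>) \<le> 2 * sqrt (3 * first_difference_const (card I) + second_difference_const (card I)) * M"
proof -
  define E where "E = norm (f \<tau>) - \<epsilon>"
  define d where "d = 1 - c"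
  have d: "0 < d" using c by (simp add: d_def)
  have E0: "0 \<le> E" using E by (simp add: E_def)
  define \<phi> where "\<phi> = frac_int 1 (dilation_diff c f)"
  have \<phi>c: "continuous_on {0..\<tau>} \<phi>" unfolding \<phi>_def by (intro frac_int_continuous_on D_cont) simp
  have le: "c * \<tau> \<le> \<tau>" "0 \<le> c * \<tau>" using cpos \<tau> by (auto intro: mult_left_le_one_le)
  have low: "d * (c * \<tau>) * E \<le> norm (\<phi> s)" if s: "s \<in> {c * \<tau>..\<tau>}" for s
  proof -
    have s0: "s \<in> {0..\<tau>}" "0 \<le> s" using s le by auto
    have cs: "c * s \<le> s" "0 \<le> c * s" using s0 cpos by (auto intro: mult_left_le_one_le)
    have fs: "continuous_on {0..s} f" "continuous_on {c * s..s} f"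
      using s0 cs by (auto intro!: continuous_on_subset[OF f])
    have comb: "integral {0..c * s} f + integral {c * s..s} f = integral {0..s} f"
      using cs by (intro Henstock_Kurzweil_Integration.integral_combine integrable_continuous_real fs) auto
    have "\<phi> s = frac_int 1 f (c * s) - frac_int 1 f s"
      unfolding \<phi>_def by (rule frac_int_one_dilation_diff[OF cpos f s0(1)])
    then have "\<phi> s = - integral {c * s..s} f" by (simp add: frac_int_one comb[symmetric])
    then have \<phi>s: "norm (\<phi> s) = norm (integral {c * s..s} f)" by simp
    have "norm (integral {c * s..s} (\<lambda>x. f x - f \<tau>)) \<le> \<epsilon> * (s - c * s)"
    proof (rule integral_bound)
      fix x assume x: "x \<in> {c * s..s}"
      have "c * (c * \<tau>) \<le> c * s" using s cpos by (intro mult_left_mono) auto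
      then show "norm (f x - f \<tau>) \<le> \<epsilon>" using x s by (intro \<epsilon>) auto
    qed (use cs in \<open>auto intro!: continuous_intros fs\<close>)
    moreover have "integral {c * s..s} (\<lambda>x. f x - f \<tau>) = integral {c * s..s} f - (s - c * s) *\<^sub>R f \<tau>"
      using cs fs by (subst Henstock_Kurzweil_Integration.integral_diff) (auto intro!: integrable_continuous_real)
    moreover have "norm ((s - c * s) *\<^sub>R f \<tau>) \<le> norm (integral {c * s..s} f)
        + norm (integral {c * s..s} f - (s - c * s) *\<^sub>R f \<tau>)"
      using norm_triangle_ineq4[of "integral {c * s..s} f" "integral {c * s..s} f - (s - c * s) *\<^sub>R f \<tau>"] by simp
    moreover have "norm ((s - c * s) *\<^sub>R f \<tau>) = (s - c * s) * norm (f \<tau>)" using cs by simp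
    ultimately have "(s - c * s) * E \<le> norm (\<phi> s)"
      unfolding \<phi>s E_def by (simp add: algebra_simps)
    moreover have "d * (c * \<tau>) * E \<le> (s - c * s) * E"
    proof (rule mult_right_mono[OF _ E0])
      have "d * (c * \<tau>) \<le> d * s" using s d by (intro mult_left_mono) auto
      also have "d * s = s - c * s" by (simp add: d_def algebra_simps)
      finally show "d * (c * \<tau>) \<le> s - c * s" .
    qed
    ultimately show ?thesis by linarith
  qed
  have "d * \<tau> * (d * (c * \<tau>) * E)\<^sup>2 = integral {c * \<tau>..\<tau>} (\<lambda>_. (d * (c * \<tau>) * E)\<^sup>2)"
    using le by (simp add: d_def algebra_simps)
  also have "\<dots> \<le> integral {c * \<tau>..\<tau>} (\<lambda>s. (norm (\<phi> s))\<^sup>2)"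
    using low d le E0 by (intro integral_le integrable_continuous_real continuous_intros continuous_on_subset[OF \<phi>c])
      (auto intro!: power_mono)
  also have "\<dots> \<le> (3 * first_difference_const (card I) + second_difference_const (card I)) * d ^ 3 * (\<tau> * M\<^sup>2)"
    using energy_near_end by (simp add: \<phi>_def d_def)
  finally have "(d ^ 3 * \<tau>) * (c * \<tau> * E)\<^sup>2 \<le> (d ^ 3 * \<tau>) * ((3 * first_difference_const (card I) + second_difference_const (card I)) * M\<^sup>2)"
    by (simp add: power_mult_distrib power2_eq_square power3_eq_cube mult_ac)
  then have "(c * \<tau> * E)\<^sup>2 \<le> (3 * first_difference_const (card I) + second_difference_const (card I)) * M\<^sup>2"
    using d \<tau> by (simp add: mult_le_cancel_left_pos)
  then have "c * \<tau> * E \<le> sqrt ((3 * first_difference_const (card I) + second_difference_const (card I)) * M\<^sup>2)"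
    by (rule real_le_rsqrt)
  also have "\<dots> = sqrt (3 * first_difference_const (card I) + second_difference_const (card I)) * M" using M by (simp add: real_sqrt_mult)
  finally have "c * (\<tau> * E) \<le> sqrt (3 * first_difference_const (card I) + second_difference_const (card I)) * M" by (simp add: mult_ac)
  moreover have "1 / 2 * (\<tau> * E) \<le> c * (\<tau> * E)" using c \<tau> E0 by (intro mult_right_mono) auto
  ultimately show ?thesis by (simp add: E_def)
qed

end

text \<open>A value of \<open>c\<close> close to one, chosen by the continuity of \<open>f\<close> at \<open>\<tau>\<close>, makes \<open>\<epsilon>\<close>
  arbitrarily small while the constant stays the same.\<close>

theorem pointwise_bound:
  assumes \<tau>: "0 < \<tau>" and f: "continuous_on {0..\<tau>} f" and M: "0 \<le> M"
    and r0: "\<And>s. s \<in> {0..\<tau>} \<Longrightarrow> norm (integrated_lhs f s) \<le> M"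
    and r1: "\<And>c s. 1 / 2 \<le> c \<Longrightarrow> c < 1 \<Longrightarrow> s \<in> {0..\<tau>} \<Longrightarrow>
      norm (integrated_lhs f (c * s) - integrated_lhs f s) \<le> 2 * (1 - c) * M"
    and r2: "\<And>c s. 1 / 2 \<le> c \<Longrightarrow> c < 1 \<Longrightarrow> s \<in> {0..\<tau>} \<Longrightarrow>
      norm (integrated_lhs f (c * (c * s)) - 2 *\<^sub>R integrated_lhs f (c * s) + integrated_lhs f s) \<le> 12 * (1 - c)\<^sup>2 * M"
  shows "\<tau> * norm (f \<tau>) \<le> 2 * sqrt (3 * first_difference_const (card I) + second_difference_const (card I)) * M"
proof (rule field_le_epsilon)
  fix \<delta> :: real assume \<delta>: "0 < \<delta>"
  define \<epsilon> where "\<epsilon> = \<delta> / \<tau>"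
  have \<epsilon>: "0 < \<epsilon>" using \<delta> \<tau> by (simp add: \<epsilon>_def)
  have K: "0 \<le> 2 * sqrt (3 * first_difference_const (card I) + second_difference_const (card I)) * M" using M by (simp add: first_difference_const_def second_difference_const_def)
  show "\<tau> * norm (f \<tau>) \<le> 2 * sqrt (3 * first_difference_const (card I) + second_difference_const (card I)) * M + \<delta>"
  proof (cases "norm (f \<tau>) < \<epsilon>")
    case True
    then have "\<tau> * norm (f \<tau>) \<le> \<delta>" using \<tau> by (simp add: \<epsilon>_def field_simps)
    then show ?thesis using K by linarith
  next
    case False
    obtain \<eta> where \<eta>: "\<eta> > 0" and f\<eta>: "\<And>x. x \<in> {0..\<tau>} \<Longrightarrow> dist x \<tau> < \<eta> \<Longrightarrow> dist (f x) (f \<tau>) < \<epsilon>"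
      using f[unfolded continuous_on_iff, rule_format, of \<tau> \<epsilon>] \<epsilon> \<tau> by auto
    \<comment> \<open>With this choice \<open>c\<^sup>2 \<tau>\<close> lies within \<open>2 x \<tau> < \<eta>\<close> of \<open>\<tau>\<close>.\<close>
    define x where "x = min (1 / 2) (\<eta> / (4 * \<tau>))"
    define c where "c = 1 - x"
    have x: "0 < x" "x \<le> 1 / 2" "x \<le> \<eta> / (4 * \<tau>)" using \<eta> \<tau> by (auto simp: x_def)
    have c: "1 / 2 \<le> c" "c < 1" using x by (auto simp: c_def)
    have x2: "2 * x * \<tau> < \<eta>" using x(3) \<tau> \<eta> by (simp add: field_simps)
    have cc: "c * (c * \<tau>) = \<tau> - 2 * x * \<tau> + x * x * \<tau>" by (simp add: c_def algebra_simps)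
    have nn: "0 \<le> x * x * \<tau>" "0 \<le> c * (c * \<tau>)" using x \<tau> c by auto
    have "norm (f y - f \<tau>) \<le> \<epsilon>" if y: "y \<in> {c * (c * \<tau>)..\<tau>}" for y
    proof -
      have "c * (c * \<tau>) \<le> y" "y \<le> \<tau>" using y by auto
      then have "y \<in> {0..\<tau>}" "\<tau> - y < \<eta>" using x2 cc nn unfolding atLeastAtMost_iff by linarith+
      then have "dist (f y) (f \<tau>) < \<epsilon>" using y by (intro f\<eta>) (simp_all add: dist_real_def)
      then show ?thesis by (simp add: dist_norm)
    qed
    then have "\<tau> * (norm (f \<tau>) - \<epsilon>) \<le> 2 * sqrt (3 * first_difference_const (card I) + second_difference_const (card I)) * M"
      using False by (intro pointwise_bound_near_end[OF \<tau> f M c r0 r1[OF c] r2[OF c]]) auto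
    then show ?thesis using \<tau> by (simp add: \<epsilon>_def algebra_simps)
  qed
qed

end

section \<open>The error equation\<close>

text \<open>For \<open>p = c s\<close> the differences are \<open>-\<integral> \<rho>\<close> over \<open>[p,s]\<close> and \<open>\<integral> (\<rho>(x) - c \<rho>(c x)) dx\<close>
  over \<open>[p,s]\<close>.  The bound on \<open>s \<parallel>\<rho>(s)\<parallel>\<close> handles the first; the second needs the bound on
  \<open>s\<^sup>2 \<parallel>\<rho>\<^sub>t(s)\<parallel>\<close> as well, through the mean value inequality on \<open>[c x,x]\<close>.  The numerical
  constants come from \<open>c \<ge> 1/2\<close>.\<close>

lemma integral_difference_bounds:
  fixes \<rho> \<rho>\<^sub>t :: "real \<Rightarrow> 'a::banach"
  assumes int: "\<rho> integrable_on {0..\<tau>}" and ac: "locally_absolutely_continuous_on {0<..\<tau>} \<rho>"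
    and der: "AE t in lborel. 0 < t \<and> t < \<tau> \<longrightarrow> (\<rho> has_vector_derivative \<rho>\<^sub>t t) (at t)"
    and M: "0 \<le> M"
    and b1: "\<And>s. s \<in> {0<..\<tau>} \<Longrightarrow> s * norm (\<rho> s) \<le> M"
    and b2: "\<And>s. s \<in> {0<..\<tau>} \<Longrightarrow> s\<^sup>2 * norm (\<rho>\<^sub>t s) \<le> M"
    and c: "1 / 2 \<le> c" "c < 1" and s: "s \<in> {0..\<tau>}"
  shows "norm (integral {0..c * s} \<rho> - integral {0..s} \<rho>) \<le> 2 * (1 - c) * M"
    and "norm (integral {0..c * (c * s)} \<rho> - 2 *\<^sub>R integral {0..c * s} \<rho> + integral {0..s} \<rho>)
      \<le> 12 * (1 - c)\<^sup>2 * M"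
proof -
  consider "s = 0" | "0 < s" using s by fastforce
  then have "norm (integral {0..c * s} \<rho> - integral {0..s} \<rho>) \<le> 2 * (1 - c) * M \<and>
    norm (integral {0..c * (c * s)} \<rho> - 2 *\<^sub>R integral {0..c * s} \<rho> + integral {0..s} \<rho>)
      \<le> 12 * (1 - c)\<^sup>2 * M"
  proof cases
    case 1
    then show ?thesis using c M by simp
  next
    case 2
    have \<tau>: "s \<le> \<tau>" using s by simp
    define d where "d = 1 - c"
    have d: "0 \<le> d" using c by (simp add: d_def)
    define p where "p = c * s"
    have p: "0 < p" "p \<le> s" "s \<le> 2 * p" using 2 c by (auto simp: p_def mult_left_le_one_le)
    have cp: "0 < c * p" "c * p \<le> p" using p c by (auto simp: mult_left_le_one_le)
    have sp: "s - p = d * s" by (simp add: p_def d_def algebra_simps)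
    have cont: "continuous_on {u..v} \<rho>" if "0 < u" "v \<le> \<tau>" for u v
      using that by (rule locally_absolutely_continuous_on_imp_continuous_on[OF ac])
    have comb: "integral {0..u} \<rho> + integral {u..v} \<rho> = integral {0..v} \<rho>" if "0 \<le> u" "u \<le> v" "v \<le> \<tau>" for u v
      using that by (intro Henstock_Kurzweil_Integration.integral_combine integrable_on_subinterval[OF int]) auto
    have n1: "norm (\<rho> x) \<le> M / x" if "0 < x" "x \<le> \<tau>" for x
      using b1[of x] that by (simp add: field_simps)
    have "norm (integral {p..s} \<rho>) \<le> (M / p) * (s - p)"
    proof (rule integral_bound)
      show "norm (\<rho> x) \<le> M / p" if "x \<in> {p..s}" for x
        using n1[of x] that p \<tau> M divide_left_mono[of p x M] by (force intro: order_trans)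
    qed (use p \<tau> cont in auto)
    also have "(M / p) * (s - p) \<le> 2 * d * M"
    proof -
      have "(M / p) * (s - p) = d * M * (s / p)" by (simp add: sp)
      also have "\<dots> \<le> d * M * 2" using d M p by (intro mult_left_mono mult_nonneg_nonneg) (simp_all add: field_simps)
      finally show ?thesis by simp
    qed
    finally have r1: "norm (integral {p..s} \<rho>) \<le> 2 * d * M" .
    have d1: "integral {0..p} \<rho> - integral {0..s} \<rho> = - integral {p..s} \<rho>"
      using comb[of p s] p \<tau> by (simp add: algebra_simps)
    have img: "(\<lambda>x. x / c) ` {c * p..p} = {p..s}"
      using c 2 by (subst image_divide_atLeastAtMost) (auto simp: p_def)
    have "((\<lambda>x. \<rho> (c * x)) has_integral (1 / \<bar>c\<bar>) *\<^sub>R integral {c * p..p} \<rho>) {p..s}"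
      using cp p \<tau> c unfolding img[symmetric]
      by (intro has_integral_stretch_real integrable_integral integrable_continuous_real cont) auto
    then have "((\<lambda>x. c *\<^sub>R \<rho> (c * x)) has_integral c *\<^sub>R (1 / \<bar>c\<bar>) *\<^sub>R integral {c * p..p} \<rho>) {p..s}"
      by (rule has_integral_cmul)
    then have st: "((\<lambda>x. c *\<^sub>R \<rho> (c * x)) has_integral integral {c * p..p} \<rho>) {p..s}"
      using c by simp
    moreover have "(\<rho> has_integral integral {p..s} \<rho>) {p..s}"
      using p \<tau> by (intro integrable_integral integrable_continuous_real cont) auto
    ultimately have diff: "((\<lambda>x. \<rho> x - c *\<^sub>R \<rho> (c * x)) has_integral
        (integral {p..s} \<rho> - integral {c * p..p} \<rho>)) {p..s}"
      by (intro has_integral_diff)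
    have pt: "norm (\<rho> x - c *\<^sub>R \<rho> (c * x)) \<le> 12 * d * M / s" if x: "x \<in> {p..s}" for x
    proof -
      have x0: "0 < x" "x \<le> \<tau>" "s / 2 \<le> x" using x p \<tau> by auto
      have cx: "0 < c * x" "c * x \<le> x" "c * x \<le> \<tau>" "s / 4 \<le> c * x"
      proof -
        show "0 < c * x" "c * x \<le> x" using x0 c by (auto simp: mult_left_le_one_le)
        then show "c * x \<le> \<tau>" using x0 by linarith
        have "1 / 2 * (s / 2) \<le> c * x" using x0 c 2 by (intro mult_mono) auto
        then show "s / 4 \<le> c * x" by simp
      qed
      have "norm (\<rho> x - \<rho> (c * x)) \<le> (M / (c * x)\<^sup>2) * (x - c * x)"
      proof (rule absolutely_continuous_norm_diff_le)
        show "absolutely_continuous_on {c * x..x} \<rho>"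
          using cx x0 by (intro locally_absolutely_continuous_onD[OF ac]) auto
        show "AE t in lborel. c * x < t \<and> t < x \<longrightarrow>
            (\<exists>D. (\<rho> has_vector_derivative D) (at t) \<and> norm D \<le> M / (c * x)\<^sup>2)"
          using der
        proof eventually_elim
          case (elim t)
          show ?case
          proof (intro impI exI[of _ "\<rho>\<^sub>t t"] conjI)
            assume t: "c * x < t \<and> t < x"
            then have t0: "0 < t" "t \<le> \<tau>" using cx x0 by auto
            show "(\<rho> has_vector_derivative \<rho>\<^sub>t t) (at t)" using elim t t0 x0 by auto
            have "norm (\<rho>\<^sub>t t) \<le> M / t\<^sup>2" using b2[of t] t0 by (simp add: field_simps)
            also have "\<dots> \<le> M / (c * x)\<^sup>2"
              using t cx M by (intro divide_left_mono power_mono mult_pos_pos) (auto simp: zero_less_power2)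
            finally show "norm (\<rho>\<^sub>t t) \<le> M / (c * x)\<^sup>2" .
          qed
        qed
      qed (use cx M in auto)
      also have "(M / (c * x)\<^sup>2) * (x - c * x) = d * M * (1 / c) / (c * x)"
        using x0 c by (simp add: d_def field_simps power2_eq_square)
      also have "\<dots> \<le> d * M * 2 / (s / 4)"
        using c d M cx 2 by (intro frac_le mult_left_mono mult_nonneg_nonneg) (auto simp: field_simps)
      finally have a: "norm (\<rho> x - \<rho> (c * x)) \<le> 8 * d * M / s" by simp
      have "norm (d *\<^sub>R \<rho> (c * x)) \<le> d * (M / (c * x))"
        using mult_left_mono[OF n1[of "c * x"] d] cx d by simp
      also have "\<dots> \<le> d * (M / (s / 4))"
        using d M cx 2 by (intro mult_left_mono divide_left_mono) auto
      finally have b: "norm (d *\<^sub>R \<rho> (c * x)) \<le> 4 * d * M / s" by (simp add: mult_ac)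
      have "\<rho> x - c *\<^sub>R \<rho> (c * x) = (\<rho> x - \<rho> (c * x)) + d *\<^sub>R \<rho> (c * x)"
        by (simp add: d_def algebra_simps)
      then have "norm (\<rho> x - c *\<^sub>R \<rho> (c * x)) \<le> norm (\<rho> x - \<rho> (c * x)) + norm (d *\<^sub>R \<rho> (c * x))"
        by (metis norm_triangle_ineq)
      also have "\<dots> \<le> 8 * d * M / s + 4 * d * M / s" using a b by linarith
      finally show ?thesis by (simp add: add_divide_distrib[symmetric] mult_ac)
    qed
    have "norm (integral {p..s} (\<lambda>x. \<rho> x - c *\<^sub>R \<rho> (c * x))) \<le> (12 * d * M / s) * (s - p)"
    proof (rule integral_bound)
      show "continuous_on {p..s} (\<lambda>x. \<rho> x - c *\<^sub>R \<rho> (c * x))"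
      proof (intro continuous_intros cont continuous_on_compose2[OF cont[of "c * p" p]])
        show "(\<lambda>x. c * x) ` {p..s} \<subseteq> {c * p..p}"
          using c by (auto simp: p_def intro: mult_left_mono)
      qed (use p cp \<tau> in auto)
    qed (use p pt in auto)
    also have "\<dots> = 12 * d\<^sup>2 * M" using 2 by (simp add: sp power2_eq_square)
    finally have r2: "norm (integral {p..s} \<rho> - integral {c * p..p} \<rho>) \<le> 12 * d\<^sup>2 * M"
      using diff by (simp add: integral_unique)
    have "integral {0..c * p} \<rho> - 2 *\<^sub>R integral {0..p} \<rho> + integral {0..s} \<rho>
        = integral {p..s} \<rho> - integral {c * p..p} \<rho>"
    proof -
      have "X - 2 *\<^sub>R Y + Z = V - U" if "X + U = Y" "Y + V = Z" for X Y Z U V :: 'a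
        using that(1) unfolding that(2)[symmetric] by (auto simp: scaleR_2)
      then show ?thesis using comb[of p s] comb[of "c * p" p] cp p \<tau> by simp
    qed
    then show ?thesis using r1 r2 d1 unfolding p_def[symmetric] d_def[symmetric] by simp
  qed
  then show "norm (integral {0..c * s} \<rho> - integral {0..s} \<rho>) \<le> 2 * (1 - c) * M"
    "norm (integral {0..c * (c * s)} \<rho> - 2 *\<^sub>R integral {0..c * s} \<rho> + integral {0..s} \<rho>)
      \<le> 12 * (1 - c)\<^sup>2 * M" by auto
qed

text \<open>The difference of the two sides is absolutely continuous on compact subintervals of \<open>(0,T]\<close> with
  derivative zero almost everywhere, hence constant there; it is continuous up to time zero and
  vanishes there, although \<open>\<rho>\<close> need not be bounded near zero.\<close>

lemma (in multi_term_relaxation) integrated_lhs_eq_integral: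
  fixes e \<rho> :: "real \<Rightarrow> 'a"
  assumes T: "0 < T" and e: "continuous_on {0..T} e" and Ae0: "A (e 0) = 0"
    and cap: "\<And>i. i \<in> I \<Longrightarrow> caputo_differentiable (\<gamma> i) T e"
    and int: "\<rho> integrable_on {0..T}" and ac: "locally_absolutely_continuous_on {0<..T} \<rho>"
    and eq: "AE t in lborel. 0 < t \<and> t < T \<longrightarrow>
      (\<forall>i\<in>I. caputo_primitive (\<gamma> i) e differentiable (at t)) \<longrightarrow>
      A (\<Sum>i\<in>I. b i *\<^sub>R caputo (\<gamma> i) e t) + e t = \<rho> t"
    and t: "t \<in> {0..T}"
  shows "integrated_lhs e t = integral {0..t} \<rho>"
proof -
  define q where "q i = caputo_primitive (\<gamma> i) e" for i
  have Aq: "A (q i s) = A (frac_int (1 - \<gamma> i) e s)" if i: "i \<in> I" and s: "s \<in> {0..T}" for i s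
  proof -
    have es: "continuous_on {0..s} e" using s by (intro continuous_on_subset[OF e]) auto
    have "A (q i s) = A (frac_int (1 - \<gamma> i) (\<lambda>r. e r - e 0) s)"
      by (simp add: q_def caputo_primitive_def frac_int_def)
    also have "\<dots> = frac_int (1 - \<gamma> i) (\<lambda>r. A (e r - e 0)) s"
      using \<gamma>[OF i] s es A by (intro frac_int_bounded_linear[symmetric] continuous_intros) auto
    also have "\<dots> = frac_int (1 - \<gamma> i) (\<lambda>r. A (e r)) s"
      by (simp add: linear_simps[OF A] Ae0)
    also have "\<dots> = A (frac_int (1 - \<gamma> i) e s)"
      using \<gamma>[OF i] s es A by (intro frac_int_bounded_linear) auto
    finally show ?thesis .
  qed
  define F where "F s = (\<Sum>i\<in>I. b i *\<^sub>R A (q i s)) + integral {0..s} e" for s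
  have F: "integrated_lhs e s = F s" if "s \<in> {0..T}" for s
    using that by (simp add: integrated_lhs_def memory_term_def F_def frac_int_one Aq)
  define G where "G s = F s - integral {0..s} \<rho>" for s
  have cont\<rho>: "continuous_on {u..v} \<rho>" if "0 < u" "v \<le> T" for u v
    using that by (rule locally_absolutely_continuous_on_imp_continuous_on[OF ac])
  have comb: "integral {0..v} f - integral {0..u} f = integral {u..v} f"
    if "f integrable_on {0..T}" "0 \<le> u" "u \<le> v" "v \<le> T" for u v and f :: "real \<Rightarrow> 'a"
    using that Henstock_Kurzweil_Integration.integral_combine[of 0 u v f] integrable_on_subinterval[of f "{0..T}" 0 v]
    by (auto simp: algebra_simps)
  have ei: "e integrable_on {0..T}" by (intro integrable_continuous_real e)
  obtain KA where KA: "0 < KA" "\<And>x. norm (A x) \<le> KA * norm x"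
    using bounded_linear.pos_bounded[OF A] by (metis mult.commute)
  have const: "G v = G u" if uv: "0 < u" "u \<le> v" "v \<le> T" for u v
  proof -
    have sub: "{u..v} \<subseteq> {0<..T}" using uv by auto
    obtain Be where Be: "0 < Be" "\<And>s. s \<in> {u..v} \<Longrightarrow> norm (e s) \<le> Be"
      using compact_imp_bounded[OF compact_continuous_image[OF continuous_on_subset[OF e, of "{u..v}"]]] uv
      by (force simp: bounded_pos)
    obtain Br where Br: "0 < Br" "\<And>s. s \<in> {u..v} \<Longrightarrow> norm (\<rho> s) \<le> Br"
      using compact_imp_bounded[OF compact_continuous_image[OF cont\<rho>[OF uv(1,3)]]]
      by (force simp: bounded_pos)
    define K where "K = (\<Sum>i\<in>I. b i * KA) + Be + Br"
    have S0: "0 \<le> (\<Sum>i\<in>I. b i * KA)" using b KA(1) by (intro sum_nonneg) (simp add: less_imp_le)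
    have K: "0 < K" using S0 Be Br by (simp add: K_def)
    have "absolutely_continuous_on {u..v} G"
    proof (rule absolutely_continuous_on_dominated[OF I _ K])
      fix i assume i: "i \<in> I"
      show "absolutely_continuous_on {u..v} (q i)"
        using cap[OF i] sub unfolding caputo_differentiable_def q_def
        by (intro locally_absolutely_continuous_onD) auto
    next
      fix x y assume xy: "x \<in> {u..v}" "y \<in> {u..v}" "x \<le> y"
      have "G y - G x = (\<Sum>i\<in>I. b i *\<^sub>R A (q i y - q i x)) + (integral {x..y} e - integral {x..y} \<rho>)"
      proof -
        have "integral {0..y} e = integral {0..x} e + integral {x..y} e"
          "integral {0..y} \<rho> = integral {0..x} \<rho> + integral {x..y} \<rho>"
          using comb[OF ei, of x y] comb[OF int, of x y] xy uv by (auto simp: algebra_simps)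
        then show ?thesis
          by (simp add: G_def F_def linear_simps[OF A] scaleR_right_diff_distrib sum_subtractf)
      qed
      moreover have "norm (\<Sum>i\<in>I. b i *\<^sub>R A (q i y - q i x)) \<le> (\<Sum>i\<in>I. b i * KA) * (\<Sum>i\<in>I. norm (q i y - q i x))"
      proof -
        have "norm (\<Sum>i\<in>I. b i *\<^sub>R A (q i y - q i x)) \<le> (\<Sum>i\<in>I. b i * KA * norm (q i y - q i x))"
        proof (rule sum_norm_le)
          fix i assume i: "i \<in> I"
          show "norm (b i *\<^sub>R A (q i y - q i x)) \<le> b i * KA * norm (q i y - q i x)"
            using b[OF i] KA(2)[of "q i y - q i x"] by (simp add: mult.assoc mult_left_mono)
        qed
        also have "\<dots> \<le> (\<Sum>i\<in>I. b i * KA * (\<Sum>j\<in>I. norm (q j y - q j x)))"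
          using b KA(1) I by (intro sum_mono mult_left_mono member_le_sum) (auto simp: less_imp_le)
        finally show ?thesis by (simp add: sum_distrib_right)
      qed
      moreover have "norm (integral {x..y} e) \<le> Be * (y - x)"
        using xy uv Be by (intro integral_bound continuous_on_subset[OF e]) auto
      moreover have "norm (integral {x..y} \<rho>) \<le> Br * (y - x)"
        using xy uv Br by (intro integral_bound cont\<rho>) auto
      ultimately have "norm (G y - G x) \<le> (\<Sum>i\<in>I. b i * KA) * (\<Sum>i\<in>I. norm (q i y - q i x)) + (Be + Br) * (y - x)"
        using norm_triangle_ineq[of "\<Sum>i\<in>I. b i *\<^sub>R A (q i y - q i x)" "integral {x..y} e - integral {x..y} \<rho>"]
          norm_triangle_ineq4[of "integral {x..y} e" "integral {x..y} \<rho>"]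
        by (simp add: distrib_right)
      also have "\<dots> \<le> K * (\<Sum>i\<in>I. norm (q i y - q i x)) + K * (y - x)"
        using S0 Be Br xy by (intro add_mono mult_right_mono sum_nonneg) (auto simp: K_def)
      finally show "norm (G y - G x) \<le> K * ((\<Sum>i\<in>I. norm (q i y - q i x)) + (y - x))"
        by (simp add: distrib_left)
    qed
    moreover have "AE s in lborel. u < s \<and> s < v \<longrightarrow> (\<exists>D. (G has_vector_derivative D) (at s) \<and> norm D \<le> 0)"
    proof -
      have "AE s in lborel. \<forall>i\<in>I. 0 < s \<and> s < T \<longrightarrow> q i differentiable (at s)"
        using cap I by (intro AE_finite_allI) (auto simp: caputo_differentiable_def q_def)
      then show ?thesis using eq
      proof eventually_elim
        case (elim s)
        show ?case
        proof
          assume s: "u < s \<and> s < v"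
          then have s0: "0 < s" "s < T" using uv by auto
          have dq: "(q i has_vector_derivative caputo (\<gamma> i) e s) (at s)" if "i \<in> I" for i
            using elim(1) that s0 unfolding caputo_def q_def by (simp add: vector_derivative_works)
          have "((\<lambda>s. \<Sum>i\<in>I. b i *\<^sub>R A (q i s)) has_vector_derivative (\<Sum>i\<in>I. b i *\<^sub>R A (caputo (\<gamma> i) e s))) (at s)"
            by (intro has_vector_derivative_sum bounded_linear.has_vector_derivative[OF bounded_linear_scaleR_right]
                bounded_linear.has_vector_derivative[OF A] dq)
          moreover have "((\<lambda>s. integral {0..s} e) has_vector_derivative e s) (at s)"
            using integral_has_vector_derivative[OF e, of s] s0 by (simp add: at_within_Icc_at)
          moreover have "((\<lambda>s. integral {0..s} \<rho>) has_vector_derivative \<rho> s) (at s)"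
          proof -
            have "continuous (at s) \<rho>"
              using cont\<rho>[OF uv(1,3)] s by (intro continuous_on_interior) auto
            then have "((\<lambda>s. integral {0..s} \<rho>) has_vector_derivative \<rho> s) (at s within {0..T})"
              using int s0 by (intro integral_has_vector_derivative_continuous_at[where S = "{}", simplified])
                (auto intro: continuous_at_imp_continuous_at_within)
            then show ?thesis using s0 by (simp add: at_within_Icc_at)
          qed
          ultimately have "(G has_vector_derivative
              ((\<Sum>i\<in>I. b i *\<^sub>R A (caputo (\<gamma> i) e s)) + e s - \<rho> s)) (at s)"
            unfolding G_def F_def by (intro has_vector_derivative_diff has_vector_derivative_add)
          moreover have "(\<Sum>i\<in>I. b i *\<^sub>R A (caputo (\<gamma> i) e s)) + e s - \<rho> s = 0"
          proof -
            have "A (\<Sum>i\<in>I. b i *\<^sub>R caputo (\<gamma> i) e s) = (\<Sum>i\<in>I. b i *\<^sub>R A (caputo (\<gamma> i) e s))"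
              by (simp add: linear_sum[OF bounded_linear.linear[OF A]] linear_simps[OF A])
            then show ?thesis using elim s0 by (simp add: q_def)
          qed
          ultimately show "\<exists>D. (G has_vector_derivative D) (at s) \<and> norm D \<le> 0" by auto
        qed
      qed
    qed
    ultimately have "norm (G v - G u) \<le> 0 * (v - u)"
      using uv by (intro absolutely_continuous_norm_diff_le) auto
    then show ?thesis by simp
  qed
  have "continuous_on {0..T} (\<lambda>s. integrated_lhs e s - integral {0..s} \<rho>)"
    by (intro continuous_intros integrated_lhs_continuous_on e indefinite_integral_continuous_1 int)
  then have contG: "continuous_on {0..T} G"
    by (rule continuous_on_eq) (simp add: F G_def)
  have "G s = G T" if "s \<in> {0..T}" for s
  proof (rule continuous_constant_on_closure[of "{0<..T}"])
    show "continuous_on (closure {0<..T}) G" using contG T by simp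
    show "s \<in> closure {0<..T}" using that T by simp
    show "G x = G T" if "x \<in> {0<..T}" for x using const[of x T] that by simp
  qed
  from this[OF t] this[of 0] have "G t = G 0" using T by simp
  also have "\<dots> = 0" using T F[of 0] by (simp add: G_def integrated_lhs_def memory_term_def frac_int_def linear_simps[OF A])
  finally show ?thesis using F[OF t] by (simp add: G_def)
qed

theorem lemma6p1:
  fixes T \<alpha> :: real and m :: nat and \<alpha>s b :: "nat \<Rightarrow> real"
  assumes "0 < T"
    and "0 < \<alpha>" and "\<alpha> < 1"
    and "\<And>i. i \<in> {1..m} \<Longrightarrow> 0 < \<alpha>s i \<and> \<alpha>s i \<le> \<alpha>"
    and "\<And>i j. i \<in> {1..m} \<Longrightarrow> j \<in> {1..m} \<Longrightarrow> i \<le> j \<Longrightarrow> \<alpha>s j \<le> \<alpha>s i"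
    and "\<And>i. i \<in> {1..m} \<Longrightarrow> 0 < b i"
  shows "\<exists>C>0. \<forall>(\<Omega> :: (real^2) set) (V :: real \<Rightarrow> l2_plane set) (Th :: real \<Rightarrow> l2_plane \<Rightarrow> l2_plane).
    open \<Omega> \<and> connected \<Omega> \<and> bounded \<Omega> \<and> \<Omega> \<noteq> {} \<and>
    (\<forall>h. 0 < h \<and> h < 1 \<longrightarrow> discrete_space \<Omega> (V h) \<and> solution_operator \<Omega> (V h) (Th h)) \<longrightarrow>
    (\<forall>h (e :: real \<Rightarrow> l2_plane) (\<rho> :: real \<Rightarrow> l2_plane) (\<rho>\<^sub>t :: real \<Rightarrow> l2_plane).
      0 < h \<and> h < 1 \<and>
      continuous_on {0..T} e \<and> e \<in> {0..T} \<rightarrow> L2 \<Omega> \<and>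
      (\<forall>\<nu> \<in> insert \<alpha> (\<alpha>s ` {1..m}). caputo_differentiable \<nu> T e) \<and>
      \<rho> \<in> {0<..T} \<rightarrow> L2 \<Omega> \<and> \<rho>\<^sub>t \<in> {0<..T} \<rightarrow> L2 \<Omega> \<and>
      \<rho> integrable_on {0..T} \<and>
      locally_absolutely_continuous_on {0<..T} \<rho> \<and>
      (AE t in lborel. 0 < t \<and> t < T \<longrightarrow> (\<rho> has_vector_derivative \<rho>\<^sub>t t) (at t)) \<and>
      (AE t in lborel. 0 < t \<and> t < T \<longrightarrow> Th h (P_caputo \<alpha> m \<alpha>s b e t) + e t = \<rho> t) \<and>
      Th h (e 0) = 0 \<longrightarrow>
      (\<forall>t. 0 < t \<and> t \<le> T \<longrightarrow>
        ennreal (norm (e t)) \<le> ennreal (C / t) *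
          (SUP s\<in>{0<..t}. ennreal (norm (integral {0..s} \<rho>) + s * norm (\<rho> s) + s\<^sup>2 * norm (\<rho>\<^sub>t s)))))"
proof -
  define I where "I = {0..m}"
  \<comment> \<open>The leading term \<open>\<partial>\<^sub>t\<^sup>\<alpha>\<close> joins the sum as the term with index 0 and coefficient 1.\<close>
  define \<gamma> where "\<gamma> i = (if i = 0 then \<alpha> else \<alpha>s i)" for i
  define b' where "b' i = (if i = 0 then 1 else b i)" for i
  have \<gamma>: "0 < \<gamma> i \<and> \<gamma> i < 1" if "i \<in> I" for i
    using that assms(2,3) assms(4)[of i] by (auto simp: \<gamma>_def I_def)
  have b': "0 < b' i" if "i \<in> I" for i
    using that assms(6)[of i] by (auto simp: b'_def I_def)
  have \<gamma>_mem: "\<gamma> i \<in> insert \<alpha> (\<alpha>s ` {1..m})" if "i \<in> I" for i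
    using that by (auto simp: \<gamma>_def I_def)
  have P_sum: "P_caputo \<alpha> m \<alpha>s b e t = (\<Sum>i\<in>I. b' i *\<^sub>R caputo (\<gamma> i) e t)"
    for e :: "real \<Rightarrow> l2_plane" and t
  proof -
    have "(\<Sum>i\<in>I. b' i *\<^sub>R caputo (\<gamma> i) e t) = b' 0 *\<^sub>R caputo (\<gamma> 0) e t + (\<Sum>i=1..m. b' i *\<^sub>R caputo (\<gamma> i) e t)"
      unfolding I_def by (subst sum.atLeast_Suc_atMost) auto
    also have "(\<Sum>i=1..m. b' i *\<^sub>R caputo (\<gamma> i) e t) = (\<Sum>i=1..m. b i *\<^sub>R caputo (\<alpha>s i) e t)"
      by (intro sum.cong) (auto simp: b'_def \<gamma>_def)
    finally show ?thesis by (simp add: P_caputo_def b'_def \<gamma>_def)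
  qed
  define C where "C = 2 * sqrt (3 * first_difference_const (card I) + second_difference_const (card I))"
  have Cpos: "0 < C"
    unfolding C_def first_difference_const_def second_difference_const_def by (simp add: add_pos_nonneg)
  have main: "ennreal (norm (e t)) \<le> ennreal (C / t) *
      (SUP s\<in>{0<..t}. ennreal (norm (integral {0..s} \<rho>) + s * norm (\<rho> s) + s\<^sup>2 * norm (\<rho>\<^sub>t s)))"
    if \<Omega>: "open \<Omega>" and V: "discrete_space \<Omega> V" and Th: "solution_operator \<Omega> V Th"
      and e: "continuous_on {0..T} e" and eL: "e \<in> {0..T} \<rightarrow> L2 \<Omega>"
      and cap: "\<forall>\<nu> \<in> insert \<alpha> (\<alpha>s ` {1..m}). caputo_differentiable \<nu> T e"
      and int: "\<rho> integrable_on {0..T}" and ac: "locally_absolutely_continuous_on {0<..T} \<rho>"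
      and der: "AE t in lborel. 0 < t \<and> t < T \<longrightarrow> (\<rho> has_vector_derivative \<rho>\<^sub>t t) (at t)"
      and eq: "AE t in lborel. 0 < t \<and> t < T \<longrightarrow> Th (P_caputo \<alpha> m \<alpha>s b e t) + e t = \<rho> t"
      and e0: "Th (e 0) = 0" and t: "0 < t" "t \<le> T"
    for \<Omega> V Th e t and \<rho> \<rho>\<^sub>t :: "real \<Rightarrow> l2_plane"
  proof -
    have \<Omega>m: "\<Omega> \<in> sets lebesgue" using \<Omega> by simp
    obtain n :: nat and \<eta> where \<eta>: "\<And>u. u \<in> L2 \<Omega> \<Longrightarrow> Th u = (\<Sum>k<n. inner u (\<eta> k) *\<^sub>R \<eta> k)"
      using solution_operator_finite_rank[OF V Th \<Omega>m] by blast
    define A where "A u = (\<Sum>k<n. inner u (\<eta> k) *\<^sub>R \<eta> k)" for u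
    have ThA: "Th u = A u" if "u \<in> L2 \<Omega>" for u using \<eta>[OF that] by (simp add: A_def)
    interpret multi_term_relaxation A I \<gamma> b'
      using finite_rank_forms[OF A_def] \<gamma> b' by (intro multi_term_relaxation.intro) (auto simp: I_def)
    have prim: "caputo_primitive \<nu> e s \<in> L2 \<Omega>" if "s \<le> T" for \<nu> s
      unfolding caputo_primitive_def
    proof (rule integral_mem_L2[OF \<Omega>m])
      fix x assume "x \<in> {0..s}"
      then have "e x \<in> L2 \<Omega>" "e 0 \<in> L2 \<Omega>" using eL that assms(1) by auto
      then show "omega (1 - \<nu>) (s - x) *\<^sub>R (e x - e 0) \<in> L2 \<Omega>"
        using subspace_L2[OF \<Omega>m] by (auto intro!: subspace_scale subspace_diff)
    qed
    \<comment> \<open>Outside \<open>L\<^sup>2(\<Omega>)\<close> the operators \<open>Th\<close> and \<open>A\<close> may differ, so the Caputo derivatives have to be located in it first.\<close>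
  have rep: "integrated_lhs e s = integral {0..s} \<rho>" if "s \<in> {0..T}" for s
    proof (rule integrated_lhs_eq_integral[OF assms(1) e _ _ int ac _ that])
      show "A (e 0) = 0" using e0 ThA[of "e 0"] eL assms(1) by (auto simp: Pi_iff)
      show "caputo_differentiable (\<gamma> i) T e" if "i \<in> I" for i using cap \<gamma>_mem[OF that] by blast
      show "AE t in lborel. 0 < t \<and> t < T \<longrightarrow>
          (\<forall>i\<in>I. caputo_primitive (\<gamma> i) e differentiable (at t)) \<longrightarrow>
          A (\<Sum>i\<in>I. b' i *\<^sub>R caputo (\<gamma> i) e t) + e t = \<rho> t"
        using eq
      proof eventually_elim
        case (elim s)
        show ?case
        proof (intro impI)
          assume s: "0 < s \<and> s < T" and d: "\<forall>i\<in>I. caputo_primitive (\<gamma> i) e differentiable (at s)"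
          have "caputo (\<gamma> i) e s \<in> L2 \<Omega>" if "i \<in> I" for i
          proof (rule has_vector_derivative_mem_L2[OF \<Omega>m])
            show "caputo_primitive (\<gamma> i) e r \<in> L2 \<Omega>" if "r \<in> {0<..<T}" for r using that by (intro prim) auto
            show "(caputo_primitive (\<gamma> i) e has_vector_derivative caputo (\<gamma> i) e s) (at s)"
              using d that unfolding caputo_def by (simp add: vector_derivative_works)
          qed (use s in auto)
          then have "(\<Sum>i\<in>I. b' i *\<^sub>R caputo (\<gamma> i) e s) \<in> L2 \<Omega>"
            using subspace_L2[OF \<Omega>m] by (intro subspace_sum subspace_scale) auto
          then show "A (\<Sum>i\<in>I. b' i *\<^sub>R caputo (\<gamma> i) e s) + e s = \<rho> s"
            using elim s ThA P_sum[of e s] by simp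
        qed
      qed
    qed
    define \<Phi> where "\<Phi> s = norm (integral {0..s} \<rho>) + s * norm (\<rho> s) + s\<^sup>2 * norm (\<rho>\<^sub>t s)" for s
    define S where "S = (SUP s\<in>{0<..t}. ennreal (\<Phi> s))"
    have "ennreal (norm (e t)) \<le> ennreal (C / t) * S"
    proof (cases "S = \<infinity>")
      case True
      then show ?thesis using Cpos t by (simp add: ennreal_mult_top)
    next
      case False
      define M where "M = enn2real S"
      have SM: "S = ennreal M" using False by (simp add: M_def less_top)
      have M0: "0 \<le> M" by (simp add: M_def)
      have \<Phi>M: "\<Phi> s \<le> M" if "s \<in> {0<..t}" for s
      proof -
        have "ennreal (\<Phi> s) \<le> ennreal M" unfolding SM[symmetric] S_def by (rule SUP_upper[OF that])
        then show ?thesis using M0 by (simp add: ennreal_le_iff)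
      qed
      have bnd: "norm (integral {0..s} \<rho>) \<le> M" "s * norm (\<rho> s) \<le> M" "s\<^sup>2 * norm (\<rho>\<^sub>t s) \<le> M"
        if "s \<in> {0<..t}" for s
      proof -
        have "0 \<le> s * norm (\<rho> s)" "0 \<le> s\<^sup>2 * norm (\<rho>\<^sub>t s)" "0 \<le> norm (integral {0..s} \<rho>)" using that by auto
        then show "norm (integral {0..s} \<rho>) \<le> M" "s * norm (\<rho> s) \<le> M" "s\<^sup>2 * norm (\<rho>\<^sub>t s) \<le> M"
          using \<Phi>M[OF that] unfolding \<Phi>_def by linarith+
      qed
      have rep': "integrated_lhs e s = integral {0..s} \<rho>" if "s \<in> {0..t}" for s using rep[of s] that t by auto
      have intt: "\<rho> integrable_on {0..t}" using t by (intro integrable_on_subinterval[OF int]) auto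
      have act: "locally_absolutely_continuous_on {0<..t} \<rho>"
        unfolding locally_absolutely_continuous_on_def
      proof (intro allI impI)
        fix u v assume "{u..v} \<subseteq> {0<..t}"
        also have "{0<..t} \<subseteq> {0<..T}" using t by auto
        finally show "absolutely_continuous_on {u..v} \<rho>" by (rule locally_absolutely_continuous_onD[OF ac])
      qed
      have dert: "AE s in lborel. 0 < s \<and> s < t \<longrightarrow> (\<rho> has_vector_derivative \<rho>\<^sub>t s) (at s)"
        using der by eventually_elim (use t in auto)
      note diffs = integral_difference_bounds[OF intt act dert M0 bnd(2,3)]
      have "t * norm (e t) \<le> 2 * sqrt (3 * first_difference_const (card I) + second_difference_const (card I)) * M"
      proof (rule pointwise_bound[OF t(1) continuous_on_subset[OF e] M0])
        show "norm (integrated_lhs e s) \<le> M" if s: "s \<in> {0..t}" for s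
          using bnd(1)[of s] s M0 rep'[OF s] by (cases "s = 0") auto
      next
        fix c s :: real assume c: "1 / 2 \<le> c" "c < 1" and s: "s \<in> {0..t}"
        have cs: "c * s \<in> {0..t}" "c * (c * s) \<in> {0..t}"
          using c s by (auto intro!: dilate_mem simp del: atLeastAtMost_iff)
        show "norm (integrated_lhs e (c * s) - integrated_lhs e s) \<le> 2 * (1 - c) * M"
          unfolding rep'[OF s] rep'[OF cs(1)] by (rule diffs(1)[OF _ _ c s])
        show "norm (integrated_lhs e (c * (c * s)) - 2 *\<^sub>R integrated_lhs e (c * s) + integrated_lhs e s) \<le> 12 * (1 - c)\<^sup>2 * M"
          unfolding rep'[OF s] rep'[OF cs(1)] rep'[OF cs(2)] by (rule diffs(2)[OF _ _ c s])
      qed (use t in auto)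
      then have "norm (e t) \<le> C / t * M"
        using t by (simp add: C_def field_simps)
      then show ?thesis
        unfolding SM using Cpos t M0 by (simp add: ennreal_mult[symmetric] ennreal_leI)
    qed
    then show ?thesis by (simp add: S_def \<Phi>_def)
  qed
  show ?thesis
  proof (rule exI[of _ C], rule conjI[OF Cpos], intro allI impI, elim conjE, goal_cases)
    case (1 \<Omega> V Th h e \<rho> \<rho>\<^sub>t t)
    then have "discrete_space \<Omega> (V h)" "solution_operator \<Omega> (V h) (Th h)" by blast+
    then show ?case using 1 by (intro main[of \<Omega> "V h" "Th h" e \<rho> \<rho>\<^sub>t t])
  qed
qed

end
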